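(* Let $D$ be any (oriented) knot diagram with ordered crossings and a basepoint away from the crossings, and let $c(D)$ be its number of crossings. There is a spectral sequence $E_r^{*,*}$ that converges to the reduced Khovanov homology $\widetilde{H}^{*,*}(D;\mathbb{Z})$, such that as groups $E_1^{*,*}\cong\mathcal{C}^*_*(D)$, where $\mathcal{C}(D)$ is the group freely generated by the spanning trees of the Tait graph of $D$, and the spectral sequence collapses for some $r\le c(D)$.
   Context: **Tait graph.** A connected link diagram $D$ is checkerboard colored; its Tait graph $G$ is the planar graph with one vertex per shaded region and one edge per crossing. An edge is positive if the $A$-smoothing of its crossing joins the shaded regions, and negative otherwise. The coloring is chosen so that the number of positive edges is at least the number of negative edges. An order on the crossings gives an order on the edges. **Activities.** Let $T$ be a spanning tree of $G$. For $e\in T$, $cut(T,e)$ is the set of edges of $G$ connecting the two components of $T\setminus e$ (including $e$); for $f\notin T$, $cyc(T,f)$ is the set of edges of the unique cycle in $T\cup f$. An edge $e\in T$ is internally active (live) if it is the lowest edge of $cut(T,e)$, else internally inactive (dead); an edge $e\notin T$ is externally active (live) if it is the lowest edge of $cyc(T,e)$, else externally inactive (dead). Write $L,D,\ell,d$ for a positive edge that is respectively internally active, internally inactive, externally active, externally inactive, and $\bar L,\bar D,\bar\ell,\bar d$ for the same activities of a negative edge. **Spanning tree groups.** For a spanning tree $T$ set $u(T)=\#L-\#\ell-\#\bar L+\#\bar\ell$ and $v(T)=\#L+\#D$. $\mathcal{C}^u_v(D)$ is the free abelian group on the spanning trees $T$ of $G$ with $u(T)=u$, $v(T)=v$, and $\mathcal{C}(D)=\bigoplus_{u,v}\mathcal{C}^u_v(D)$.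 **Reduced Khovanov complex (Viro's conventions).** An enhanced state of $D$ is a choice of $A$- or $B$-smoothing at each crossing together with a sign $\pm$ on each resulting circle. Let $w$ be the writhe of $D$, $\sigma=\#A-\#B$ (smoothings), $\tau=\#(+)-\#(-)$ (circles), $i=(w-\sigma)/2$, $j=i+w-\tau$. The Khovanov complex is free abelian on enhanced states. Its differential has bidegree $(1,0)$: it is the sum, with the standard signs, over all ways of changing one $A$-smoothing to a $B$-smoothing, with merging of circles given by $(-,-)\mapsto -$, $(+,-),(-,+)\mapsto +$, $(+,+)\mapsto 0$ and splitting given by $+\mapsto(+,+)$, $-\mapsto(+,-)+(-,+)$. The reduced complex $\widetilde{C}(D)$ is the subcomplex generated by the enhanced states in which the circle through the basepoint has sign $+$; its homology is $\widetilde H^{i,j}(D)$. **Convention.** "Collapses for some $r\le c(D)$" means $E_r^{*,*}=E_\infty^{*,*}$ for some $r\le c(D)$. The total degree $p+q$ of $E_r^{p,q}$ is the homological degree $i$. *)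

theory Defs
  imports "HOL-Algebra.Free_Abelian_Groups"
begin

section \<open>Oriented knot diagrams\<close>

text \<open>
  An oriented knot diagram with \<open>n\<close> crossings, up to isotopy of the sphere, is given by its signed
  Gauss code. Following the orientation one passes \<open>2n\<close> times through a crossing, at times
  \<open>0, \<dots>, 2n - 1\<close>; for every crossing the code records the time of the passage on the under-strand,
  the time of the passage on the over-strand and the sign. The position of a crossing in the list
  is its place in the chosen order of the crossings. Arc \<open>t\<close> arrives at passage \<open>t\<close>, and
  arc \<open>t + 1\<close> (modulo \<open>2n\<close>) leaves it. The diagram without crossings has the single closed arc \<open>0\<close>.
\<close>

record crossing =
  under :: nat
  over :: nat
  positive :: bool

type_synonym gauss_code = "crossing list"

definition arcs :: "gauss_code \<Rightarrow> nat set" where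
  "arcs D = {..<max 1 (2 * length D)}"

definition out_arc :: "gauss_code \<Rightarrow> nat \<Rightarrow> nat" where
  "out_arc D t = Suc t mod (2 * length D)"

text \<open>
  The four arc ends at crossing \<open>c\<close>, counterclockwise, starting with the incoming under-strand.
  The flag tells whether the arc points away from the crossing. At a positive crossing the
  over-strand runs from left to right as seen along the under-strand.
\<close>

definition arc_ends :: "gauss_code \<Rightarrow> nat \<Rightarrow> (nat \<times> bool) list" where
  "arc_ends D c =
    (let X = D ! c;
         ui = (under X, False); uo = (out_arc D (under X), True);
         oi = (over X, False); oo = (out_arc D (over X), True)
     in if positive X then [ui, oo, uo, oi] else [ui, oi, uo, oo])"

definition glue_classes :: "'a set \<Rightarrow> ('a \<times> 'a) set \<Rightarrow> 'a set set" where
  "glue_classes A R = A // (R \<union> R\<inverse>)\<^sup>*"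

text \<open>
  A side of an arc is a pair of the arc and a flag, \<open>True\<close> for the left and \<open>False\<close> for the right.
  Corner \<open>k\<close> of a crossing lies between the ends \<open>k\<close> and \<open>k + 1\<close> (modulo 4). It is bounded by the
  counterclockwise side of end \<open>k\<close>, which is the left side if the arc points away from the crossing
  and the right side otherwise, and by the clockwise side of end \<open>k + 1\<close>.
  Faces are the classes of sides under the relation of meeting at a corner.
\<close>

definition corner_glue :: "gauss_code \<Rightarrow> ((nat \<times> bool) \<times> (nat \<times> bool)) set" where
  "corner_glue D =
    {(arc_ends D c ! k, (a, \<not> out)) | c k a out.
       c < length D \<and> k < 4 \<and> (a, out) = arc_ends D c ! (Suc k mod 4)}"

definition faces :: "gauss_code \<Rightarrow> (nat \<times> bool) set set" where
  "faces D = glue_classes (arcs D \<times> UNIV) (corner_glue D)"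

definition face_of :: "gauss_code \<Rightarrow> nat \<times> bool \<Rightarrow> (nat \<times> bool) set" where
  "face_of D s = (corner_glue D \<union> (corner_glue D)\<inverse>)\<^sup>* `` {s}"

text \<open>
  Planarity is Euler's formula \<open>n - 2n + F = 2\<close> for the surface obtained by filling in the faces.
\<close>

definition knot_diagram :: "gauss_code \<Rightarrow> bool" where
  "knot_diagram D \<longleftrightarrow>
     distinct (map under D @ map over D) \<and>
     set (map under D @ map over D) = {..<2 * length D} \<and>
     card (faces D) = length D + 2"

definition writhe :: "gauss_code \<Rightarrow> int" where
  "writhe D = (\<Sum>c<length D. if positive (D ! c) then 1 else - 1)"


section \<open>The Tait graph\<close>

definition checkerboard :: "gauss_code \<Rightarrow> (nat \<times> bool) set set \<Rightarrow> bool" where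
  "checkerboard D S \<longleftrightarrow>
     S \<subseteq> faces D \<and>
     (\<forall>a\<in>arcs D. face_of D (a, True) \<in> S \<longleftrightarrow> face_of D (a, False) \<notin> S)"

definition corner_face :: "gauss_code \<Rightarrow> nat \<Rightarrow> nat \<Rightarrow> (nat \<times> bool) set" where
  "corner_face D c k = face_of D (arc_ends D c ! k)"

text \<open>
  The Tait graph has the vertex set \<open>S\<close> of shaded faces and the edge set \<open>{..<length D}\<close>; it may
  have loops and parallel edges. The \<open>A\<close>-smoothing opens the regions swept out when the over-strand
  is turned counterclockwise: it joins corners 1 and 3, whatever the sign of the crossing.
\<close>

definition pos_edge :: "gauss_code \<Rightarrow> (nat \<times> bool) set set \<Rightarrow> nat \<Rightarrow> bool" where
  "pos_edge D S c \<longleftrightarrow> corner_face D c 1 \<in> S \<and> corner_face D c 3 \<in> S"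

definition edge_ends :: "gauss_code \<Rightarrow> (nat \<times> bool) set set \<Rightarrow> nat \<Rightarrow> (nat \<times> bool) set set" where
  "edge_ends D S c =
    (if pos_edge D S c then {corner_face D c 1, corner_face D c 3}
     else {corner_face D c 0, corner_face D c 2})"

definition tait_coloring :: "gauss_code \<Rightarrow> (nat \<times> bool) set set \<Rightarrow> bool" where
  "tait_coloring D S \<longleftrightarrow>
     checkerboard D S \<and>
     card {c. c < length D \<and> \<not> pos_edge D S c} \<le> card {c. c < length D \<and> pos_edge D S c}"


section \<open>Spanning trees and activities\<close>

text \<open>
  A multigraph is given by a vertex set, an edge set and a map that sends an edge to the set of its
  one or two end points.
\<close>

definition joined :: "('e \<Rightarrow> 'v set) \<Rightarrow> 'e set \<Rightarrow> ('v \<times> 'v) set" where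
  "joined ends T = {(x, y). \<exists>e\<in>T. ends e = {x, y}}\<^sup>*"

definition is_cycle :: "('e \<Rightarrow> 'v set) \<Rightarrow> 'e set \<Rightarrow> bool" where
  "is_cycle ends C \<longleftrightarrow>
     (\<exists>xs es. xs \<noteq> [] \<and> length es = length xs \<and> distinct xs \<and> distinct es \<and> C = set es \<and>
        (\<forall>k<length xs. ends (es ! k) = {xs ! k, xs ! (Suc k mod length xs)}))"

definition spanning_tree :: "'v set \<Rightarrow> 'e set \<Rightarrow> ('e \<Rightarrow> 'v set) \<Rightarrow> 'e set \<Rightarrow> bool" where
  "spanning_tree V E ends T \<longleftrightarrow>
     T \<subseteq> E \<and> V \<times> V \<subseteq> joined ends T \<and> (\<nexists>C. C \<subseteq> T \<and> is_cycle ends C)"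

definition cut :: "'e set \<Rightarrow> ('e \<Rightarrow> 'v set) \<Rightarrow> 'e set \<Rightarrow> 'e \<Rightarrow> 'e set" where
  "cut E ends T e = {g \<in> E. \<exists>x y. ends g = {x, y} \<and> (x, y) \<notin> joined ends (T - {e})}"

definition cyc :: "('e \<Rightarrow> 'v set) \<Rightarrow> 'e set \<Rightarrow> 'e \<Rightarrow> 'e set" where
  "cyc ends T f = (THE C. is_cycle ends C \<and> C \<subseteq> insert f T)"

definition live :: "'e::linorder set \<Rightarrow> ('e \<Rightarrow> 'v set) \<Rightarrow> 'e set \<Rightarrow> 'e \<Rightarrow> bool" where
  "live E ends T e \<longleftrightarrow> (\<forall>g \<in> (if e \<in> T then cut E ends T e else cyc ends T e). e \<le> g)"

definition tait_tree :: "gauss_code \<Rightarrow> (nat \<times> bool) set set \<Rightarrow> nat set \<Rightarrow> bool" where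
  "tait_tree D S T \<longleftrightarrow> spanning_tree S {..<length D} (edge_ends D S) T"

text \<open>
  \<open>activity_count D S T int pos act\<close> is the number of edges that are internal or external, positive
  or negative, live or dead, as told by the three flags; for instance, \<open>True True True\<close> counts the
  letter \<open>L\<close> and \<open>False False True\<close> counts the letter \<open>l\<close> with a bar.
\<close>

definition activity_count ::
    "gauss_code \<Rightarrow> (nat \<times> bool) set set \<Rightarrow> nat set \<Rightarrow> bool \<Rightarrow> bool \<Rightarrow> bool \<Rightarrow> int" where
  "activity_count D S T internal pos act =
     int (card {e. e < length D \<and> (e \<in> T) = internal \<and> pos_edge D S e = pos \<and>
                   live {..<length D} (edge_ends D S) T e = act})"

definition tree_u :: "gauss_code \<Rightarrow> (nat \<times> bool) set set \<Rightarrow> nat set \<Rightarrow> int" where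
  "tree_u D S T =
     activity_count D S T True True True - activity_count D S T False True True
     - activity_count D S T True False True + activity_count D S T False False True"

definition tree_v :: "gauss_code \<Rightarrow> (nat \<times> bool) set set \<Rightarrow> nat set \<Rightarrow> int" where
  "tree_v D S T = activity_count D S T True True True + activity_count D S T True True False"

definition tree_group ::
    "gauss_code \<Rightarrow> (nat \<times> bool) set set \<Rightarrow> int \<Rightarrow> int \<Rightarrow> (nat set \<Rightarrow>\<^sub>0 int) monoid" where
  "tree_group D S u v =
     free_Abelian_group {T. tait_tree D S T \<and> tree_u D S T = u \<and> tree_v D S T = v}"


section \<open>Reduced Khovanov homology\<close>

text \<open>
  A smoothing of the diagram is given by the set \<open>B\<close> of its \<open>B\<close>-smoothed crossings. Since an
  \<open>A\<close>-smoothing joins corners 1 and 3, it connects end 0 with end 1 and end 2 with end 3.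
  A circle is the set of arcs it consists of.
\<close>

definition smoothing_glue :: "gauss_code \<Rightarrow> nat set \<Rightarrow> (nat \<times> nat) set" where
  "smoothing_glue D B =
    (\<Union>c<length D. let e = (\<lambda>k. fst (arc_ends D c ! k))
       in if c \<in> B then {(e 1, e 2), (e 3, e 0)} else {(e 0, e 1), (e 2, e 3)})"

definition circles :: "gauss_code \<Rightarrow> nat set \<Rightarrow> nat set set" where
  "circles D B = glue_classes (arcs D) (smoothing_glue D B)"

text \<open>An enhanced state is a pair \<open>(B, P)\<close>, where \<open>P\<close> is the set of circles with sign \<open>+\<close>.\<close>

type_synonym enhanced_state = "nat set \<times> nat set set"

definition enhanced_states :: "gauss_code \<Rightarrow> enhanced_state set" where
  "enhanced_states D = {(B, P). B \<subseteq> {..<length D} \<and> P \<subseteq> circles D B}"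

definition sigma :: "gauss_code \<Rightarrow> enhanced_state \<Rightarrow> int" where
  "sigma D s = int (card ({..<length D} - fst s)) - int (card (fst s))"

definition tau :: "gauss_code \<Rightarrow> enhanced_state \<Rightarrow> int" where
  "tau D s = int (card (snd s)) - int (card (circles D (fst s) - snd s))"

text \<open>The division is exact, as the writhe and \<open>sigma\<close> have the parity of the number of crossings.\<close>

definition i_deg :: "gauss_code \<Rightarrow> enhanced_state \<Rightarrow> int" where
  "i_deg D s = (writhe D - sigma D s) div 2"

definition j_deg :: "gauss_code \<Rightarrow> enhanced_state \<Rightarrow> int" where
  "j_deg D s = i_deg D s + writhe D - tau D s"

definition merge_rule :: "nat set set \<Rightarrow> nat set set \<Rightarrow> nat set \<Rightarrow> nat set \<Rightarrow> nat set \<Rightarrow> bool" where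
  "merge_rule P P' x y z \<longleftrightarrow>
     (x \<notin> P \<and> y \<notin> P \<and> z \<notin> P') \<or> ((x \<in> P) \<noteq> (y \<in> P) \<and> z \<in> P')"

definition split_rule :: "nat set set \<Rightarrow> nat set set \<Rightarrow> nat set \<Rightarrow> nat set \<Rightarrow> nat set \<Rightarrow> bool" where
  "split_rule P P' z x y \<longleftrightarrow>
     (z \<in> P \<and> x \<in> P' \<and> y \<in> P') \<or> (z \<notin> P \<and> (x \<in> P') \<noteq> (y \<in> P'))"

definition state_step :: "gauss_code \<Rightarrow> nat \<Rightarrow> enhanced_state \<Rightarrow> enhanced_state \<Rightarrow> bool" where
  "state_step D c s s' \<longleftrightarrow>
    (case (s, s') of ((B, P), (B', P')) \<Rightarrow>
       c < length D \<and> c \<notin> B \<and> B' = insert c B \<and>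
       P \<inter> circles D B' = P' \<inter> circles D B \<and>
       (\<exists>x y z. x \<noteq> y \<and>
          (circles D B - circles D B' = {x, y} \<and> circles D B' - circles D B = {z} \<and>
             merge_rule P P' x y z \<or>
           circles D B - circles D B' = {z} \<and> circles D B' - circles D B = {x, y} \<and>
             split_rule P P' z x y)))"

definition khovanov_d :: "gauss_code \<Rightarrow> (enhanced_state \<Rightarrow>\<^sub>0 int) \<Rightarrow> (enhanced_state \<Rightarrow>\<^sub>0 int)" where
  "khovanov_d D = frag_extend (\<lambda>s.
     \<Sum>(c, s') \<in> {(c, s'). s' \<in> enhanced_states D \<and> state_step D c s s'}.
       frag_cmul ((- 1) ^ card {b \<in> fst s. b < c}) (frag_of s'))"

text \<open>The basepoint is given by the arc \<open>b\<close> on which it lies.\<close>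

definition reduced_states :: "gauss_code \<Rightarrow> nat \<Rightarrow> enhanced_state set" where
  "reduced_states D b = {s \<in> enhanced_states D. \<exists>x \<in> snd s. b \<in> x}"

definition reduced_chains :: "gauss_code \<Rightarrow> nat \<Rightarrow> int \<Rightarrow> int \<Rightarrow> (enhanced_state \<Rightarrow>\<^sub>0 int) monoid" where
  "reduced_chains D b i j =
     free_Abelian_group {s \<in> reduced_states D b. i_deg D s = i \<and> j_deg D s = j}"

text \<open>The homology at \<open>B\<close> of a complex \<open>A \<rightarrow> B \<rightarrow> C\<close> with the maps \<open>f\<close> and \<open>g\<close>.\<close>

definition homology_at ::
    "'a monoid \<Rightarrow> ('a \<Rightarrow> 'b) \<Rightarrow> 'b monoid \<Rightarrow> ('b \<Rightarrow> 'c) \<Rightarrow> 'c monoid \<Rightarrow> 'b set monoid" where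
  "homology_at A f B g C = (B\<lparr>carrier := kernel B C g\<rparr>) Mod (f ` carrier A)"

definition reduced_khovanov ::
    "gauss_code \<Rightarrow> nat \<Rightarrow> int \<Rightarrow> int \<Rightarrow> (enhanced_state \<Rightarrow>\<^sub>0 int) set monoid" where
  "reduced_khovanov D b i j =
     homology_at (reduced_chains D b (i - 1) j) (khovanov_d D)
       (reduced_chains D b i j) (khovanov_d D) (reduced_chains D b (i + 1) j)"


section \<open>Spectral sequences\<close>

text \<open>
  Cohomologically graded spectral sequences of abelian groups. The page number 0 is included so
  that collapsing at page 0 makes sense for the diagram without crossings.
\<close>

locale spectral_sequence =
  fixes E :: "nat \<Rightarrow> int \<Rightarrow> int \<Rightarrow> 'a monoid"
    and d :: "nat \<Rightarrow> int \<Rightarrow> int \<Rightarrow> 'a \<Rightarrow> 'a"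
  assumes abelian: "comm_group (E r p q)"
    and d_hom: "d r p q \<in> hom (E r p q) (E r (p + int r) (q - int r + 1))"
    and d_d: "x \<in> carrier (E r p q) \<Longrightarrow>
      d r (p + int r) (q - int r + 1) (d r p q x)
        = \<one>\<^bsub>E r (p + int r + int r) (q - int r + 1 - int r + 1)\<^esub>"
    and turn_page: "E (Suc r) p q \<cong>
      homology_at (E r (p - int r) (q + int r - 1)) (d r (p - int r) (q + int r - 1))
        (E r p q) (d r p q) (E r (p + int r) (q - int r + 1))"

text \<open>From page \<open>r\<close> on, all differentials into and out of position \<open>(p, q)\<close> vanish.\<close>

definition stable_from ::
    "(nat \<Rightarrow> int \<Rightarrow> int \<Rightarrow> 'a monoid) \<Rightarrow> (nat \<Rightarrow> int \<Rightarrow> int \<Rightarrow> 'a \<Rightarrow> 'a) \<Rightarrow> nat \<Rightarrow> int \<Rightarrow> int \<Rightarrow> bool" where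
  "stable_from E d r p q \<longleftrightarrow>
     (\<forall>s\<ge>r. (\<forall>x \<in> carrier (E s p q). d s p q x = \<one>\<^bsub>E s (p + int s) (q - int s + 1)\<^esub>) \<and>
            (\<forall>x \<in> carrier (E s (p - int s) (q + int s - 1)).
               d s (p - int s) (q + int s - 1) x = \<one>\<^bsub>E s p q\<^esub>))"

definition E_infinity ::
    "(nat \<Rightarrow> int \<Rightarrow> int \<Rightarrow> 'a monoid) \<Rightarrow> (nat \<Rightarrow> int \<Rightarrow> int \<Rightarrow> 'a \<Rightarrow> 'a) \<Rightarrow> int \<Rightarrow> int \<Rightarrow> 'a monoid" where
  "E_infinity E d p q = E (LEAST r. stable_from E d r p q) p q"

definition converges_to ::
    "(nat \<Rightarrow> int \<Rightarrow> int \<Rightarrow> 'a monoid) \<Rightarrow> (nat \<Rightarrow> int \<Rightarrow> int \<Rightarrow> 'a \<Rightarrow> 'a) \<Rightarrow> (int \<Rightarrow> 'b monoid) \<Rightarrow> bool" where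
  "converges_to E d H \<longleftrightarrow>
     (\<forall>p q. \<exists>r. stable_from E d r p q) \<and>
     (\<exists>F. (\<forall>n p. subgroup (F n p) (H n) \<and> F n (p + 1) \<subseteq> F n p) \<and>
          (\<forall>n. (\<exists>p. F n p = carrier (H n)) \<and> (\<exists>p. F n p = {\<one>\<^bsub>H n\<^esub>})) \<and>
          (\<forall>p q. E_infinity E d p q \<cong>
             ((H (p + q))\<lparr>carrier := F (p + q) p\<rparr>) Mod (F (p + q) (p + 1))))"

text \<open>\<open>E\<^sub>r = E\<^sub>\<infinity>\<close>: every position is stable from page \<open>r\<close> on.\<close>

definition collapses_at ::
    "(nat \<Rightarrow> int \<Rightarrow> int \<Rightarrow> 'a monoid) \<Rightarrow> (nat \<Rightarrow> int \<Rightarrow> int \<Rightarrow> 'a \<Rightarrow> 'a) \<Rightarrow> nat \<Rightarrow> bool" where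
  "collapses_at E d r \<longleftrightarrow> (\<forall>p q. stable_from E d r p q)"

end

theory Submission
  imports Defs "HOL-Combinatorics.Orbits"
begin

text \<open>
  Every smoothing lies in the block of a unique spanning tree \<open>T\<close>: it agrees with the one-circle
  state of \<open>T\<close> at the dead crossings of \<open>T\<close>. Inside a block, switching a live crossing splits off a
  circle, and these circles form a tree rooted at the circle of the basepoint. Flipping a
  live crossing where the sign of the split-off circle allows it matches all enhanced states of the block
  except one. The remaining terms of the differential either move to a block that is larger in the lexicographic
  order or move a sign \<open>+\<close> towards the root, so that the matching is acyclic: the matched sources and
  their boundaries span a contractible subcomplex \<open>N\<close>, and the quotient by \<open>N\<close> is free on the
  spanning trees. The spectral sequence is that of the quotient complex in the single row \<open>q = 0\<close>: its
  first page is the quotient complex itself, and all later pages are the homology. It collapses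
  at page 2. With at most one crossing there is only one tree, and it collapses at page 0.
\<close>

section \<open>Circles as cycles of a permutation of the arcs\<close>

text \<open>Three difficulties shape the proof. The first is that a saddle must never turn one
  circle into one circle. With the arcs oriented by the colouring, changing one smoothing multiplies
  a permutation by a transposition, so every saddle merges two circles or splits one. The second is
  to relate circles to activities. The blocks are built from one-circle states alone: a crossing is
  called live if switching it together with a lower crossing never gives a one-circle state. The
  graph enters only near the end, where one-circle states are identified with spanning trees and the
  exchange property of trees turns this notion into activity. The third is the differential on the
  trees. Passing to the quotient avoids sums over alternating paths of the matching: the
  differential is the induced one, and only the unitriangularity of the matching has to be proved.
  The degrees then match because the degrees of a critical state are, up to constants of the
  diagram, sums of contributions of the eight activity letters.\<close>

lemma orbit_transpose:
  assumes f: "permutation f" and uv: "u \<noteq> v"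
  shows "v \<in> orbit (f \<circ> transpose u v) u \<longleftrightarrow> v \<notin> orbit f u"
proof -
  define g where "g = f \<circ> transpose u v"
  have g: "permutation g"
    unfolding g_def by (rule permutation_compose[OF f permutation_swap_id])
  have gu: "g u = f v" and gv: "g v = f u" and go: "\<And>x. x \<noteq> u \<Longrightarrow> x \<noteq> v \<Longrightarrow> g x = f x"
    by (auto simp: g_def)
  \<comment> \<open>Two cycles are joined: from \<open>v\<close> on, \<open>g\<close> enters the
    cycle of \<open>u\<close> at \<open>f u\<close> and follows \<open>f\<close> there until it
    comes back to \<open>u\<close>.\<close>
  have "v \<in> orbit g u" if nv: "v \<notin> orbit f u"
  proof -
    have step: "(f ^^ Suc j) u \<in> orbit g v \<or> u \<in> orbit g v" for j
    proof (induction j)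
      case 0
      then show ?case using gv orbit.base[of g v] by simp
    next
      case (Suc j)
      have "(f ^^ Suc j) u \<noteq> v"
        using nv unfolding orbit_altdef by blast
      then show ?case
        using Suc go[of "(f ^^ Suc j) u"] by (metis comp_apply funpow.simps(2) orbit.step)
    qed
    obtain m where "m > 0" "(f ^^ m) u = u"
      using permutation_self_in_orbit[OF f, of u] by (auto simp: orbit_altdef)
    then have "u \<in> orbit g v" using step[of "m - 1"] by auto
    then show ?thesis
      using orbit_swap permutation_self_in_orbit[OF g] by metis
  qed
  \<comment> \<open>One cycle is split: with \<open>k\<close> the least number of steps from
    \<open>v\<close> to \<open>u\<close>, the cycle of \<open>u\<close> under \<open>g\<close> is
    \<open>f v\<close>, ..., \<open>(f ^^ k) v = u\<close>. Minimality of \<open>k\<close> keeps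
    \<open>v\<close> out of it.\<close>
  moreover have "v \<notin> orbit g u" if "v \<in> orbit f u"
  proof -
    have "u \<in> orbit f v" using that orbit_swap permutation_self_in_orbit[OF f] by metis
    then have ex: "\<exists>k. k > 0 \<and> (f ^^ k) v = u" by (auto simp: orbit_altdef)
    define k where "k = (LEAST k. k > 0 \<and> (f ^^ k) v = u)"
    have k: "k > 0" "(f ^^ k) v = u" using LeastI_ex[OF ex] by (auto simp: k_def)
    have min: "(f ^^ j) v \<noteq> u" if "0 < j" "j < k" for j
      using not_less_Least[of j "\<lambda>k. k > 0 \<and> (f ^^ k) v = u"] that by (auto simp: k_def)
    have nv: "(f ^^ j) v \<noteq> v" if "0 < j" "j \<le> k" for j
    proof
      assume jv: "(f ^^ j) v = v"
      show False
      proof (cases "j = k")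
        case True then show False using jv k uv by simp
      next
        case False
        have "(f ^^ (k - j)) ((f ^^ j) v) = u"
          using k that by (metis funpow_add comp_apply le_add_diff_inverse2)
        then show False using min[of "k - j"] jv False that by auto
      qed
    qed
    have "\<exists>j. 0 < j \<and> j \<le> k \<and> y = (f ^^ j) v" if "y \<in> orbit g u" for y
      using that
    proof induction
      case base
      show ?case using k gu by (intro exI[of _ 1]) auto
    next
      case (step y)
      then obtain j where j: "0 < j" "j \<le> k" "y = (f ^^ j) v" by blast
      show ?case
      proof (cases "j = k")
        case True
        then show ?thesis using j k gu by (intro exI[of _ 1]) auto
      next
        case False
        then have "g y = f y" using go[of y] min[of j] nv[of j] j by auto
        then show ?thesis using j False by (intro exI[of _ "Suc j"]) auto
      qed
    qed
    then show ?thesis using nv by metis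
  qed
  ultimately show ?thesis unfolding g_def by blast
qed

lemma orbit_sym: "permutation f \<Longrightarrow> y \<in> orbit f x \<Longrightarrow> x \<in> orbit f y"
  using orbit_swap permutation_self_in_orbit by metis

section \<open>Ends of arcs at crossings and the strands of a smoothing\<close>

definition arc_at :: "gauss_code \<Rightarrow> nat \<Rightarrow> nat \<Rightarrow> nat" where
  "arc_at D c k = fst (arc_ends D c ! k)"

definition circle_rel :: "gauss_code \<Rightarrow> nat set \<Rightarrow> (nat \<times> nat) set" where
  "circle_rel D B = (smoothing_glue D B \<union> (smoothing_glue D B)\<inverse>)\<^sup>*"

definition circle_of :: "gauss_code \<Rightarrow> nat set \<Rightarrow> nat \<Rightarrow> nat set" where
  "circle_of D B x = circle_rel D B `` {x}"

text \<open>Both lists are involutions that exchange even and odd ends. As the shading of the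
  corners alternates around a crossing, a strand of either smoothing joins ends of opposite
  shade.\<close>

definition partner :: "nat set \<Rightarrow> nat \<Rightarrow> nat \<Rightarrow> nat" where
  "partner B c k = (if c \<in> B then [3, 2, 1, 0] ! k else [1, 0, 3, 2] ! k)"

lemma less4: "(k::nat) < 4 \<longleftrightarrow> k = 0 \<or> k = 1 \<or> k = 2 \<or> k = 3"
  by auto

lemma partner_less: "k < 4 \<Longrightarrow> partner B c k < 4"
  by (auto simp: partner_def less4)

lemma partner_partner: "k < 4 \<Longrightarrow> partner B c (partner B c k) = k"
  by (auto simp: partner_def less4)

lemma smoothing_glue_iff:
  "(x, y) \<in> smoothing_glue D B \<union> (smoothing_glue D B)\<inverse> \<longleftrightarrow>
     (\<exists>c<length D. \<exists>k<4. x = arc_at D c k \<and> y = arc_at D c (partner B c k))"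
  (is "?L \<longleftrightarrow> ?R")
proof
  assume ?L
  then obtain c where c: "c < length D" and
    "(if c \<in> B then (x, y) \<in> {(arc_at D c 1, arc_at D c 2), (arc_at D c 3, arc_at D c 0)}
        \<or> (y, x) \<in> {(arc_at D c 1, arc_at D c 2), (arc_at D c 3, arc_at D c 0)}
      else (x, y) \<in> {(arc_at D c 0, arc_at D c 1), (arc_at D c 2, arc_at D c 3)}
        \<or> (y, x) \<in> {(arc_at D c 0, arc_at D c 1), (arc_at D c 2, arc_at D c 3)})"
    unfolding smoothing_glue_def Let_def arc_at_def by (auto split: if_splits)
  then have "\<exists>k\<in>{0,1,2,3}. x = arc_at D c k \<and> y = arc_at D c (partner B c k)"
    by (auto simp: partner_def split: if_splits)
  then show ?R using c by (metis less4 insertE singletonD)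
next
  assume ?R
  then obtain c k where "c < length D" "k < 4" "x = arc_at D c k" "y = arc_at D c (partner B c k)"
    by blast
  moreover from this have "(x, y) \<in> (let e = (\<lambda>k. fst (arc_ends D c ! k))
       in if c \<in> B then {(e 1, e 2), (e 3, e 0)} else {(e 0, e 1), (e 2, e 3)}) \<or>
     (y, x) \<in> (let e = (\<lambda>k. fst (arc_ends D c ! k))
       in if c \<in> B then {(e 1, e 2), (e 3, e 0)} else {(e 0, e 1), (e 2, e 3)})"
    by (auto simp: Let_def arc_at_def partner_def less4)
  ultimately show ?L
    unfolding smoothing_glue_def by blast
qed

locale colored_diagram =
  fixes D :: gauss_code and b :: nat and S :: "(nat \<times> bool) set set"
  assumes knot: "knot_diagram D" and base: "b \<in> arcs D" and board: "checkerboard D S"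
begin

abbreviation "same B x y \<equiv> (x, y) \<in> circle_rel D B"
text \<open>Ends 0 and 2 are never connected by a smoothing of \<open>c\<close>, and each of the
  other two ends is connected to one of them. So \<open>al c\<close> and \<open>be c\<close>
  represent the two strands at \<open>c\<close> whichever smoothing is chosen.\<close>

abbreviation "al c \<equiv> arc_at D c 0"
abbreviation "be c \<equiv> arc_at D c 2"

definition shaded :: "nat \<Rightarrow> nat \<Rightarrow> bool" where
  "shaded c k \<longleftrightarrow> corner_face D c k \<in> S"

lemma finite_arcs: "finite (arcs D)"
  by (simp add: arcs_def)

lemma arcs_eq: "0 < length D \<Longrightarrow> arcs D = {..<2 * length D}"
  by (cases "length D") (auto simp: arcs_def)

lemma out_arc_inj:
  assumes "t < 2 * length D" "t' < 2 * length D" "out_arc D t = out_arc D t'"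
  shows "t = t'"
proof -
  have "Suc t mod (2 * length D) = (if Suc t = 2 * length D then 0 else Suc t)" if "t < 2 * length D" for t
    using that by auto
  then show ?thesis using assms unfolding out_arc_def by (auto split: if_splits)
qed

lemma under_over:
  assumes "c < length D"
  shows "under (D ! c) < 2 * length D" "over (D ! c) < 2 * length D"
    "c' < length D \<Longrightarrow> under (D ! c) \<noteq> over (D ! c')"
    "c' < length D \<Longrightarrow> under (D ! c) = under (D ! c') \<Longrightarrow> c = c'"
    "c' < length D \<Longrightarrow> over (D ! c) = over (D ! c') \<Longrightarrow> c = c'"
proof -
  have d: "distinct (map under D @ map over D)" and s: "set (map under D @ map over D) = {..<2 * length D}"
    using knot by (auto simp: knot_diagram_def)
  show "under (D ! c) < 2 * length D" "over (D ! c) < 2 * length D"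
    using s assms by (auto simp: set_eq_iff)
  show "under (D ! c) \<noteq> over (D ! c')" if "c' < length D"
    using d assms that by (auto simp: disjoint_iff) (metis nth_mem image_eqI)
  show "c = c'" if "c' < length D" "under (D ! c) = under (D ! c')"
    using d assms that by (auto simp: distinct_map inj_on_def) (metis nth_mem nth_eq_iff_index_eq distinct_map)
  show "c = c'" if "c' < length D" "over (D ! c) = over (D ! c')"
    using d assms that by (auto simp: distinct_map inj_on_def) (metis nth_mem nth_eq_iff_index_eq distinct_map)
qed

lemma arc_ends_nth:
  assumes "k < 4"
  shows "arc_ends D c ! k =
    (let t = (if even k then under (D ! c) else over (D ! c));
         out = (k = 2 \<or> k = (if positive (D ! c) then 1 else 3))
     in (if out then out_arc D t else t, out))"
  using assms by (auto simp: less4 arc_ends_def Let_def)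

text \<open>The flag separates incoming from outgoing ends, the arc then gives the time of the
  passage, and each passage belongs to one strand of one crossing.\<close>

lemma arc_ends_inj:
  assumes "c < length D" "c' < length D" "k < 4" "k' < 4" "arc_ends D c ! k = arc_ends D c' ! k'"
  shows "c = c' \<and> k = k'"
proof -
  define t where "t c k = (if even k then under (D ! c) else over (D ! c))" for c and k :: nat
  define out where "out c k \<longleftrightarrow> k = 2 \<or> k = (if positive (D ! c) then 1 else 3)" for c and k :: nat
  have tl: "t c k < 2 * length D" if "c < length D" for c k using under_over[OF that] by (simp add: t_def)
  have *: "arc_ends D c ! k = (if out c k then out_arc D (t c k) else t c k, out c k)" if "k < 4" for c k
    using arc_ends_nth[OF that] by (simp add: t_def out_def Let_def)
  have o: "out c k = out c' k'" using assms *[of k c] *[of k' c'] by simp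
  have t: "t c k = t c' k'"
    using assms *[of k c] *[of k' c'] o out_arc_inj[OF tl tl] by (auto split: if_splits)
  have "even k = even k'"
    using t under_over(3)[OF assms(1,2)] under_over(3)[OF assms(2,1)] by (auto simp: t_def split: if_splits)
  moreover from this have "c = c'"
    using t under_over(4,5)[OF assms(1,2)] by (auto simp: t_def split: if_splits)
  ultimately show ?thesis using o assms(3,4) by (auto simp: out_def less4 split: if_splits)
qed

lemma arc_ends_surj:
  assumes "a \<in> arcs D" "0 < length D"
  shows "\<exists>c<length D. \<exists>k<4. arc_ends D c ! k = (a, out)"
proof -
  have s: "set (map under D @ map over D) = {..<2 * length D}"
    using knot by (auto simp: knot_diagram_def)
  have pas: "\<exists>c<length D. t = under (D ! c) \<or> t = over (D ! c)" if "t < 2 * length D" for t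
  proof -
    have "t \<in> set (map under D @ map over D)" using s that by simp
    then show ?thesis by (auto simp: in_set_conv_nth)
  qed
  have a: "a < 2 * length D" using assms arcs_eq by auto
  \<comment> \<open>Arc \<open>a\<close> arrives at passage \<open>a\<close> and leaves passage
    \<open>a - 1\<close>; arc 0 leaves the last passage.\<close>
  define t where "t = (if out then (if a = 0 then 2 * length D - 1 else a - 1) else a)"
  have t: "t < 2 * length D" using a by (auto simp: t_def)
  have o: "out \<Longrightarrow> out_arc D t = a" using a by (auto simp: t_def out_arc_def)
  obtain c where c: "c < length D" "t = under (D ! c) \<or> t = over (D ! c)" using pas[OF t] by blast
  have "\<exists>k\<in>{0,1,2,3}. arc_ends D c ! k = (a, out)"
    using c o t_def unfolding arc_ends_def Let_def by (auto split: if_splits)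
  then show ?thesis using c by (metis less4 insertE singletonD)
qed

lemma arc_at_in: "c < length D \<Longrightarrow> k < 4 \<Longrightarrow> arc_at D c k \<in> arcs D"
  using length_greater_0_conv[THEN iffD1, OF le_less_trans[OF le0], of c D] under_over(1,2)[of c] mod_less_divisor[of "2 * length D" "Suc (under (D ! c))"]
    mod_less_divisor[of "2 * length D" "Suc (over (D ! c))"]
  by (auto simp: arc_at_def arc_ends_nth Let_def arcs_def out_arc_def simp del: mod_less_divisor)

lemma corner_shaded:
  assumes "c < length D" "k < 4" "arc_ends D c ! k = (a, out)"
  shows "shaded c k \<longleftrightarrow> face_of D (a, out) \<in> S"
  using assms by (simp add: shaded_def corner_face_def)

lemma board_arc: "a \<in> arcs D \<Longrightarrow> face_of D (a, out) \<in> S \<longleftrightarrow> face_of D (a, \<not> out) \<notin> S"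
  using board by (cases out) (auto simp: checkerboard_def)

lemma face_of_glue:
  assumes "(s, s') \<in> (corner_glue D \<union> (corner_glue D)\<inverse>)\<^sup>*"
  shows "face_of D s = face_of D s'"
proof -
  let ?R = "(corner_glue D \<union> (corner_glue D)\<inverse>)\<^sup>*"
  have "sym ?R" by (rule sym_rtrancl) (simp add: sym_Un_converse)
  then have "(s', s) \<in> ?R" using assms by (meson symE)
  then show ?thesis using assms unfolding face_of_def by (auto intro: rtrancl_trans)
qed

text \<open>Corners \<open>k\<close> and \<open>k + 1\<close> lie on the two sides of the arc at end
  \<open>k + 1\<close>.\<close>

lemma shaded_Suc:
  assumes "c < length D" "k < 4"
  shows "shaded c (Suc k mod 4) \<longleftrightarrow> \<not> shaded c k"
proof -
  obtain a out where ao: "arc_ends D c ! (Suc k mod 4) = (a, out)" by (cases "arc_ends D c ! (Suc k mod 4)")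
  have "(arc_ends D c ! k, (a, \<not> out)) \<in> corner_glue D"
    unfolding corner_glue_def using assms ao[symmetric] by blast
  then have e: "face_of D (arc_ends D c ! k) = face_of D (a, \<not> out)"
    by (intro face_of_glue) auto
  have "a \<in> arcs D" using arc_at_in[of c "Suc k mod 4"] assms ao by (simp add: arc_at_def)
  then show ?thesis
    using board_arc[of a out] e ao by (simp add: shaded_def corner_face_def)
qed

lemma shaded_parity:
  assumes "c < length D"
  shows "shaded c 1 \<longleftrightarrow> \<not> shaded c 0" "shaded c 2 \<longleftrightarrow> shaded c 0" "shaded c 3 \<longleftrightarrow> \<not> shaded c 0"
proof -
  have e: "Suc 0 mod 4 = (1::nat)" "Suc 1 mod 4 = (2::nat)" "Suc 2 mod 4 = (3::nat)" by simp_all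
  show "shaded c 1 \<longleftrightarrow> \<not> shaded c 0" "shaded c 2 \<longleftrightarrow> shaded c 0" "shaded c 3 \<longleftrightarrow> \<not> shaded c 0"
    using shaded_Suc[OF assms, of 0] shaded_Suc[OF assms, of 1] shaded_Suc[OF assms, of 2]
    unfolding e by auto
qed

lemma shaded_partner: "c < length D \<Longrightarrow> k < 4 \<Longrightarrow> shaded c (partner B c k) \<longleftrightarrow> \<not> shaded c k"
  using shaded_parity[of c] by (auto simp: partner_def less4)

text \<open>The two ends of an arc differ in the flag, and the corners counterclockwise from them
  lie on opposite sides of the arc. Hence an arc has exactly one end of each shade, which gives
  every arc a direction.\<close>

lemma end_exists:
  assumes "a \<in> arcs D" "0 < length D"
  shows "\<exists>c<length D. \<exists>k<4. arc_at D c k = a \<and> shaded c k = sh"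
proof -
  obtain out where "face_of D (a, out) \<in> S \<longleftrightarrow> sh" using board_arc[OF assms(1), of True] by auto
  then show ?thesis using arc_ends_surj[OF assms, of out] corner_shaded
    unfolding arc_at_def by (metis fst_conv)
qed

lemma end_unique:
  assumes "c < length D" "k < 4" "c' < length D" "k' < 4" "arc_at D c k = arc_at D c' k'" "shaded c k = shaded c' k'"
  shows "c = c' \<and> k = k'"
proof -
  obtain a out where 1: "arc_ends D c ! k = (a, out)" by (cases "arc_ends D c ! k")
  obtain out' where 2: "arc_ends D c' ! k' = (a, out')" using assms(5) 1 unfolding arc_at_def
    by (cases "arc_ends D c' ! k'") auto
  have "a \<in> arcs D" using arc_at_in[OF assms(1,2)] 1 by (simp add: arc_at_def)
  then have "out = out'"
    using assms(6) corner_shaded[OF assms(1,2) 1] corner_shaded[OF assms(3,4) 2] board_arc[of a out]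
    by (cases out; cases out') auto
  then show ?thesis using arc_ends_inj[of c c' k k'] assms 1 2 by simp
qed

text \<open>Orient every arc with the shaded side on its left. Both smoothings respect this orientation,
  so that the circles of a state are the cycles of a permutation of the arcs.\<close>

definition next_arc :: "nat set \<Rightarrow> nat \<Rightarrow> nat" where
  "next_arc B a = (if a \<in> arcs D \<and> 0 < length D
     then (let (c, k) = SOME (c, k). c < length D \<and> k < 4 \<and> arc_at D c k = a \<and> \<not> shaded c k
       in arc_at D c (partner B c k)) else a)"

lemma next_arc_at:
  assumes "c < length D" "k < 4" "\<not> shaded c k"
  shows "next_arc B (arc_at D c k) = arc_at D c (partner B c k)"
proof -
  let ?P = "\<lambda>(c', k'). c' < length D \<and> k' < 4 \<and> arc_at D c' k' = arc_at D c k \<and> \<not> shaded c' k'"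
  have "?P (Eps ?P)" by (rule someI[of ?P "(c, k)"]) (use assms in auto)
  then have "Eps ?P = (c, k)" using end_unique[of "fst (Eps ?P)" "snd (Eps ?P)" c k] assms
    by (auto simp: case_prod_beta prod_eq_iff)
  then show ?thesis using assms arc_at_in by (auto simp: next_arc_def)
qed

lemma next_arc_permutes: "next_arc B permutes arcs D"
proof (cases "length D = 0")
  case True
  then have "next_arc B = id" by (simp add: fun_eq_iff next_arc_def del: length_0_conv length_greater_0_conv)
  then show ?thesis by (simp add: permutes_id)
next
  case False
  have ex: "\<exists>c k. c < length D \<and> k < 4 \<and> arc_at D c k = a \<and> \<not> shaded c k" if "a \<in> arcs D" for a
    using end_exists[OF that, of False] False by auto
  have "inj_on (next_arc B) (arcs D)"
  proof (rule inj_onI)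
    fix x y assume xy: "x \<in> arcs D" "y \<in> arcs D" "next_arc B x = next_arc B y"
    obtain c k where 1: "c < length D" "k < 4" "arc_at D c k = x" "\<not> shaded c k" using ex xy by blast
    obtain c' k' where 2: "c' < length D" "k' < 4" "arc_at D c' k' = y" "\<not> shaded c' k'" using ex xy by blast
    \<comment> \<open>The images are reached at shaded ends, so equal images come from the same
      crossing and the same partner.\<close>
    have "c = c' \<and> partner B c k = partner B c' k'"
      using end_unique[of c "partner B c k" c' "partner B c' k'"] 1 2 xy(3) next_arc_at partner_less shaded_partner
      by metis
    then show "x = y" using 1 2 partner_partner by metis
  qed
  moreover have "next_arc B ` arcs D \<subseteq> arcs D"
    using ex next_arc_at arc_at_in partner_less by (metis image_subsetI)
  ultimately have "bij_betw (next_arc B) (arcs D) (arcs D)"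
    by (simp add: bij_betw_def endo_inj_surj finite_arcs)
  then show ?thesis by (rule bij_imp_permutes) (auto simp: next_arc_def)
qed

lemma next_arc_permutation: "permutation (next_arc B)"
  using next_arc_permutes finite_arcs permutation_permutes by blast

lemma same_refl: "same B x x" by (simp add: circle_rel_def)

lemma same_sym: "same B x y \<Longrightarrow> same B y x"
proof -
  have "sym (circle_rel D B)" unfolding circle_rel_def by (rule sym_rtrancl) (simp add: sym_Un_converse)
  then show "same B x y \<Longrightarrow> same B y x" by (meson symE)
qed

lemma same_trans: "same B x y \<Longrightarrow> same B y z \<Longrightarrow> same B x z"
  unfolding circle_rel_def by (rule rtrancl_trans)

lemma same_partner: "c < length D \<Longrightarrow> k < 4 \<Longrightarrow> same B (arc_at D c k) (arc_at D c (partner B c k))"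
  unfolding circle_rel_def using smoothing_glue_iff by (intro r_into_rtrancl) blast

lemma same_induct [consumes 1, case_names refl step]:
  assumes "same B x y" "P x"
    "\<And>c k. c < length D \<Longrightarrow> k < 4 \<Longrightarrow> same B x (arc_at D c k) \<Longrightarrow> P (arc_at D c k) \<Longrightarrow> P (arc_at D c (partner B c k))"
  shows "P y"
  using assms(1) unfolding circle_rel_def
proof (induction rule: rtrancl_induct)
  case base then show ?case by (rule assms)
next
  case (step y z)
  then show ?case using smoothing_glue_iff assms(3) unfolding circle_rel_def by metis
qed

lemma same_in_arcs: "same B x y \<Longrightarrow> x \<in> arcs D \<longleftrightarrow> y \<in> arcs D"
proof -
  have "y \<in> arcs D" if "same B x y" "x \<in> arcs D" for x y
    using that by (induction rule: same_induct) (auto intro: arc_at_in partner_less)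
  then show "same B x y \<Longrightarrow> x \<in> arcs D \<longleftrightarrow> y \<in> arcs D" using same_sym by blast
qed

text \<open>Passing through a crossing from an unshaded end is a step of \<open>next_arc\<close>,
  from a shaded end a step backwards. On a finite cycle a step backwards is also a sequence of
  forward steps.\<close>

lemma same_iff_orbit: "same B x y \<longleftrightarrow> y \<in> orbit (next_arc B) x"
proof
  note P = next_arc_permutation[of B]
  assume "same B x y"
  then show "y \<in> orbit (next_arc B) x"
  proof (induction rule: same_induct)
    case refl then show ?case by (rule permutation_self_in_orbit[OF P])
  next
    case (step c k)
    show ?case
    proof (cases "shaded c k")
      case False
      then show ?thesis using step next_arc_at[of c k B] by (metis orbit.step)
    next
      case True
      then have "next_arc B (arc_at D c (partner B c k)) = arc_at D c k"
        using next_arc_at[of c "partner B c k" B] step partner_less partner_partner shaded_partner by simp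
      then have "arc_at D c k \<in> orbit (next_arc B) (arc_at D c (partner B c k))" by (metis orbit.base)
      then show ?thesis using step.IH orbit_sym[OF P] by (metis orbit_trans)
    qed
  qed
next
  have one: "same B z (next_arc B z)" for z
  proof (cases "z \<in> arcs D \<and> 0 < length D")
    case True
    then obtain c k where "c < length D" "k < 4" "arc_at D c k = z" "\<not> shaded c k" using end_exists by metis
    then show ?thesis using next_arc_at same_partner by metis
  qed (auto simp: next_arc_def same_refl)
  assume "y \<in> orbit (next_arc B) x"
  then show "same B x y" by induction (use one same_trans in blast)+
qed

section \<open>The effect of a saddle on the circles\<close>

definition differ_at :: "nat \<Rightarrow> nat set \<Rightarrow> nat set \<Rightarrow> bool" where
  "differ_at c B B' \<longleftrightarrow> c < length D \<and> B' - {c} = B - {c} \<and> (c \<in> B) \<noteq> (c \<in> B')"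

lemma differ_at_sym: "differ_at c B B' \<Longrightarrow> differ_at c B' B"
  by (auto simp: differ_at_def)

text \<open>The permutations of the two states differ by the transposition of the two arcs that run
  into the crossing, so \<open>orbit_transpose\<close> decides whether the strands share a circle.
  This is where the colouring excludes saddles that keep the number of circles.\<close>

lemma saddle_xor:
  assumes "differ_at c B B'"
  shows "same B' (al c) (be c) \<longleftrightarrow> \<not> same B (al c) (be c)"
proof -
  have main: "same B' (al c) (be c) \<longleftrightarrow> \<not> same B (al c) (be c)"
    if d: "differ_at c B B'" and cB: "c \<notin> B" for B B'
  proof -
    have c: "c < length D" and cB': "c \<in> B'" and o: "\<And>h. h \<noteq> c \<Longrightarrow> h \<in> B \<longleftrightarrow> h \<in> B'"
      using d cB by (auto simp: differ_at_def)
    define i j where "i = (if shaded c 0 then 1 else 0::nat)" and "j = (if shaded c 0 then 3 else 2::nat)"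
    have ij: "i < 4" "j < 4" "i \<noteq> j" "\<not> shaded c i" "\<not> shaded c j" "\<And>k. k < 4 \<Longrightarrow> \<not> shaded c k \<Longrightarrow> k = i \<or> k = j"
      using shaded_parity[OF c] by (auto simp: i_def j_def less4)
    define u v where "u = arc_at D c i" and "v = arc_at D c j"
    have uv: "u \<noteq> v" using end_unique[of c i c j] c ij by (auto simp: u_def v_def)
    \<comment> \<open>The unshaded ends are opposite to each other, and the two smoothings connect
      them to the same two ends in exchanged order.\<close>
    have pa: "partner B' c i = partner B c j" "partner B' c j = partner B c i"
      using cB cB' by (auto simp: partner_def i_def j_def)
    have "next_arc B' x = (next_arc B \<circ> transpose u v) x" for x
    proof (cases "x \<in> arcs D")
      case True
      then obtain h k where hk: "h < length D" "k < 4" "arc_at D h k = x" "\<not> shaded h k"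
        using end_exists[of x False] c by (metis gr_zeroI not_less_zero)
      show ?thesis
      proof (cases "h = c")
        case True
        then have "x = u \<or> x = v" using ij hk by (auto simp: u_def v_def)
        then show ?thesis using pa ij next_arc_at[OF c, of i] next_arc_at[OF c, of j]
          by (auto simp: u_def v_def)
      next
        case False
        then have "x \<noteq> u" "x \<noteq> v" using end_unique[of h k c] hk c ij by (auto simp: u_def v_def)
        moreover have "partner B' h k = partner B h k" using o[OF False] by (simp add: partner_def)
        ultimately show ?thesis using hk next_arc_at[of h k] by simp
      qed
    next
      case False
      then have "x \<noteq> u" "x \<noteq> v" using arc_at_in c ij by (auto simp: u_def v_def)
      then show ?thesis using False by (simp add: next_arc_def)
    qed
    then have "next_arc B' = next_arc B \<circ> transpose u v" by blast
    then have x: "same B' u v \<longleftrightarrow> \<not> same B u v"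
      using orbit_transpose[OF next_arc_permutation uv] by (simp add: same_iff_orbit)
    show ?thesis
    proof (cases "shaded c 0")
      case False
      then show ?thesis using x by (simp add: u_def v_def i_def j_def)
    next
      case True
      \<comment> \<open>If end 0 is shaded, \<open>u\<close> and \<open>v\<close> are at ends 1 and
        3. Ends 0 and 2 lie on their strands, with the roles exchanged in \<open>B'\<close>.\<close>
      have "same B (al c) u" "same B (be c) v" "same B' (al c) v" "same B' (be c) u"
        using same_partner[OF c, of 0 B] same_partner[OF c, of 2 B] same_partner[OF c, of 0 B'] same_partner[OF c, of 2 B'] cB cB' True
        by (auto simp: partner_def u_def v_def i_def j_def)
      then show ?thesis using x same_sym same_trans by metis
    qed
  qed
  show ?thesis
  proof (cases "c \<in> B")
    case True
    then have "differ_at c B' B" "c \<notin> B'" using assms by (auto simp: differ_at_def)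
    then show ?thesis using main by blast
  next
    case False
    then show ?thesis using main assms by blast
  qed
qed

lemma end_at_al_be:
  assumes "c < length D" "k < 4"
  shows "same B (arc_at D c k) (al c) \<or> same B (arc_at D c k) (be c)"
proof (cases "c \<in> B")
  case True
  then show ?thesis using same_partner[OF assms, of B] assms(2) same_refl by (auto simp: less4 partner_def)
next
  case False
  then show ?thesis using same_partner[OF assms, of B] assms(2) same_refl by (auto simp: less4 partner_def)
qed

text \<open>A path in \<open>B'\<close> is a path in \<open>B\<close> except where it passes
  \<open>c\<close>, and there it can only change from one of the two strands to the other.\<close>

lemma saddle_join:
  assumes "differ_at c B B'" "same B' x y"
  shows "same B x y \<or> same B x (al c) \<and> same B y (be c) \<or> same B x (be c) \<and> same B y (al c)"
  using assms(2)
proof (induction rule: same_induct)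
  case refl then show ?case by (simp add: same_refl)
next
  case (step h k)
  show ?case
  proof (cases "h = c")
    case False
    then have "partner B' h k = partner B h k" using assms(1) by (auto simp: partner_def differ_at_def)
    then have "same B (arc_at D h k) (arc_at D h (partner B' h k))" using same_partner step by metis
    then show ?thesis using step.IH same_trans same_sym by metis
  next
    case True
    have "same B (arc_at D c k) (al c) \<or> same B (arc_at D c k) (be c)"
      "same B (arc_at D c (partner B' c k)) (al c) \<or> same B (arc_at D c (partner B' c k)) (be c)"
      using end_at_al_be step partner_less True by auto
    then show ?thesis using step.IH True same_trans same_sym by metis
  qed
qed

lemma circle_of_eq_iff: "circle_of D B x = circle_of D B y \<longleftrightarrow> same B x y"
proof
  assume "circle_of D B x = circle_of D B y"
  then have "y \<in> circle_of D B x" using same_refl[of y B] by (simp add: circle_of_def)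
  then show "same B x y" by (simp add: circle_of_def)
next
  assume "same B x y"
  then show "circle_of D B x = circle_of D B y"
    unfolding circle_of_def by (auto intro: same_trans same_sym)
qed

lemma in_circle_of: "y \<in> circle_of D B x \<longleftrightarrow> same B x y"
  by (simp add: circle_of_def)

lemma circles_eq: "circles D B = circle_of D B ` arcs D"
  by (auto simp: circles_def glue_classes_def circle_rel_def[symmetric] circle_of_def quotient_def)

lemma finite_circles: "finite (circles D B)"
  by (simp add: circles_eq finite_arcs)

lemma circle_of_in: "x \<in> arcs D \<Longrightarrow> circle_of D B x \<in> circles D B"
  by (simp add: circles_eq)

lemma circle_cases: "z \<in> circles D B \<Longrightarrow> (\<And>x. x \<in> arcs D \<Longrightarrow> z = circle_of D B x \<Longrightarrow> P) \<Longrightarrow> P"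
  by (auto simp: circles_eq)

lemma circle_self: "x \<in> circle_of D B x"
  by (simp add: in_circle_of same_refl)

text \<open>This and the following lemmas about \<open>differ_at\<close> treat a saddle from
  \<open>B\<close> to \<open>B'\<close> that splits a circle. A merge is read backwards as a split,
  by \<open>differ_at_sym\<close>.\<close>

lemma split_finer:
  assumes "differ_at c B B'" "same B (al c) (be c)" "same B' x y"
  shows "same B x y"
  using saddle_join[OF assms(1,3)] assms(2) same_trans same_sym by metis

lemma split_unchanged:
  assumes "differ_at c B B'" "same B (al c) (be c)" "\<not> same B x (al c)"
  shows "circle_of D B' x = circle_of D B x"
proof -
  have "same B' x y \<longleftrightarrow> same B x y" for y
  proof
    assume "same B' x y"
    then show "same B x y" by (rule split_finer[OF assms(1,2)])
  next
    have f: "\<not> same B' x (al c)" "\<not> same B' x (be c)"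
      using split_finer[OF assms(1,2)] assms(2,3) same_trans same_sym by blast+
    assume "same B x y"
    then show "same B' x y" using saddle_join[OF differ_at_sym[OF assms(1)]] f by blast
  qed
  then show ?thesis by (auto simp: circle_of_def)
qed

lemma split_two:
  assumes "differ_at c B B'" "same B (al c) (be c)" "same B x (al c)"
  shows "same B' x (al c) \<or> same B' x (be c)"
  using saddle_join[OF differ_at_sym[OF assms(1)] assms(3)] by auto

lemma split_circles:
  assumes d: "differ_at c B B'" and s: "same B (al c) (be c)"
  shows "circles D B - circles D B' = {circle_of D B (al c)}"
    "circles D B' - circles D B = {circle_of D B' (al c), circle_of D B' (be c)}"
    "circle_of D B' (al c) \<noteq> circle_of D B' (be c)"
    "card (circles D B') = Suc (card (circles D B))"
proof -
  have c: "c < length D" using d by (simp add: differ_at_def)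
  have in_arcs: "al c \<in> arcs D" "be c \<in> arcs D" using arc_at_in c by auto
  show ne: "circle_of D B' (al c) \<noteq> circle_of D B' (be c)"
    using saddle_xor[OF d] s by (simp add: circle_of_eq_iff)
  have old: "circle_of D B (al c) \<notin> circles D B'"
  proof
    assume "circle_of D B (al c) \<in> circles D B'"
    then obtain x where "circle_of D B (al c) = circle_of D B' x" by (auto simp: circles_eq)
    then have "al c \<in> circle_of D B' x" "be c \<in> circle_of D B' x"
      using s same_refl by (metis in_circle_of)+
    then show False using ne by (metis circle_of_eq_iff in_circle_of same_sym same_trans)
  qed
  have new: "circle_of D B' y \<notin> circles D B" if "y = al c \<or> y = be c" for y
  proof
    assume "circle_of D B' y \<in> circles D B"
    then obtain x where "circle_of D B' y = circle_of D B x" by (auto simp: circles_eq)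
    moreover have "y \<in> circle_of D B' y" by (rule circle_self)
    ultimately have "circle_of D B' y = circle_of D B y" by (metis in_circle_of circle_of_eq_iff)
    then have "al c \<in> circle_of D B' y" "be c \<in> circle_of D B' y"
      using s that same_refl same_sym by (auto simp: in_circle_of)
    then show False using ne by (metis circle_of_eq_iff in_circle_of same_sym same_trans)
  qed
  have z: "z \<in> circles D B'" if "z \<in> circles D B" "z \<noteq> circle_of D B (al c)" for z
  proof -
    obtain x where x: "x \<in> arcs D" "z = circle_of D B x" using \<open>z \<in> circles D B\<close> by (rule circle_cases)
    then have "z = circle_of D B' x" using split_unchanged[OF d s, of x] that(2) by (metis circle_of_eq_iff)
    then show ?thesis using circle_of_in x by simp
  qed
  show 1: "circles D B - circles D B' = {circle_of D B (al c)}"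
    using z old circle_of_in in_arcs by auto
  have w: "z \<in> circles D B" if zB: "z \<in> circles D B'" "z \<noteq> circle_of D B' (al c)" "z \<noteq> circle_of D B' (be c)" for z
  proof -
    obtain x where "x \<in> arcs D" "z = circle_of D B' x" using zB by (auto simp: circles_eq)
    then show ?thesis using zB split_unchanged[OF d s, of x] split_two[OF d s, of x]
      by (metis circle_of_eq_iff circle_of_in)
  qed
  show 2: "circles D B' - circles D B = {circle_of D B' (al c), circle_of D B' (be c)}"
    using w new circle_of_in in_arcs by auto
  have "card (circles D B') = card (circles D B \<inter> circles D B') + 2"
    using card_Int_Diff[of "circles D B'" "circles D B"] 2 ne finite_circles by (simp add: Int_commute)
  moreover have "card (circles D B) = card (circles D B \<inter> circles D B') + 1"
    using card_Int_Diff[of "circles D B" "circles D B'"] 1 finite_circles by simp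
  ultimately show "card (circles D B') = Suc (card (circles D B))" by simp
qed

end

section \<open>Blocks of states\<close>

text \<open>The sum reads a set as a binary number. It encodes the lexicographic order, with the
  highest crossing most significant, by natural numbers that can be minimised and used in
  ranks.\<close>

lemma sum_power2_less:
  fixes A B :: "nat set"
  assumes fin: "finite A" "finite B" and c: "c \<in> B" "c \<notin> A" and agree: "\<And>h. h > c \<Longrightarrow> h \<in> A \<longleftrightarrow> h \<in> B"
  shows "(\<Sum>i\<in>A. 2 ^ i) < (\<Sum>i\<in>B. 2 ^ i :: nat)"
proof -
  have sub: "A \<subseteq> (B \<inter> {c<..}) \<union> {..<c}"
  proof
    fix i assume "i \<in> A"
    then show "i \<in> (B \<inter> {c<..}) \<union> {..<c}"
      using c agree[of i] by (cases i c rule: linorder_cases) auto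
  qed
  have "(\<Sum>i\<in>A. 2 ^ i) \<le> (\<Sum>i\<in>(B \<inter> {c<..}) \<union> {..<c}. 2 ^ i :: nat)"
  proof (rule sum_mono2[OF _ sub])
    show "finite (B \<inter> {c<..} \<union> {..<c})" using fin by blast
  qed simp
  also have "\<dots> = (\<Sum>i\<in>B \<inter> {c<..}. 2 ^ i) + (\<Sum>i<c. 2 ^ i)"
  proof (rule sum.union_disjoint)
    show "finite (B \<inter> {c<..})" using fin by blast
    show "B \<inter> {c<..} \<inter> {..<c} = {}" by fastforce
  qed simp
  also have "\<dots> < (\<Sum>i\<in>B \<inter> {c<..}. 2 ^ i) + 2 ^ c"
    using sum_power2[of c] by (simp add: lessThan_atLeast0)
  also have "\<dots> = (\<Sum>i\<in>insert c (B \<inter> {c<..}). 2 ^ i)"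
    using fin by simp
  also have "\<dots> \<le> (\<Sum>i\<in>B. 2 ^ i)"
    by (rule sum_mono2) (use fin c in auto)
  finally show ?thesis .
qed

context colored_diagram
begin

definition one_circle :: "nat set \<Rightarrow> bool" where
  "one_circle T \<longleftrightarrow> T \<subseteq> {..<length D} \<and> (\<forall>x\<in>arcs D. \<forall>y\<in>arcs D. same T x y)"

text \<open>Activity without the graph: switching \<open>e\<close> and \<open>g\<close> together
  corresponds to exchanging them in a spanning tree, see \<open>live_iff_lives\<close>.\<close>

definition lives :: "nat set \<Rightarrow> nat set" where
  "lives T = {e. e < length D \<and> (\<forall>g<e. \<not> one_circle (sym_diff T {e, g}))}"

text \<open>For a live crossing \<open>e\<close> of \<open>T\<close>, the circle that is split off at \<open>e\<close>, away from the basepoint.\<close>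

definition far :: "nat set \<Rightarrow> nat \<Rightarrow> nat set" where
  "far T e = {x \<in> arcs D. \<not> same (sym_diff T {e}) x b}"

lemma finite_lives: "finite (lives T)"
  by (rule finite_subset[of _ "{..<length D}"]) (auto simp: lives_def)

lemma lives_less: "e \<in> lives T \<Longrightarrow> e < length D"
  by (simp add: lives_def)

lemma finite_one_circle: "one_circle T \<Longrightarrow> finite T"
  by (auto simp: one_circle_def intro: finite_subset)

lemma card_circles_one: "one_circle T \<Longrightarrow> circles D T = {circle_of D T b}"
proof -
  assume T: "one_circle T"
  then have "circle_of D T x = circle_of D T b" if "x \<in> arcs D" for x
    using that base by (simp add: circle_of_eq_iff one_circle_def)
  then have "circle_of D T ` arcs D = (\<lambda>_. circle_of D T b) ` arcs D" by (rule image_cong[OF refl])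
  then show ?thesis using base by (simp add: circles_eq image_constant_conv ex_in_conv[symmetric] del: ex_in_conv) blast
qed

lemma one_circleI:
  assumes "T \<subseteq> {..<length D}" "card (circles D T) = 1"
  shows "one_circle T"
proof -
  obtain z where z: "circles D T = {z}" using assms(2) card_1_singletonE by blast
  have "same T x y" if "x \<in> arcs D" "y \<in> arcs D" for x y
    using circle_of_in[OF that(1), of T] circle_of_in[OF that(2), of T] z by (simp add: circle_of_eq_iff[symmetric])
  then show ?thesis using assms(1) by (simp add: one_circle_def)
qed

lemma one_circle_iff_card:
  "one_circle T \<longleftrightarrow> T \<subseteq> {..<length D} \<and> card (circles D T) = 1"
  using one_circleI card_circles_one one_circle_def by auto

lemma differ_sym_diff: "e < length D \<Longrightarrow> differ_at e T (sym_diff T {e})"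
  by (auto simp: differ_at_def)

lemma al_be_in: "e < length D \<Longrightarrow> al e \<in> arcs D" "e < length D \<Longrightarrow> be e \<in> arcs D"
  using arc_at_in by auto

context
  fixes T
  assumes T: "one_circle T"
begin

lemma all_same: "x \<in> arcs D \<Longrightarrow> y \<in> arcs D \<Longrightarrow> same T x y"
  using T by (simp add: one_circle_def)

lemma flip_two:
  assumes e: "e < length D"
  shows "\<not> same (sym_diff T {e}) (al e) (be e)"
    "x \<in> arcs D \<Longrightarrow> same (sym_diff T {e}) x (al e) \<or> same (sym_diff T {e}) x (be e)"
proof -
  have s: "same T (al e) (be e)" using all_same al_be_in e by blast
  show "\<not> same (sym_diff T {e}) (al e) (be e)" using saddle_xor[OF differ_sym_diff[OF e]] s by blast
  show "x \<in> arcs D \<Longrightarrow> same (sym_diff T {e}) x (al e) \<or> same (sym_diff T {e}) x (be e)"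
    using split_two[OF differ_sym_diff[OF e] s] all_same al_be_in e by blast
qed

lemma far_al_be: "e < length D \<Longrightarrow> al e \<in> far T e \<longleftrightarrow> be e \<notin> far T e"
  using flip_two[of e] flip_two(2)[of e b] al_be_in[of e] base same_sym same_trans
  unfolding far_def mem_Collect_eq by meson

lemma far_base: "b \<notin> far T e"
  by (simp add: far_def same_refl)

text \<open>Switching \<open>e\<close> splits the only circle of \<open>T\<close> in two. If the
  strands at \<open>g\<close> lay on different ones of them, switching \<open>g\<close> as well
  would merge them into one circle again.\<close>

lemma no_cross:
  assumes e: "e < length D" and g: "g < length D" and eg: "e \<noteq> g"
    and n: "\<not> one_circle (sym_diff T {e, g})"
  shows "same (sym_diff T {e}) (al g) (be g)"
proof (rule ccontr)
  let ?T' = "sym_diff T {e}" and ?T'' = "sym_diff T {e, g}"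
  assume ns: "\<not> same ?T' (al g) (be g)"
  have d: "differ_at g ?T'' ?T'" using g eg by (auto simp: differ_at_def)
  have s: "same ?T'' (al g) (be g)" using saddle_xor[OF d] ns by blast
  have "same ?T'' x (al g)" if "x \<in> arcs D" for x
  proof -
    have "same ?T' x (al g) \<or> same ?T' x (be g)"
    proof -
      have "circle_of D ?T' z = circle_of D ?T' (al e) \<or> circle_of D ?T' z = circle_of D ?T' (be e)"
        if "z \<in> arcs D" for z
        using flip_two(2)[OF e that] by (simp add: circle_of_eq_iff)
      from this[OF that] this[OF al_be_in(1)[OF g]] this[OF al_be_in(2)[OF g]] ns show ?thesis
        unfolding circle_of_eq_iff[symmetric] by metis
    qed
    then show ?thesis using split_finer[OF d s] s same_trans same_sym by blast
  qed
  then have "same ?T'' x y" if "x \<in> arcs D" "y \<in> arcs D" for x y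
    using that same_trans same_sym by blast
  then have "one_circle ?T''" using T e g by (auto simp: one_circle_def)
  then show False using n by blast
qed

lemma no_cross_low: "e \<in> lives T \<Longrightarrow> g < e \<Longrightarrow> same (sym_diff T {e}) (al g) (be g)"
  by (rule no_cross) (auto simp: lives_def)

lemma no_cross_live:
  assumes "e \<in> lives T" "g \<in> lives T" "e \<noteq> g"
  shows "same (sym_diff T {e}) (al g) (be g)"
proof (rule no_cross)
  have "{e, g} = {g, e}" by auto
  then show "\<not> one_circle (sym_diff T {e, g})"
    using assms unfolding lives_def by (cases "g < e") auto
qed (use assms in \<open>auto simp: lives_def\<close>)

text \<open>Where \<open>B\<close> agrees with the state split at \<open>e\<close>, it glues arcs of
  one circle of that state. Elsewhere both strands lie on the same circle, so no way of connecting
  the four ends leads from the far side to the near side.\<close>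

lemma far_closed:
  assumes B: "\<And>h. h < length D \<Longrightarrow> (h \<in> B \<longleftrightarrow> h \<in> sym_diff T {e}) \<or> same (sym_diff T {e}) (al h) (be h)"
    and xy: "same B x y"
  shows "x \<in> far T e \<longleftrightarrow> y \<in> far T e"
  using xy
proof (induction rule: same_induct)
  case refl then show ?case by simp
next
  case (step h k)
  let ?T' = "sym_diff T {e}"
  have "same ?T' (arc_at D h k) (arc_at D h (partner B h k))"
  proof (cases "h \<in> B \<longleftrightarrow> h \<in> ?T'")
    case True
    then have "partner B h k = partner ?T' h k" unfolding partner_def by (rule if_cong) auto
    then show ?thesis using same_partner step by metis
  next
    case False
    then have "same ?T' (al h) (be h)" using B step by blast
    then show ?thesis using end_at_al_be[of h k ?T'] end_at_al_be[of h "partner B h k" ?T'] step partner_less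
        same_sym same_trans by meson
  qed
  then have "arc_at D h k \<in> far T e \<longleftrightarrow> arc_at D h (partner B h k) \<in> far T e"
    using same_sym same_trans arc_at_in step partner_less unfolding far_def by blast
  then show ?case using step by blast
qed

text \<open>Above \<open>c\<close> the state \<open>T'\<close> agrees with the state split at
  \<open>c\<close>, at \<open>c\<close> too, and below \<open>c\<close> no strands are separated
  since \<open>c\<close> is live. So \<open>far T c\<close> is a union of circles of
  \<open>T'\<close>, although it contains just one of the two strands at \<open>c\<close>.\<close>

lemma first_disagreement:
  assumes T': "one_circle T'" and c: "c \<in> lives T" and cT: "(c \<in> T) \<noteq> (c \<in> T')"
    and agree: "\<And>h. h > c \<Longrightarrow> h \<in> T \<longleftrightarrow> h \<in> T'"
  shows False
proof -
  have cl: "c < length D" using c by (simp add: lives_def)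
  have "x \<in> far T c \<longleftrightarrow> y \<in> far T c" if "same T' x y" for x y
  proof (rule far_closed[OF _ that])
    fix h assume "h < length D"
    show "(h \<in> T' \<longleftrightarrow> h \<in> sym_diff T {c}) \<or> same (sym_diff T {c}) (al h) (be h)"
      using no_cross_low[OF c, of h] agree[of h] cT by (cases h c rule: linorder_cases) auto
  qed
  then show False using far_al_be[OF cl] T' al_be_in[OF cl] unfolding one_circle_def by blast
qed

end

text \<open>At the highest crossing where the two states differ, \<open>B\<close> differs from one
  of them. The crossing is live for that one, which \<open>first_disagreement\<close>
  forbids.\<close>

lemma block_unique:
  assumes T: "one_circle T" and T': "one_circle T'"
    and B: "sym_diff B T \<subseteq> lives T" "sym_diff B T' \<subseteq> lives T'"
  shows "T = T'"
proof (rule ccontr)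
  assume "T \<noteq> T'"
  then have ne: "sym_diff T T' \<noteq> {}" by blast
  have fin: "finite (sym_diff T T')" using finite_one_circle T T' by blast
  define c where "c = Max (sym_diff T T')"
  have c: "c \<in> sym_diff T T'" using Max_in[OF fin ne] by (simp add: c_def)
  have agree: "h \<in> T \<longleftrightarrow> h \<in> T'" if "h > c" for h
  proof (rule ccontr)
    assume "\<not> ?thesis"
    then have "h \<in> sym_diff T T'" by blast
    then show False using Max_ge[OF fin] that unfolding c_def by fastforce
  qed
  show False
  proof (cases "c \<in> sym_diff B T")
    case True
    then show False using first_disagreement[OF T T', of c] c B agree by blast
  next
    case False
    then have "c \<in> lives T'" using c B by blast
    then show False using first_disagreement[OF T' T, of c] c agree by blast
  qed
qed

text \<open>In a state with the fewest circles no saddle merges circles, so all four ends at a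
  crossing lie on one circle. Following the knot from passage to passage then reaches every arc;
  this is where the diagram has a single component.\<close>

lemma one_circle_exists: "\<exists>T. one_circle T"
proof -
  obtain B where B: "B \<subseteq> {..<length D}"
    and min: "\<And>B'. B' \<subseteq> {..<length D} \<Longrightarrow> card (circles D B) \<le> card (circles D B')"
    using ex_has_least_nat[of "\<lambda>B. B \<subseteq> {..<length D}" "{}" "\<lambda>B. card (circles D B)"] by blast
  have ab: "same B (al c) (be c)" if c: "c < length D" for c
  proof (rule ccontr)
    assume n: "\<not> same B (al c) (be c)"
    let ?B' = "sym_diff B {c}"
    have d: "differ_at c B ?B'" by (rule differ_sym_diff[OF c])
    have "same ?B' (al c) (be c)" using saddle_xor[OF d] n by blast
    then have "card (circles D B) = Suc (card (circles D ?B'))"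
      using split_circles(4)[OF differ_at_sym[OF d]] by blast
    moreover have "?B' \<subseteq> {..<length D}" using B c by auto
    ultimately show False using min[of ?B'] by simp
  qed
  have ends: "same B (arc_at D c k) (arc_at D c k')" if "c < length D" "k < 4" "k' < 4" for c k k'
    using end_at_al_be[of c k B] end_at_al_be[of c k' B] ab[of c] that same_sym same_trans by meson
  have pas: "same B t (out_arc D t)" if t: "t < 2 * length D" for t
  proof -
    have "t \<in> set (map under D @ map over D)" using knot t by (simp add: knot_diagram_def)
    then obtain c where c: "c < length D" "t = under (D ! c) \<or> t = over (D ! c)"
      by (auto simp: in_set_conv_nth)
    have "\<exists>k<4. \<exists>k'<4. arc_at D c k = t \<and> arc_at D c k' = out_arc D t"
    proof (cases "t = under (D ! c)")
      case True
      then have "arc_at D c 0 = t" "arc_at D c 2 = out_arc D t"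
        by (simp_all add: arc_at_def arc_ends_nth Let_def)
      then show ?thesis by (metis less4)
    next
      case False
      then have "t = over (D ! c)" using c by blast
      then have "arc_at D c (if positive (D ! c) then 3 else 1) = t"
        "arc_at D c (if positive (D ! c) then 1 else 3) = out_arc D t"
        by (simp_all add: arc_at_def arc_ends_nth Let_def)
      moreover have "(if positive (D ! c) then 3 else 1) < (4::nat)" "(if positive (D ! c) then 1 else 3) < (4::nat)"
        by auto
      ultimately show ?thesis by blast
    qed
    then obtain k k' where "k < 4" "k' < 4" "arc_at D c k = t" "arc_at D c k' = out_arc D t" by blast
    then show ?thesis using ends[OF c(1), of k k'] by simp
  qed
  have "same B 0 t" if "t \<in> arcs D" for t
    using that
  proof (induction t)
    case 0 show ?case by (rule same_refl)
  next
    case (Suc t)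
    then have "Suc t < 2 * length D" by (auto simp: arcs_def)
    then have "out_arc D t = Suc t" "t < 2 * length D" "t \<in> arcs D" by (auto simp: out_arc_def arcs_def)
    then show ?case using Suc pas[of t] same_trans by metis
  qed
  then have "same B x y" if "x \<in> arcs D" "y \<in> arcs D" for x y
    using that by (blast intro: same_trans[OF same_sym])
  then show ?thesis using B unfolding one_circle_def by blast
qed

text \<open>A one-circle state closest to \<open>B\<close> in the lexicographic sense works: a disagreement at a
  crossing that is not live could be exchanged for one at a lower crossing.\<close>

lemma block_exists: "\<exists>T. one_circle T \<and> sym_diff B T \<subseteq> lives T" if B: "B \<subseteq> {..<length D}"
proof -
  define m where "m T = (\<Sum>i\<in>sym_diff B T. 2 ^ i :: nat)" for T
  obtain T where T: "one_circle T" and min: "\<And>T'. one_circle T' \<Longrightarrow> m T \<le> m T'"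
    using one_circle_exists ex_has_least_nat[of one_circle _ m] by metis
  have finB: "finite B" using B finite_subset by blast
  have "c \<in> lives T" if c: "c \<in> sym_diff B T" for c
  proof (rule ccontr)
    assume "c \<notin> lives T"
    moreover have "c < length D" using c B T by (auto simp: one_circle_def)
    ultimately obtain g where g: "g < c" "one_circle (sym_diff T {c, g})" by (auto simp: lives_def)
    have "m (sym_diff T {c, g}) < m T"
      unfolding m_def
    proof (rule sum_power2_less[where c = c])
      show "finite (sym_diff B (sym_diff T {c, g}))" "finite (sym_diff B T)"
        using finB finite_one_circle[OF T] by auto
    qed (use c g in auto)
    then show False using min[OF g(2)] by simp
  qed
  then show ?thesis using T by blast
qed

definition tree_of :: "nat set \<Rightarrow> nat set" where
  "tree_of B = (THE T. one_circle T \<and> sym_diff B T \<subseteq> lives T)"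

lemma tree_of_eq: "one_circle T \<Longrightarrow> sym_diff B T \<subseteq> lives T \<Longrightarrow> tree_of B = T"
  unfolding tree_of_def by (rule the_equality) (use block_unique in blast)+

lemma tree_of:
  assumes "B \<subseteq> {..<length D}"
  shows "one_circle (tree_of B)" "sym_diff B (tree_of B) \<subseteq> lives (tree_of B)"
  using block_exists[OF assms] tree_of_eq by auto

text \<open>By \<open>first_disagreement\<close> the highest crossing where the two trees differ is
  live for neither, so each tree agrees with its own state there. Since the second state contains
  the first, the difference is that the second tree contains this crossing.\<close>

lemma tree_of_mono:
  assumes B: "B \<subseteq> {..<length D}" and c: "c < length D" "c \<notin> B"
  shows "tree_of B = tree_of (insert c B) \<or>
    (\<Sum>i\<in>tree_of B. 2 ^ i) < (\<Sum>i\<in>tree_of (insert c B). 2 ^ i :: nat)"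
proof (rule disjCI)
  let ?T = "tree_of B" and ?B' = "insert c B"
  let ?T' = "tree_of ?B'"
  have B': "?B' \<subseteq> {..<length D}" using B c by simp
  note T = tree_of(1)[OF B] and T' = tree_of(1)[OF B']
  note L = tree_of(2)[OF B] and L' = tree_of(2)[OF B']
  assume nl: "\<not> (\<Sum>i\<in>?T. 2 ^ i) < (\<Sum>i\<in>?T'. 2 ^ i :: nat)"
  show "?T = ?T'"
  proof (rule ccontr)
    assume "?T \<noteq> ?T'"
    then have ne: "sym_diff ?T ?T' \<noteq> {}" by blast
    have fin: "finite (sym_diff ?T ?T')" using finite_one_circle T T' by blast
    define h where "h = Max (sym_diff ?T ?T')"
    have h: "h \<in> sym_diff ?T ?T'" using Max_in[OF fin ne] by (simp add: h_def)
    have agree: "i \<in> ?T \<longleftrightarrow> i \<in> ?T'" if "i > h" for i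
    proof (rule ccontr)
      assume "\<not> ?thesis"
      then have "i \<in> sym_diff ?T ?T'" by blast
      then show False using Max_ge[OF fin] that unfolding h_def by fastforce
    qed
    have n: "h \<notin> lives ?T" "h \<notin> lives ?T'"
      using first_disagreement[OF T T', of h] first_disagreement[OF T' T, of h] h agree by blast+
    then have "h \<in> B \<longleftrightarrow> h \<in> ?T" "h \<in> ?B' \<longleftrightarrow> h \<in> ?T'" using L L' by blast+
    then have "h \<in> ?T'" "h \<notin> ?T" using h by blast+
    then show False
      using sum_power2_less[OF finite_one_circle[OF T] finite_one_circle[OF T'], of h] agree nl by blast
  qed
qed

section \<open>The tree of circles in a state of a block\<close>

definition near_end :: "nat set \<Rightarrow> nat \<Rightarrow> nat" where
  "near_end T e = (if al e \<in> far T e then be e else al e)"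

definition far_end :: "nat set \<Rightarrow> nat \<Rightarrow> nat" where
  "far_end T e = (if al e \<in> far T e then al e else be e)"

context
  fixes T
  assumes T: "one_circle T"
begin

lemma far_end: "e < length D \<Longrightarrow> far_end T e \<in> far T e" "e < length D \<Longrightarrow> near_end T e \<notin> far T e"
  using far_al_be[OF T] by (auto simp: far_end_def near_end_def)

lemma ends_in: "e < length D \<Longrightarrow> far_end T e \<in> arcs D" "e < length D \<Longrightarrow> near_end T e \<in> arcs D"
  using al_be_in by (auto simp: far_end_def near_end_def)

lemma ends_cases: "far_end T e = al e \<and> near_end T e = be e \<or> far_end T e = be e \<and> near_end T e = al e"
  by (auto simp: far_end_def near_end_def)

text \<open>The strands at the other live crossings are not separated by \<open>e\<close>, so
  switching these crossings cannot connect the two sides.\<close>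

lemma block_far:
  assumes W: "W \<subseteq> lives T" "e \<in> W" and "same (sym_diff T W) x y"
  shows "x \<in> far T e \<longleftrightarrow> y \<in> far T e"
proof (rule far_closed[OF T _ assms(3)])
  fix h assume "h < length D"
  show "(h \<in> sym_diff T W \<longleftrightarrow> h \<in> sym_diff T {e}) \<or> same (sym_diff T {e}) (al h) (be h)"
    using no_cross_live[OF T, of e h] W by (cases "h \<in> W \<and> h \<noteq> e") auto
qed

lemma block_split:
  assumes W: "W \<subseteq> lives T" "e \<in> W"
  shows "\<not> same (sym_diff T W) (al e) (be e)"
  using block_far[OF W] far_al_be[OF T] W lives_less by blast

lemma block_differ:
  assumes "e \<in> lives T" "e \<notin> W"
  shows "differ_at e (sym_diff T W) (sym_diff T (insert e W))"
  using assms lives_less by (auto simp: differ_at_def)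

lemma block_joined:
  assumes W: "W \<subseteq> lives T" and e: "e \<in> lives T" "e \<notin> W"
  shows "same (sym_diff T W) (al e) (be e)"
  using saddle_xor[OF block_differ[OF e]] block_split[of "insert e W" e] W e by blast

lemma card_block_circles:
  assumes "W \<subseteq> lives T"
  shows "card (circles D (sym_diff T W)) = Suc (card W)"
proof -
  have "finite W" using assms finite_lives finite_subset by blast
  then show ?thesis
    using assms
  proof (induction W)
    case empty
    have "sym_diff T {} = T" by auto
    then show ?case using card_circles_one[OF T] by simp
  next
    case (insert e W)
    then have "card (circles D (sym_diff T (insert e W))) = Suc (card (circles D (sym_diff T W)))"
      using split_circles(4)[OF block_differ block_joined] by blast
    then show ?case using insert by simp
  qed
qed

text \<open>Both strands at \<open>g\<close> are in \<open>far T e\<close>. An arc of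
  \<open>far T g\<close> outside \<open>far T e\<close> would be on the basepoint's circle when only
  \<open>e\<close> is switched. Switching \<open>g\<close> too alters only circles inside
  \<open>far T e\<close>, so the arc would still be connected to the basepoint, against its being in
  \<open>far T g\<close>.\<close>

lemma far_nested:
  assumes e: "e \<in> lives T" and g: "g \<in> lives T" and eg: "e \<noteq> g" and i: "far_end T g \<in> far T e \<or> near_end T g \<in> far T e"
  shows "far T g \<subset> far T e"
proof -
  let ?T' = "sym_diff T {e}" and ?T'' = "sym_diff T {e, g}"
  have s: "same ?T' (al g) (be g)" by (rule no_cross_live[OF T e g eg])
  then have in_far: "al g \<in> far T e" "be g \<in> far T e"
    using block_far[of "{e}" e "al g" "be g"] e i ends_cases[of g] by auto
  have d: "differ_at g ?T'' ?T'" using lives_less[OF g] eg by (auto simp: differ_at_def)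
  have "u \<in> far T e" if u: "u \<in> far T g" for u
  proof (rule ccontr)
    assume nu: "u \<notin> far T e"
    then have "same ?T' u b" using u by (simp add: far_def)
    then have "same ?T'' u b \<or> same ?T'' u (al g) \<or> same ?T'' u (be g)"
      using saddle_join[OF d] by blast
    moreover have "\<not> same ?T'' u (al g)" "\<not> same ?T'' u (be g)"
      using block_far[of "{e, g}" e] e g nu in_far by blast+
    ultimately have "same ?T'' u b" by blast
    then show False using block_far[of "{e, g}" g u b] e g u far_base[OF T] by blast
  qed
  moreover have "near_end T g \<in> far T e" "near_end T g \<notin> far T g"
    using in_far ends_cases[of g] far_end lives_less[OF g] by auto
  ultimately show ?thesis by blast
qed

lemma far_ends_differ:
  assumes W: "W \<subseteq> lives T" and e: "e \<in> W" and g: "g \<in> W" and s: "same (sym_diff T W) (far_end T e) (far_end T g)"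
  shows "e = g"
proof (rule ccontr)
  assume eg: "e \<noteq> g"
  have "far_end T g \<in> far T e" "far_end T e \<in> far T g"
    using block_far[OF W e s] block_far[OF W g s] far_end lives_less W e g by blast+
  then show False using far_nested[of e g] far_nested[of g e] e g W eg by blast
qed

lemma far_end_not_base:
  assumes "W \<subseteq> lives T" "e \<in> W"
  shows "\<not> same (sym_diff T W) (far_end T e) b"
  using block_far[OF assms] far_end far_base[OF T] lives_less assms by blast

text \<open>The parent of the circle split off at \<open>e\<close> is the circle through its near
  end. That it has a larger \<open>far\<close> set is what bounds the movement of signs towards the
  root.\<close>

lemma parent_far:
  assumes W: "W \<subseteq> lives T" and e: "e \<in> lives T" and g: "g \<in> W" "e \<noteq> g"
    and s: "same (sym_diff T W) (near_end T e) (far_end T g)"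
  shows "card (far T e) < card (far T g)"
proof -
  have "near_end T e \<in> far T g" using block_far[OF W g(1) s] far_end lives_less W g by blast
  then have "far T e \<subset> far T g" using far_nested[of g e] W e g by blast
  moreover have "finite (far T g)" using finite_arcs by (simp add: far_def)
  ultimately show ?thesis by (rule psubset_card_mono[rotated])
qed

text \<open>The basepoint and the far ends represent different circles, and they are as many as
  \<open>card_block_circles\<close> allows.\<close>

lemma block_circles:
  assumes W: "W \<subseteq> lives T"
  shows "circles D (sym_diff T W) = insert (circle_of D (sym_diff T W) b) ((\<lambda>e. circle_of D (sym_diff T W) (far_end T e)) ` W)"
proof (rule card_subset_eq[symmetric])
  let ?B = "sym_diff T W"
  have fin: "finite W" using W finite_lives finite_subset by blast
  show "finite (circles D ?B)" by (rule finite_circles)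
  show "insert (circle_of D ?B b) ((\<lambda>e. circle_of D ?B (far_end T e)) ` W) \<subseteq> circles D ?B"
    using circle_of_in base ends_in lives_less W by (auto simp: subset_iff)
  have "inj_on (\<lambda>e. circle_of D ?B (far_end T e)) W"
    using far_ends_differ[OF W] by (auto simp: inj_on_def circle_of_eq_iff)
  moreover have "circle_of D ?B b \<noteq> circle_of D ?B (far_end T e)" if "e \<in> W" for e
    using far_end_not_base[OF W that] by (metis circle_of_eq_iff)
  then have "circle_of D ?B b \<notin> (\<lambda>e. circle_of D ?B (far_end T e)) ` W" by blast
  ultimately show "card (insert (circle_of D ?B b) ((\<lambda>e. circle_of D ?B (far_end T e)) ` W)) = card (circles D ?B)"
    using card_block_circles[OF W] fin by (simp add: card_image)
qed

text \<open>As sets of arcs the circles change with the saddle at \<open>e\<close>, so signs have to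
  be followed along fixed representatives. The representative of the parent is the same before and
  after the split.\<close>

lemma parent_stable:
  assumes W: "insert e W \<subseteq> lives T" and e: "e \<notin> W" and u: "u = b \<or> u \<in> far_end T ` W"
  shows "same (sym_diff T W) u (near_end T e) \<longleftrightarrow> same (sym_diff T (insert e W)) u (near_end T e)"
proof -
  let ?B = "sym_diff T W" and ?B' = "sym_diff T (insert e W)"
  have el: "e \<in> lives T" and Wl: "W \<subseteq> lives T" using W by auto
  note d = block_differ[OF el e] and s = block_joined[OF Wl el e]
  have nfar: "\<not> same ?B' u (far_end T e)"
    using u far_ends_differ[OF W, of _ e] far_end_not_base[OF W, of e] same_sym e by blast
  show ?thesis
  proof
    assume "same ?B u (near_end T e)"
    then have "same ?B u (al e)" using s ends_cases[of e] same_trans same_sym by metis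
    then show "same ?B' u (near_end T e)" using split_two[OF d s] nfar ends_cases[of e] by metis
  next
    assume "same ?B' u (near_end T e)"
    then show "same ?B u (near_end T e)" by (rule split_finer[OF d s])
  qed
qed

end

end

section \<open>The matching of the enhanced states\<close>

context colored_diagram
begin

lemma step_split_iff:
  assumes c: "c < length D" "c \<notin> B" and s: "same B (al c) (be c)"
  shows "state_step D c (B, P) (insert c B, P') \<longleftrightarrow>
    P \<inter> circles D (insert c B) = P' \<inter> circles D B \<and>
    split_rule P P' (circle_of D B (al c)) (circle_of D (insert c B) (al c)) (circle_of D (insert c B) (be c))"
proof -
  have d: "differ_at c B (insert c B)" using c by (auto simp: differ_at_def)
  \<comment> \<open>The two new circles may be named in either order; the rule is symmetric in
    them.\<close>
  have "(\<exists>x y z. x \<noteq> y \<and> ({w} = {x, y} \<and> {u, v} = {z} \<and> M x y z \<or> {w} = {z} \<and> {u, v} = {x, y} \<and> N z x y))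
      \<longleftrightarrow> N w u v \<or> N w v u" if "u \<noteq> v" for u v w :: "nat set" and M N
    using that by (auto simp: doubleton_eq_iff)
  from this[OF split_circles(3)[OF d s]] show ?thesis
    unfolding state_step_def case_prod_conv split_circles(1,2)[OF d s] using c
    by (simp add: split_rule_def) argo
qed

lemma step_merge_iff:
  assumes c: "c < length D" "c \<notin> B" and s: "\<not> same B (al c) (be c)"
  shows "state_step D c (B, P) (insert c B, P') \<longleftrightarrow>
    P \<inter> circles D (insert c B) = P' \<inter> circles D B \<and>
    merge_rule P P' (circle_of D B (al c)) (circle_of D B (be c)) (circle_of D (insert c B) (al c))"
proof -
  have d: "differ_at c B (insert c B)" using c by (auto simp: differ_at_def)
  then have s': "same (insert c B) (al c) (be c)" using saddle_xor s by blast
  note d' = differ_at_sym[OF d]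
  have "(\<exists>x y z. x \<noteq> y \<and> ({u, v} = {x, y} \<and> {w} = {z} \<and> M x y z \<or> {u, v} = {z} \<and> {w} = {x, y} \<and> N z x y))
      \<longleftrightarrow> M u v w \<or> M v u w" if "u \<noteq> v" for u v w :: "nat set" and M N
  proof -
    have ne: "{u, v} \<noteq> {z}" for z using that by blast
    show ?thesis
    proof
      assume "\<exists>x y z. x \<noteq> y \<and> ({u, v} = {x, y} \<and> {w} = {z} \<and> M x y z \<or> {u, v} = {z} \<and> {w} = {x, y} \<and> N z x y)"
      then show "M u v w \<or> M v u w"
      proof (elim exE conjE disjE)
        fix x y z assume "{u, v} = {x, y}" "{w} = {z}" "M x y z"
        then show ?thesis unfolding doubleton_eq_iff by auto
      next
        fix x y z assume "{u, v} = {z}"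
        then show ?thesis using ne by metis
      qed
    next
      assume "M u v w \<or> M v u w"
      then show "\<exists>x y z. x \<noteq> y \<and> ({u, v} = {x, y} \<and> {w} = {z} \<and> M x y z \<or> {u, v} = {z} \<and> {w} = {x, y} \<and> N z x y)"
        using that insert_commute[of u v "{}"] by metis
    qed
  qed
  from this[OF split_circles(3)[OF d' s']] show ?thesis
    unfolding state_step_def case_prod_conv split_circles(1,2)[OF d' s'] using c
    by (simp add: merge_rule_def) argo
qed

text \<open>A state is recorded by its tree \<open>T\<close>, the set \<open>B\<close> and a set \<open>Q\<close> of live crossings: the sign of the
  circle split off at \<open>e\<close> is \<open>+\<close> iff \<open>e \<in> Q\<close>. If no circle is split off at \<open>e\<close>, a virtual sign is
  used: the one for which the differential can transport it unchanged to the circle split off at \<open>e\<close>.\<close>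

definition sign_set :: "enhanced_state \<Rightarrow> nat set" where
  "sign_set s = (let B = fst s; T = tree_of B in
     {e \<in> lives T. if e \<in> sym_diff B T then circle_of D B (far_end T e) \<in> snd s else e \<notin> T})"

text \<open>The inverse of recording a state by \<open>sign_set\<close>. Only the circles that are
  actually split off receive signs, so virtual signs leave no trace.\<close>

definition make_state :: "nat set \<Rightarrow> nat set \<Rightarrow> nat set \<Rightarrow> enhanced_state" where
  "make_state T Q B =
     (B, insert (circle_of D B b) ((\<lambda>e. circle_of D B (far_end T e)) ` (sym_diff B T \<inter> Q)))"

text \<open>The crossings whose sign equals the virtual sign, so that both smoothings are possible
  with the same \<open>Q\<close>. The differential acts there as a unit: for \<open>e\<close>
  outside \<open>T\<close> a split gives the new far circle the sign \<open>+\<close> and leaves the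
  parent's sign, for \<open>e\<close> in \<open>T\<close> a far circle with sign \<open>-\<close> is
  absorbed.\<close>

definition free :: "nat set \<Rightarrow> nat set \<Rightarrow> nat set" where
  "free T Q = {e \<in> lives T. e \<in> Q \<longleftrightarrow> e \<notin> T}"

definition valid :: "nat set \<Rightarrow> nat set \<Rightarrow> nat set \<Rightarrow> bool" where
  "valid T Q B \<longleftrightarrow> one_circle T \<and> Q \<subseteq> lives T \<and> sym_diff B T \<subseteq> lives T \<and> lives T - free T Q \<subseteq> sym_diff B T"

lemma sym_diff_twice: "sym_diff T (sym_diff B T) = B"
  by auto

lemma valid_block:
  assumes "valid T Q B"
  shows "one_circle T" "sym_diff B T \<subseteq> lives T" "tree_of B = T" "B \<subseteq> {..<length D}"
proof -
  show T: "one_circle T" and W: "sym_diff B T \<subseteq> lives T" using assms by (auto simp: valid_def)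
  then show "tree_of B = T" by (rule tree_of_eq)
  show "B \<subseteq> {..<length D}" using T W unfolding one_circle_def lives_def by blast
qed

lemma make_state_base: "circle_of D B b \<in> snd (make_state T Q B)"
  by (simp add: make_state_def)

lemma make_state_mem:
  assumes v: "valid T Q B" and e: "e \<in> sym_diff B T"
  shows "circle_of D B (far_end T e) \<in> snd (make_state T Q B) \<longleftrightarrow> e \<in> Q"
proof
  note T = valid_block(1)[OF v] and W = valid_block(2)[OF v]
  assume "circle_of D B (far_end T e) \<in> snd (make_state T Q B)"
  moreover have "circle_of D B (far_end T e) \<noteq> circle_of D B b"
    using far_end_not_base[OF T W e] by (simp add: circle_of_eq_iff sym_diff_twice)
  ultimately obtain g where g: "g \<in> sym_diff B T \<inter> Q" "circle_of D B (far_end T e) = circle_of D B (far_end T g)"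
    by (auto simp: make_state_def)
  then have "e = g" using far_ends_differ[OF T W e, of g] by (simp add: circle_of_eq_iff sym_diff_twice)
  then show "e \<in> Q" using g by blast
qed (use e in \<open>auto simp: make_state_def\<close>)

lemma block_circles':
  assumes "one_circle T" "sym_diff B T \<subseteq> lives T"
  shows "circles D B = insert (circle_of D B b) ((\<lambda>e. circle_of D B (far_end T e)) ` sym_diff B T)"
  using block_circles[OF assms] by (simp add: sym_diff_twice)

lemma make_state_reduced:
  assumes v: "valid T Q B"
  shows "make_state T Q B \<in> reduced_states D b" "sign_set (make_state T Q B) = Q" "fst (make_state T Q B) = B"
proof -
  note T = valid_block(1)[OF v] and W = valid_block(2)[OF v]
  show B: "fst (make_state T Q B) = B" by (simp add: make_state_def)
  have "snd (make_state T Q B) \<subseteq> circles D B"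
    using block_circles'[OF T W] by (auto simp: make_state_def)
  then show "make_state T Q B \<in> reduced_states D b"
    using valid_block(4)[OF v] make_state_base[of B T Q] circle_self[of b B] B
    unfolding reduced_states_def enhanced_states_def by (auto simp: case_prod_beta)
  have "e \<in> sign_set (make_state T Q B) \<longleftrightarrow> e \<in> Q" for e
  proof (cases "e \<in> sym_diff B T")
    case True
    then show ?thesis using make_state_mem[OF v True] W
      unfolding sign_set_def Let_def B valid_block(3)[OF v] by auto
  next
    case False
    then have "e \<in> lives T \<Longrightarrow> e \<in> Q \<longleftrightarrow> e \<notin> T" using v by (auto simp: valid_def free_def)
    then show ?thesis using False v
      unfolding sign_set_def Let_def B valid_block(3)[OF v] valid_def by auto
  qed
  then show "sign_set (make_state T Q B) = Q" by blast
qed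

lemma reduced_state_valid:
  assumes s: "s \<in> reduced_states D b"
  shows "valid (tree_of (fst s)) (sign_set s) (fst s)"
    "s = make_state (tree_of (fst s)) (sign_set s) (fst s)"
proof -
  obtain B P where BP: "s = (B, P)" by (cases s)
  define T where "T = tree_of B"
  have B: "B \<subseteq> {..<length D}" and P: "P \<subseteq> circles D B" and "\<exists>x\<in>P. b \<in> x"
    using s BP by (auto simp: reduced_states_def enhanced_states_def)
  then obtain x where x: "x \<in> P" "b \<in> x" by blast
  then have bP: "circle_of D B b \<in> P" using P by (metis circle_cases circle_of_eq_iff in_circle_of subsetD)
  note T = tree_of(1)[OF B, folded T_def] and W = tree_of(2)[OF B, folded T_def]
  have Q: "sign_set s = {e \<in> lives T. if e \<in> sym_diff B T then circle_of D B (far_end T e) \<in> P else e \<notin> T}"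
    by (simp add: sign_set_def BP T_def Let_def)
  have v: "valid T (sign_set s) B"
    using T W unfolding valid_def Q free_def by auto
  have "P = insert (circle_of D B b) ((\<lambda>e. circle_of D B (far_end T e)) ` (sym_diff B T \<inter> sign_set s))"
  proof
    show "P \<subseteq> insert (circle_of D B b) ((\<lambda>e. circle_of D B (far_end T e)) ` (sym_diff B T \<inter> sign_set s))"
    proof
      fix z assume z: "z \<in> P"
      then have "z \<in> circles D B" using P by blast
      then consider "z = circle_of D B b" | e where "e \<in> sym_diff B T" "z = circle_of D B (far_end T e)"
        unfolding block_circles'[OF T W] by blast
      then show "z \<in> insert (circle_of D B b) ((\<lambda>e. circle_of D B (far_end T e)) ` (sym_diff B T \<inter> sign_set s))"
      proof cases
        case 2
        then have "e \<in> sign_set s" using z W unfolding Q by auto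
        then show ?thesis using 2 by blast
      qed blast
    qed
    show "insert (circle_of D B b) ((\<lambda>e. circle_of D B (far_end T e)) ` (sym_diff B T \<inter> sign_set s)) \<subseteq> P"
      using bP unfolding Q by auto
  qed
  then show "s = make_state (tree_of (fst s)) (sign_set s) (fst s)"
    using BP by (simp add: make_state_def T_def)
  show "valid (tree_of (fst s)) (sign_set s) (fst s)" using v BP by (simp add: T_def)
qed

context
  fixes T e V
  assumes T: "one_circle T" and V: "insert e V \<subseteq> lives T" and eV: "e \<notin> V"
begin

abbreviation (input) "joined_B \<equiv> sym_diff T V"
abbreviation (input) "split_B \<equiv> sym_diff T (insert e V)"

text \<open>Provides a single arc that represents the parent circle both before and after the
  split.\<close>

lemma parent_exists:
  obtains u where "u = b \<or> u \<in> far_end T ` V"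
    "circle_of D joined_B (al e) = circle_of D joined_B u"
    "circle_of D split_B (near_end T e) = circle_of D split_B u"
proof -
  have Vl: "V \<subseteq> lives T" and e: "e \<in> lives T" using V by auto
  have "circle_of D joined_B (near_end T e) \<in> circles D joined_B"
    using circle_of_in ends_in[OF T] lives_less e by blast
  then obtain u where u: "u = b \<or> u \<in> far_end T ` V"
    "circle_of D joined_B (near_end T e) = circle_of D joined_B u"
    unfolding block_circles[OF T Vl] by blast
  have "circle_of D joined_B (al e) = circle_of D joined_B (near_end T e)"
    using block_joined[OF T Vl e eV] ends_cases[OF T, of e] by (metis circle_of_eq_iff)
  moreover have "same split_B u (near_end T e)"
    using parent_stable[OF T V eV u(1)] u(2) by (metis circle_of_eq_iff)
  ultimately show ?thesis using that u by (metis circle_of_eq_iff)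
qed

lemma unchanged_in_both:
  assumes "v \<in> arcs D" "\<not> same joined_B v (al e)"
  shows "circle_of D split_B v = circle_of D joined_B v"
proof -
  have Vl: "V \<subseteq> lives T" and e: "e \<in> lives T" using V by auto
  show ?thesis by (rule split_unchanged[OF block_differ[OF T e eV] block_joined[OF T Vl e eV] assms(2)])
qed

lemma common_circle:
  assumes "w \<in> circles D joined_B" "w \<in> circles D split_B"
  obtains v where "v = b \<or> v \<in> far_end T ` V" "w = circle_of D joined_B v" "w = circle_of D split_B v"
proof -
  have Vl: "V \<subseteq> lives T" using V by auto
  obtain v where v: "v = b \<or> v \<in> far_end T ` V" "w = circle_of D joined_B v"
    using assms(1) unfolding block_circles[OF T Vl] by blast
  obtain x where "w = circle_of D split_B x" using assms(2) by (rule circle_cases)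
  moreover have "v \<in> w" using v circle_self by blast
  ultimately have "w = circle_of D split_B v" by (metis circle_of_eq_iff in_circle_of)
  then show ?thesis using that v by blast
qed

end

lemma sign_mem:
  assumes v: "valid T Q B" and W: "V \<subseteq> sym_diff B T" and u: "u = b \<or> u \<in> far_end T ` V"
  shows "circle_of D B u \<in> snd (make_state T Q B) \<longleftrightarrow> u = b \<or> (\<exists>g\<in>V. u = far_end T g \<and> g \<in> Q)"
proof (cases "u = b")
  case True
  then show ?thesis using make_state_base by simp
next
  case False
  then obtain g where g: "g \<in> V" "u = far_end T g" using u by blast
  have "g' = g" if "g' \<in> V" "u = far_end T g'" for g'
  proof -
    have "same (sym_diff T (sym_diff B T)) (far_end T g') (far_end T g)" using that g same_refl by metis
    then show ?thesis using far_ends_differ[OF valid_block(1)[OF v] valid_block(2)[OF v]] that g W by blast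
  qed
  then show ?thesis using make_state_mem[OF v, of g] g W False by blast
qed

text \<open>With the parent's sign \<open>p\<close>, the local rule is the term of the split that
  gives \<open>+\<close> to the far circle and \<open>p\<close> to the near one, or the merge of
  \<open>-\<close> with \<open>p\<close> into \<open>p\<close>. All other circles are common to both
  states.\<close>

lemma step_same_signs:
  assumes v: "valid T Q B" and e: "e \<in> free T Q" "e \<notin> B"
  shows "valid T Q (insert e B)" "state_step D e (make_state T Q B) (make_state T Q (insert e B))"
proof -
  let ?B' = "insert e B"
  note T = valid_block(1)[OF v] and W = valid_block(2)[OF v]
  have el: "e \<in> lives T" and eQ: "e \<in> Q \<longleftrightarrow> e \<notin> T" using e by (auto simp: free_def)
  show v': "valid T Q ?B'" using v e unfolding valid_def free_def by auto
  define V where "V = sym_diff B T - {e}"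
  have eV: "e \<notin> V" by (simp add: V_def)
  have V: "insert e V \<subseteq> lives T" using W el unfolding V_def by blast
  have VB: "V \<subseteq> sym_diff B T" "V \<subseteq> sym_diff ?B' T" unfolding V_def by auto
  have en: "e < length D" using el by (rule lives_less)
  obtain u where u: "u = b \<or> u \<in> far_end T ` V"
    "circle_of D (sym_diff T V) (al e) = circle_of D (sym_diff T V) u"
    "circle_of D (sym_diff T (insert e V)) (near_end T e) = circle_of D (sym_diff T (insert e V)) u"
    by (rule parent_exists[OF T V eV])
  define p where "p \<longleftrightarrow> u = b \<or> (\<exists>g\<in>V. u = far_end T g \<and> g \<in> Q)"
  have pB: "circle_of D B u \<in> snd (make_state T Q B) \<longleftrightarrow> p"
    and pB': "circle_of D ?B' u \<in> snd (make_state T Q ?B') \<longleftrightarrow> p"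
    unfolding p_def using sign_mem[OF v VB(1) u(1)] sign_mem[OF v' VB(2) u(1)] by auto
  have common: "w \<in> snd (make_state T Q B) \<longleftrightarrow> w \<in> snd (make_state T Q ?B')"
    if w: "w \<in> circles D B" "w \<in> circles D ?B'" for w
  proof -
    have B: "{B, ?B'} = {sym_diff T V, sym_diff T (insert e V)}" using e(2) unfolding V_def by (cases "e \<in> T") auto
    then have "w \<in> circles D (sym_diff T V)" "w \<in> circles D (sym_diff T (insert e V))"
      using w unfolding doubleton_eq_iff by metis+
    then obtain x where x: "x = b \<or> x \<in> far_end T ` V" "w = circle_of D (sym_diff T V) x" "w = circle_of D (sym_diff T (insert e V)) x"
      by (rule common_circle[OF T V eV])
    then have "w = circle_of D B x" "w = circle_of D ?B' x" using B unfolding doubleton_eq_iff by metis+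
    then show ?thesis using sign_mem[OF v VB(1) x(1)] sign_mem[OF v' VB(2) x(1)] by metis
  qed
  have subs: "snd (make_state T Q B) \<subseteq> circles D B" "snd (make_state T Q ?B') \<subseteq> circles D ?B'"
    using make_state_reduced[OF v] make_state_reduced[OF v'] unfolding reduced_states_def enhanced_states_def
    by (auto simp: case_prod_beta)
  have ms: "make_state T Q B = (B, snd (make_state T Q B))" "make_state T Q ?B' = (?B', snd (make_state T Q ?B'))"
    by (simp_all add: make_state_def)
  show "state_step D e (make_state T Q B) (make_state T Q ?B')"
  proof (cases "e \<in> T")
    case False
    have B: "B = sym_diff T V" "?B' = sym_diff T (insert e V)" using False e unfolding V_def by auto
    have far: "circle_of D ?B' (far_end T e) \<in> snd (make_state T Q ?B')"
      using make_state_mem[OF v', of e] False eQ by auto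
    have s: "same B (al e) (be e)" using block_joined[OF T _ el eV] V B by simp
    have near: "circle_of D ?B' (near_end T e) \<in> snd (make_state T Q ?B') \<longleftrightarrow> p"
      using u(3) pB' B by metis
    have z: "circle_of D B (al e) \<in> snd (make_state T Q B) \<longleftrightarrow> p" using u(2) pB B by metis
    have "split_rule (snd (make_state T Q B)) (snd (make_state T Q ?B'))
        (circle_of D B (al e)) (circle_of D ?B' (al e)) (circle_of D ?B' (be e))"
      using ends_cases[OF T, of e] far near z unfolding split_rule_def by metis
    moreover have "snd (make_state T Q B) \<inter> circles D ?B' = snd (make_state T Q ?B') \<inter> circles D B"
      using common subs by blast
    ultimately show ?thesis using step_split_iff[OF en e(2) s] ms by metis
  next
    case True
    have B: "?B' = sym_diff T V" "B = sym_diff T (insert e V)" using True e unfolding V_def by auto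
    have far: "circle_of D B (far_end T e) \<notin> snd (make_state T Q B)"
      using make_state_mem[OF v, of e] True eQ e by auto
    have s: "\<not> same B (al e) (be e)" using block_split[OF T V insertI1] B by simp
    have near: "circle_of D B (near_end T e) \<in> snd (make_state T Q B) \<longleftrightarrow> p"
      using u(3) pB B by metis
    have z: "circle_of D ?B' (al e) \<in> snd (make_state T Q ?B') \<longleftrightarrow> p" using u(2) pB' B by metis
    have "merge_rule (snd (make_state T Q B)) (snd (make_state T Q ?B'))
        (circle_of D B (al e)) (circle_of D B (be e)) (circle_of D ?B' (al e))"
      using ends_cases[OF T, of e] far near z unfolding merge_rule_def by metis
    moreover have "snd (make_state T Q B) \<inter> circles D ?B' = snd (make_state T Q ?B') \<inter> circles D B"
      using common subs by blast
    ultimately show ?thesis using step_merge_iff[OF en e(2) s] ms by metis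
  qed
qed

text \<open>The other terms of the differential inside a block move one sign \<open>+\<close> to the parent circle.\<close>

lemma step_moves_sign:
  assumes v: "valid T Q B" and e: "e \<in> lives T" "e \<notin> B" and v': "valid T Q' (insert e B)"
    and step: "state_step D e (make_state T Q B) (make_state T Q' (insert e B))"
  shows "Q' = Q \<or> (\<exists>g. g \<in> lives T \<and> g \<notin> Q \<and> e \<in> Q \<and> Q' = insert g (Q - {e}) \<and> card (far T e) < card (far T g))"
proof -
  let ?B' = "insert e B"
  note T = valid_block(1)[OF v] and W = valid_block(2)[OF v]
  define V where "V = sym_diff B T - {e}"
  have eV: "e \<notin> V" by (simp add: V_def)
  have V: "insert e V \<subseteq> lives T" using W e unfolding V_def by blast
  have Vl: "V \<subseteq> lives T" using V by blast
  have VB: "V \<subseteq> sym_diff B T" "V \<subseteq> sym_diff ?B' T" unfolding V_def by auto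
  have en: "e < length D" using e(1) by (rule lives_less)
  obtain u where u: "u = b \<or> u \<in> far_end T ` V"
    "circle_of D (sym_diff T V) (al e) = circle_of D (sym_diff T V) u"
    "circle_of D (sym_diff T (insert e V)) (near_end T e) = circle_of D (sym_diff T (insert e V)) u"
    by (rule parent_exists[OF T V eV])
  define p p' where "p \<longleftrightarrow> u = b \<or> (\<exists>g\<in>V. u = far_end T g \<and> g \<in> Q)"
    and "p' \<longleftrightarrow> u = b \<or> (\<exists>g\<in>V. u = far_end T g \<and> g \<in> Q')"
  have pB: "circle_of D B u \<in> snd (make_state T Q B) \<longleftrightarrow> p"
    and pB': "circle_of D ?B' u \<in> snd (make_state T Q' ?B') \<longleftrightarrow> p'"
    unfolding p_def p'_def using sign_mem[OF v VB(1) u(1)] sign_mem[OF v' VB(2) u(1)] by auto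
  have ms: "make_state T Q B = (B, snd (make_state T Q B))" "make_state T Q' ?B' = (?B', snd (make_state T Q' ?B'))"
    by (simp_all add: make_state_def)
  have Bs: "e \<notin> T \<and> B = sym_diff T V \<and> ?B' = sym_diff T (insert e V)
    \<or> e \<in> T \<and> ?B' = sym_diff T V \<and> B = sym_diff T (insert e V)" using e unfolding V_def by auto
  \<comment> \<open>The step expressed by the signs of the far circle and of the parent before and
    after it. In the first alternative \<open>e\<close> splits off a circle, in the second it merges
    one into the parent.\<close>
  have rule: "snd (make_state T Q B) \<inter> circles D ?B' = snd (make_state T Q' ?B') \<inter> circles D B \<and>
    (e \<notin> T \<and> e \<in> Q \<and> (p \<and> e \<in> Q' \<and> p' \<or> \<not> p \<and> (e \<in> Q') \<noteq> p') \<or>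
     e \<in> T \<and> e \<notin> Q' \<and> (e \<notin> Q \<and> \<not> p \<and> \<not> p' \<or> (e \<in> Q) \<noteq> p \<and> p'))"
    using Bs
  proof (elim disjE conjE)
    assume eT: "e \<notin> T" and B: "B = sym_diff T V" "?B' = sym_diff T (insert e V)"
    have far: "circle_of D ?B' (far_end T e) \<in> snd (make_state T Q' ?B') \<longleftrightarrow> e \<in> Q'"
      using make_state_mem[OF v', of e] eT by auto
    \<comment> \<open>No circle is split off at \<open>e\<close> in \<open>B\<close>, so the sign at
      \<open>e\<close> is the virtual one.\<close>
    have eQ: "e \<in> Q" using v e eT unfolding valid_def free_def by auto
    have s: "same B (al e) (be e)" using block_joined[OF T Vl e(1) eV] B by simp
    have near: "circle_of D ?B' (near_end T e) \<in> snd (make_state T Q' ?B') \<longleftrightarrow> p'"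
      using u(3) pB' B by metis
    have z: "circle_of D B (al e) \<in> snd (make_state T Q B) \<longleftrightarrow> p" using u(2) pB B by metis
    have "snd (make_state T Q B) \<inter> circles D ?B' = snd (make_state T Q' ?B') \<inter> circles D B \<and>
      split_rule (snd (make_state T Q B)) (snd (make_state T Q' ?B'))
        (circle_of D B (al e)) (circle_of D ?B' (al e)) (circle_of D ?B' (be e))"
      using step step_split_iff[OF en e(2) s] ms by metis
    then show ?thesis using ends_cases[OF T, of e] far near z eT eQ unfolding split_rule_def by metis
  next
    assume eT: "e \<in> T" and B: "?B' = sym_diff T V" "B = sym_diff T (insert e V)"
    have far: "circle_of D B (far_end T e) \<in> snd (make_state T Q B) \<longleftrightarrow> e \<in> Q"
      using make_state_mem[OF v, of e] eT e by auto
    have eQ: "e \<notin> Q'" using v' e eT unfolding valid_def free_def by auto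
    have s: "\<not> same B (al e) (be e)" using block_split[OF T V insertI1] B by simp
    have near: "circle_of D B (near_end T e) \<in> snd (make_state T Q B) \<longleftrightarrow> p"
      using u(3) pB B by metis
    have z: "circle_of D ?B' (al e) \<in> snd (make_state T Q' ?B') \<longleftrightarrow> p'" using u(2) pB' B by metis
    have "snd (make_state T Q B) \<inter> circles D ?B' = snd (make_state T Q' ?B') \<inter> circles D B \<and>
      merge_rule (snd (make_state T Q B)) (snd (make_state T Q' ?B'))
        (circle_of D B (al e)) (circle_of D B (be e)) (circle_of D ?B' (al e))"
      using step step_merge_iff[OF en e(2) s] ms by metis
    then show ?thesis using ends_cases[OF T, of e] far near z eT eQ unfolding merge_rule_def by metis
  qed
  \<comment> \<open>A circle other than that of \<open>e\<close> and its parent is untouched by the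
    saddle; a crossing without a split-off circle has its virtual sign in both states.\<close>
  have others: "g \<in> Q \<longleftrightarrow> g \<in> Q'" if g: "g \<noteq> e" "far_end T g \<noteq> u \<or> g \<notin> V" for g
  proof (cases "g \<in> V")
    case True
    have gl: "g \<in> lives T" using True Vl by blast
    have "\<not> same (sym_diff T V) (far_end T g) (al e)"
    proof
      assume "same (sym_diff T V) (far_end T g) (al e)"
      then have "same (sym_diff T V) (far_end T g) u" using u(2) by (metis circle_of_eq_iff)
      then show False using u(1) far_end_not_base[OF T Vl True] far_ends_differ[OF T Vl True] g True by blast
    qed
    then have eq: "circle_of D (sym_diff T (insert e V)) (far_end T g) = circle_of D (sym_diff T V) (far_end T g)"
      by (intro unchanged_in_both[OF T V eV]) (use ends_in[OF T] lives_less gl in blast)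
    then have eq: "circle_of D B (far_end T g) = circle_of D ?B' (far_end T g)" using Bs by auto
    have "far_end T g \<in> arcs D" using ends_in[OF T] lives_less gl by blast
    then have "circle_of D B (far_end T g) \<in> circles D B" "circle_of D B (far_end T g) \<in> circles D ?B'"
      using circle_of_in eq by metis+
    then have "circle_of D B (far_end T g) \<in> snd (make_state T Q B) \<longleftrightarrow> circle_of D ?B' (far_end T g) \<in> snd (make_state T Q' ?B')"
      using rule eq by auto
    then show ?thesis using make_state_mem[OF v, of g] make_state_mem[OF v', of g] True VB by blast
  next
    case False
    then have "g \<notin> sym_diff B T" "g \<notin> sym_diff ?B' T" using g unfolding V_def by auto
    then show ?thesis using v v' unfolding valid_def free_def by auto
  qed
  show ?thesis
  proof (cases "u \<in> far_end T ` V")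
    case False
    then have p: "p" "p'" using u(1) by (auto simp: p_def p'_def)
    then have "e \<in> Q \<longleftrightarrow> e \<in> Q'" using rule by blast
    moreover have "g \<in> Q \<longleftrightarrow> g \<in> Q'" if "g \<noteq> e" for g using others[of g] that False by blast
    ultimately have "g \<in> Q' \<longleftrightarrow> g \<in> Q" for g by (cases "g = e") auto
    then have "Q' = Q" by blast
    then show ?thesis by blast
  next
    case True
    then obtain g where g: "g \<in> V" "u = far_end T g" by blast
    have uniq: "g' = g" if "g' \<in> V" "far_end T g' = u" for g'
      using far_ends_differ[OF T Vl that(1) g(1)] that g same_refl by metis
    have ub: "u \<noteq> b" using far_end_not_base[OF T Vl g(1)] g same_refl by metis
    have "(\<exists>h\<in>V. u = far_end T h \<and> h \<in> X) \<longleftrightarrow> g \<in> X" for X using g uniq by metis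
    then have p: "p \<longleftrightarrow> g \<in> Q" "p' \<longleftrightarrow> g \<in> Q'" using ub unfolding p_def p'_def by simp_all
    have "same (sym_diff T V) (near_end T e) (far_end T g)"
      using u(2) g block_joined[OF T Vl e(1) eV] ends_cases[OF T, of e] by (metis circle_of_eq_iff)
    then have lt: "card (far T e) < card (far T g)"
      using parent_far[OF T Vl e(1) g(1)] g eV by blast
    have oth: "h \<in> Q \<longleftrightarrow> h \<in> Q'" if "h \<noteq> e" "h \<noteq> g" for h using others[of h] uniq that by blast
    have "g \<noteq> e" using g eV by blast
    show ?thesis
    proof (cases "(e \<in> Q \<longleftrightarrow> e \<in> Q') \<and> (g \<in> Q \<longleftrightarrow> g \<in> Q')")
      case True
      then have "h \<in> Q' \<longleftrightarrow> h \<in> Q" for h using oth[of h] by (cases "h = e"; cases "h = g") auto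
      then have "Q' = Q" by blast
      then show ?thesis by blast
    next
      case False
      \<comment> \<open>Of the alternatives in \<open>rule\<close> that change a sign, only the loss
        of \<open>+\<close> at \<open>e\<close> and its gain at the parent remains.\<close>
      then have "e \<in> Q" "g \<notin> Q" "e \<notin> Q'" "g \<in> Q'" using rule p by blast+
      moreover from this have "h \<in> Q' \<longleftrightarrow> h \<in> insert g (Q - {e})" for h
        using oth[of h] by (cases "h = e"; cases "h = g") auto
      then have "Q' = insert g (Q - {e})" by blast
      ultimately show ?thesis using lt g Vl by blast
    qed
  qed
qed

text \<open>The matching of the reduced states flips the lowest crossing at which the sign does not force
  a circle to be split off.\<close>

definition pivot :: "enhanced_state \<Rightarrow> nat" where
  "pivot s = Min (free (tree_of (fst s)) (sign_set s))"

definition critical :: "enhanced_state set" where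
  "critical = {s \<in> reduced_states D b. free (tree_of (fst s)) (sign_set s) = {}}"

definition sources :: "enhanced_state set" where
  "sources = {s \<in> reduced_states D b. free (tree_of (fst s)) (sign_set s) \<noteq> {} \<and> pivot s \<notin> fst s}"

definition targets :: "enhanced_state set" where
  "targets = {s \<in> reduced_states D b. free (tree_of (fst s)) (sign_set s) \<noteq> {} \<and> pivot s \<in> fst s}"

definition mate :: "enhanced_state \<Rightarrow> enhanced_state" where
  "mate s = make_state (tree_of (fst s)) (sign_set s) (insert (pivot s) (fst s))"

text \<open>Moving a sign \<open>+\<close> from a circle to its parent increases this sum, by
  \<open>parent_far\<close>.\<close>

definition weight :: "nat set \<Rightarrow> nat set \<Rightarrow> nat" where
  "weight T Q = (\<Sum>e\<in>Q. card (far T e))"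

text \<open>The factor exceeds every weight, by \<open>weight_bound\<close>. So ranks compare the
  trees first and the weights only within a block.\<close>

definition rank :: "enhanced_state \<Rightarrow> nat" where
  "rank s = (\<Sum>i\<in>tree_of (fst s). 2 ^ i) * Suc (length D * card (arcs D)) + weight (tree_of (fst s)) (sign_set s)"

lemma reduced_partition:
  "reduced_states D b = sources \<union> targets \<union> critical"
  "sources \<inter> targets = {}" "sources \<inter> critical = {}" "targets \<inter> critical = {}"
  by (auto simp: sources_def targets_def critical_def)

lemma pivot_free:
  assumes "free (tree_of (fst s)) (sign_set s) \<noteq> {}"
  shows "pivot s \<in> free (tree_of (fst s)) (sign_set s)"
proof -
  have "finite (free (tree_of (fst s)) (sign_set s))"
    by (rule finite_subset[OF _ finite_lives]) (auto simp: free_def)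
  then show ?thesis unfolding pivot_def using assms by (rule Min_in)
qed

lemma make_state_data:
  assumes "valid T Q B"
  shows "fst (make_state T Q B) = B" "tree_of (fst (make_state T Q B)) = T" "sign_set (make_state T Q B) = Q"
    "pivot (make_state T Q B) = Min (free T Q)"
  using make_state_reduced[OF assms] valid_block[OF assms] by (simp_all add: pivot_def)

lemma source_mate:
  assumes s: "s \<in> sources"
  shows "mate s \<in> targets" "state_step D (pivot s) s (mate s)"
    "fst (mate s) = insert (pivot s) (fst s)" "tree_of (fst (mate s)) = tree_of (fst s)"
    "sign_set (mate s) = sign_set s" "pivot (mate s) = pivot s"
proof -
  have r: "s \<in> reduced_states D b" and f: "free (tree_of (fst s)) (sign_set s) \<noteq> {}" and p: "pivot s \<notin> fst s"
    using s by (auto simp: sources_def)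
  note v = reduced_state_valid(1)[OF r] and eq = reduced_state_valid(2)[OF r]
  note v' = step_same_signs(1)[OF v pivot_free[OF f] p]
  note d = make_state_data[OF v', folded mate_def]
  show "state_step D (pivot s) s (mate s)"
    using step_same_signs(2)[OF v pivot_free[OF f] p] eq unfolding mate_def by metis
  show 1: "fst (mate s) = insert (pivot s) (fst s)" "tree_of (fst (mate s)) = tree_of (fst s)"
    "sign_set (mate s) = sign_set s" using d by auto
  show 2: "pivot (mate s) = pivot s" using d(4) by (simp add: pivot_def)
  have "mate s \<in> reduced_states D b" unfolding mate_def by (rule make_state_reduced(1)[OF v'])
  then show "mate s \<in> targets" using f 1 2 by (simp add: targets_def)
qed

lemma target_unmate:
  assumes s: "s \<in> targets"
  shows "\<exists>s'\<in>sources. mate s' = s"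
proof -
  have r: "s \<in> reduced_states D b" and f: "free (tree_of (fst s)) (sign_set s) \<noteq> {}" and p: "pivot s \<in> fst s"
    using s by (auto simp: targets_def)
  note v = reduced_state_valid(1)[OF r] and eq = reduced_state_valid(2)[OF r]
  have v': "valid (tree_of (fst s)) (sign_set s) (fst s - {pivot s})"
    using v pivot_free[OF f] unfolding valid_def free_def by auto
  define s' where "s' = make_state (tree_of (fst s)) (sign_set s) (fst s - {pivot s})"
  note d = make_state_data[OF v', folded s'_def]
  have ps: "pivot s' = pivot s" using d(4) by (simp add: pivot_def)
  have "s' \<in> sources" using make_state_reduced(1)[OF v', folded s'_def] f d ps by (simp add: sources_def)
  moreover have "mate s' = s" using eq d ps p unfolding mate_def by (simp add: insert_absorb)
  ultimately show ?thesis by blast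
qed

lemma source_determined:
  assumes "s \<in> sources" "s' \<in> sources" "fst (mate s) = fst (mate s')" "sign_set s = sign_set s'"
  shows "s = s'"
proof -
  note m = source_mate[OF assms(1)] and m' = source_mate[OF assms(2)]
  have T: "tree_of (fst s) = tree_of (fst s')" using m(4) m'(4) assms(3) by simp
  have p: "pivot s = pivot s'" using T assms(4) by (simp add: pivot_def)
  have "pivot s \<notin> fst s" "pivot s' \<notin> fst s'" using assms by (auto simp: sources_def)
  then have "fst s = fst s'" using m(3) m'(3) assms(3) p insert_ident by metis
  then show ?thesis
    using reduced_state_valid(2)[of s] reduced_state_valid(2)[of s'] assms T by (simp add: sources_def)
qed

lemma weight_bound:
  assumes "Q \<subseteq> lives T"
  shows "weight T Q \<le> length D * card (arcs D)"
proof -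
  have "card Q \<le> card {..<length D}"
    by (rule card_mono) (use assms lives_less in auto)
  moreover have "card (far T e) \<le> card (arcs D)" for e
    by (rule card_mono[OF finite_arcs]) (auto simp: far_def)
  then have "weight T Q \<le> card Q * card (arcs D)"
    unfolding weight_def using sum_bounded_above[of Q "\<lambda>e. card (far T e)" "card (arcs D)"] by simp
  ultimately show ?thesis by (metis card_lessThan le_trans mult_le_mono1)
qed

lemma mate_rank:
  assumes s: "s \<in> sources" and s': "s' \<in> sources" "s \<noteq> s'" and step: "state_step D c s (mate s')"
  shows "rank s < rank s'"
proof -
  define B T Q where "B = fst s" and "T = tree_of B" and "Q = sign_set s"
  define T' Q' where "T' = tree_of (fst s')" and "Q' = sign_set s'"
  have r: "s \<in> reduced_states D b" "s' \<in> reduced_states D b" using s s' by (auto simp: sources_def)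
  note v = reduced_state_valid(1)[OF r(1), folded B_def, folded T_def Q_def]
    and eq = reduced_state_valid(2)[OF r(1), folded B_def, folded T_def Q_def]
  note m = source_mate[OF s'(1)]
  have c: "c < length D" "c \<notin> B" "fst (mate s') = insert c B"
    using step unfolding state_step_def B_def by (auto split: prod.splits)
  have T': "tree_of (insert c B) = T'" using m(4) c(3) by (simp add: T'_def)
  have "mate s' \<in> reduced_states D b" using m(1) by (simp add: targets_def)
  note v' = reduced_state_valid(1)[OF this, unfolded m(5) c(3) T', folded Q'_def]
    and eq' = reduced_state_valid(2)[OF this, unfolded m(5) c(3) T', folded Q'_def]
  have B: "B \<subseteq> {..<length D}" by (rule valid_block(4)[OF v])
  have w: "weight T Q \<le> length D * card (arcs D)" using weight_bound v by (simp add: valid_def)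
  show ?thesis
  proof (cases "T = T'")
    case False
    then have "(\<Sum>i\<in>T. 2 ^ i) < (\<Sum>i\<in>T'. 2 ^ i :: nat)"
      using tree_of_mono[OF B c(1,2)] T' by (simp add: T_def)
    then have "Suc (\<Sum>i\<in>T. 2 ^ i) * Suc (length D * card (arcs D)) \<le> (\<Sum>i\<in>T'. 2 ^ i :: nat) * Suc (length D * card (arcs D))"
      by (intro mult_le_mono1) simp
    then show ?thesis using w unfolding rank_def B_def[symmetric] T_def[symmetric] Q_def[symmetric] T'_def[symmetric]
      by simp
  next
    case True
    have "c \<in> lives T" using valid_block(2)[OF v] valid_block(2)[OF v'] c(2) True by auto
    then have "Q' = Q \<or> (\<exists>g. g \<in> lives T \<and> g \<notin> Q \<and> c \<in> Q \<and> Q' = insert g (Q - {c}) \<and> card (far T c) < card (far T g))"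
      using step_moves_sign[OF v _ c(2)] v' eq eq' step True by metis
    then have "weight T Q < weight T' Q'"
    proof
      assume Q: "Q' = Q"
      have "free T Q \<noteq> {}" using s by (simp add: sources_def T_def Q_def B_def)
      \<comment> \<open>With equal trees and signs the pivots agree. The pivot is missing in
        \<open>B\<close> and present after the step, hence it is \<open>c\<close>, and the two
        sources coincide.\<close>
      have p: "pivot s = pivot s'" using True Q by (simp add: pivot_def T_def T'_def Q_def Q'_def B_def)
      have "pivot s \<notin> B" using s by (simp add: sources_def B_def)
      moreover have "pivot s \<in> insert c B" using m(3) c(3) p by auto
      ultimately have "pivot s = c" by auto
      then have "fst (mate s) = fst (mate s')" using source_mate(3)[OF s] c(3) by (simp add: B_def)
      then have "s = s'" using source_determined[OF s s'(1)] Q by (simp add: Q_def Q'_def)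
      then show ?thesis using s' by blast
    next
      assume "\<exists>g. g \<in> lives T \<and> g \<notin> Q \<and> c \<in> Q \<and> Q' = insert g (Q - {c}) \<and> card (far T c) < card (far T g)"
      then obtain g where g: "g \<notin> Q" "c \<in> Q" "Q' = insert g (Q - {c})" "card (far T c) < card (far T g)" by blast
      have fin: "finite Q" using v finite_lives finite_subset unfolding valid_def by blast
      have "weight T Q = card (far T c) + weight T (Q - {c})"
        unfolding weight_def using fin g(2) by (rule sum.remove)
      moreover have "weight T Q' = card (far T g) + weight T (Q - {c})"
        unfolding weight_def g(3) using fin g(1) by (intro sum.insert) auto
      ultimately show ?thesis using g(4) True by simp
    qed
    then show ?thesis unfolding rank_def B_def[symmetric] T_def[symmetric] Q_def[symmetric] T'_def[symmetric] Q'_def[symmetric]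
      using True by simp
  qed
qed

text \<open>The only state of the block without free crossings: every live crossing is switched, and
  each split-off circle has the sign opposite to the virtual one.\<close>

definition tree_state :: "nat set \<Rightarrow> enhanced_state" where
  "tree_state T = make_state T (lives T \<inter> T) (sym_diff T (lives T))"

lemma tree_state_valid:
  "one_circle T \<Longrightarrow> valid T (lives T \<inter> T) (sym_diff T (lives T))"
  unfolding valid_def free_def by auto

lemma tree_state_bij: "bij_betw tree_state {T. one_circle T} critical"
proof (rule bij_betw_imageI)
  show "inj_on tree_state {T. one_circle T}"
  proof (rule inj_onI)
    fix T T' assume "T \<in> {T. one_circle T}" "T' \<in> {T. one_circle T}" "tree_state T = tree_state T'"
    then show "T = T'" using make_state_data(2)[OF tree_state_valid] unfolding tree_state_def by (metis mem_Collect_eq)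
  qed
  show "tree_state ` {T. one_circle T} = critical"
  proof
    show "tree_state ` {T. one_circle T} \<subseteq> critical"
    proof
      fix s assume "s \<in> tree_state ` {T. one_circle T}"
      then obtain T where T: "one_circle T" "s = tree_state T" by blast
      note v = tree_state_valid[OF T(1)]
      have "free T (lives T \<inter> T) = {}" by (auto simp: free_def)
      then show "s \<in> critical"
        using make_state_data[OF v] make_state_reduced(1)[OF v] T unfolding critical_def tree_state_def by simp
    qed
    show "critical \<subseteq> tree_state ` {T. one_circle T}"
    proof
      fix s assume s: "s \<in> critical"
      define B T Q where "B = fst s" and "T = tree_of B" and "Q = sign_set s"
      have r: "s \<in> reduced_states D b" and f: "free T Q = {}" using s by (auto simp: critical_def B_def T_def Q_def)
      note v = reduced_state_valid(1)[OF r, folded B_def, folded T_def Q_def]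
        and eq = reduced_state_valid(2)[OF r, folded B_def, folded T_def Q_def]
      have "Q = lives T \<inter> T" using v f unfolding valid_def free_def by auto
      moreover have "sym_diff B T = lives T" using v f unfolding valid_def by auto
      then have "B = sym_diff T (lives T)" by auto
      ultimately have "s = tree_state T" using eq by (simp add: tree_state_def)
      then show "s \<in> tree_state ` {T. one_circle T}" using valid_block(1)[OF v] by blast
    qed
  qed
qed

lemma tree_state_counts:
  assumes T: "one_circle T"
  shows "fst (tree_state T) = sym_diff T (lives T)"
    "card (circles D (fst (tree_state T))) = Suc (card (lives T))"
    "card (snd (tree_state T)) = Suc (card (lives T \<inter> T))"
proof -
  let ?B = "sym_diff T (lives T)"
  show 1: "fst (tree_state T) = ?B" by (simp add: tree_state_def make_state_def)
  then show "card (circles D (fst (tree_state T))) = Suc (card (lives T))"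
    using card_block_circles[OF T subset_refl] by simp
  have L: "sym_diff ?B T = lives T" by auto
  have "inj_on (\<lambda>e. circle_of D ?B (far_end T e)) (lives T \<inter> T)"
    using far_ends_differ[OF T subset_refl] by (auto simp: inj_on_def circle_of_eq_iff)
  moreover have "circle_of D ?B b \<noteq> circle_of D ?B (far_end T e)" if "e \<in> lives T" for e
    using far_end_not_base[OF T subset_refl that] by (metis circle_of_eq_iff)
  then have "circle_of D ?B b \<notin> (\<lambda>e. circle_of D ?B (far_end T e)) ` (lives T \<inter> T)" by blast
  moreover have "finite (lives T \<inter> T)" using finite_lives by blast
  moreover have "snd (tree_state T) = insert (circle_of D ?B b) ((\<lambda>e. circle_of D ?B (far_end T e)) ` (lives T \<inter> T))"
    unfolding tree_state_def make_state_def L by simp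
  ultimately show "card (snd (tree_state T)) = Suc (card (lives T \<inter> T))" by (simp add: card_image)
qed

end

section \<open>The square of the differential\<close>

lemma antisymmetric_sum_zero:
  fixes G :: "'a \<Rightarrow> 'a \<Rightarrow> ('b \<Rightarrow>\<^sub>0 int)"
  assumes "\<And>x y. x \<in> A \<Longrightarrow> y \<in> A \<Longrightarrow> G x y = - G y x"
  shows "(\<Sum>x\<in>A. \<Sum>y\<in>A. G x y) = 0"
proof -
  define S where "S = (\<Sum>x\<in>A. \<Sum>y\<in>A. G x y)"
  have "S = (\<Sum>x\<in>A. \<Sum>y\<in>A. - G y x)"
    unfolding S_def by (intro sum.cong refl assms)
  also have "\<dots> = - (\<Sum>x\<in>A. \<Sum>y\<in>A. G y x)" by (simp add: sum_negf)
  also have "(\<Sum>x\<in>A. \<Sum>y\<in>A. G y x) = S" unfolding S_def by (rule sum.swap)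
  finally have eq: "S = - S" .
  \<comment> \<open>The coefficients are integers, so \<open>S\<close> vanishes once its double
    does.\<close>
  have "S + S = 0" using eq by (metis add.right_inverse)
  then have "Poly_Mapping.lookup (S + S) k = 0" for k by simp
  then have "Poly_Mapping.lookup S k = 0" for k by (simp add: lookup_add)
  then have "S = 0" by (intro poly_mapping_eqI) simp
  then show ?thesis by (simp add: S_def)
qed

definition edge_map :: "gauss_code \<Rightarrow> nat \<Rightarrow> enhanced_state \<Rightarrow> (enhanced_state \<Rightarrow>\<^sub>0 int)" where
  "edge_map D c s = (\<Sum>s' | s' \<in> enhanced_states D \<and> state_step D c s s'. frag_of s')"

definition edge_sign :: "nat set \<Rightarrow> nat \<Rightarrow> int" where
  "edge_sign B c = (- 1) ^ card {x \<in> B. x < c}"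

context colored_diagram
begin

lemma finite_enhanced: "finite (enhanced_states D)"
proof -
  have "enhanced_states D \<subseteq> Pow {..<length D} \<times> Pow (Pow (arcs D))"
    using same_in_arcs by (fastforce simp: enhanced_states_def circles_eq in_circle_of)
  then show ?thesis using finite_arcs finite_subset by blast
qed

lemma khovanov_d_edges:
  "khovanov_d D x = frag_extend (\<lambda>s. \<Sum>c<length D. frag_cmul (edge_sign (fst s) c) (edge_map D c s)) x"
proof -
  have "(\<Sum>(c, s') \<in> {(c, s'). s' \<in> enhanced_states D \<and> state_step D c s s'}.
       frag_cmul ((- 1) ^ card {b \<in> fst s. b < c}) (frag_of s')) =
     (\<Sum>c<length D. frag_cmul (edge_sign (fst s) c) (edge_map D c s))" for s
  proof -
    have "state_step D c s s' \<Longrightarrow> c < length D" for c s'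
      by (simp add: state_step_def case_prod_beta)
    then have "{(c, s'). s' \<in> enhanced_states D \<and> state_step D c s s'} =
      Sigma {..<length D} (\<lambda>c. {s' \<in> enhanced_states D. state_step D c s s'})"
      by blast
    then show ?thesis
      using finite_enhanced by (simp add: sum.Sigma[symmetric] edge_map_def edge_sign_def frag_cmul_sum)
  qed
  then show ?thesis unfolding khovanov_d_def by simp
qed

section \<open>The differential on products of arcs\<close>

lemma circles_ext:
  assumes "P \<subseteq> circles D B'" "P' \<subseteq> circles D B'" "P \<inter> circles D B = P' \<inter> circles D B"
    "\<And>z. z \<in> circles D B' - circles D B \<Longrightarrow> z \<in> P \<longleftrightarrow> z \<in> P'"
  shows "P = P'"
  using assms by blast

lemma common_mem:
  assumes "w \<in> circles D B" "w \<in> circles D B'"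
  shows "w \<in> circle_of D B ` X \<longleftrightarrow> w \<in> circle_of D B' ` X"
proof -
  have "circle_of D B x = w \<longleftrightarrow> x \<in> w" if "w \<in> circles D B" for x B
    using that by (metis circle_cases circle_of_eq_iff circle_self in_circle_of)
  then show ?thesis using assms by (metis (no_types, lifting) image_iff)
qed

text \<open>In terms of the algebra of the states of \<open>B\<close>, generated by the arcs with square zero: the
  product of the arcs in a list.\<close>

definition monomial :: "nat set \<Rightarrow> nat list \<Rightarrow> (enhanced_state \<Rightarrow>\<^sub>0 int)" where
  "monomial B as = (if distinct (map (circle_of D B) as) then frag_of (B, circle_of D B ` set as) else 0)"

lemma monomial_zero: "x \<in> set as \<Longrightarrow> same B y x \<Longrightarrow> monomial B (y # as) = 0"
  unfolding monomial_def by (simp add: circle_of_eq_iff[symmetric])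

lemma monomial_zero2:
  assumes "monomial B as = 0" "\<And>x y. same B x y \<Longrightarrow> same B' x y"
  shows "monomial B' as = 0"
proof -
  have "\<not> distinct (map (circle_of D B) as)" using assms(1) by (auto simp: monomial_def split: if_splits)
  then have "\<not> distinct (map (circle_of D B') as)"
    using assms(2) by (auto simp: distinct_map inj_on_def circle_of_eq_iff)
  then show ?thesis by (simp add: monomial_def)
qed

lemma monomial_zero_cons: "monomial B as = 0 \<Longrightarrow> monomial B (x # as) = 0"
  by (auto simp: monomial_def split: if_splits)

lemma monomial_swap: "monomial B (x # y # as) = monomial B (y # x # as)"
  by (auto simp: monomial_def insert_commute)

lemma monomial_cong: "same B x y \<Longrightarrow> monomial B (x # as) = monomial B (y # as)"
  by (simp add: monomial_def circle_of_eq_iff[symmetric])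

text \<open>A split is multiplication by \<open>al c + be c\<close>. If no arc of the product is on
  the split circle, this gives the two terms of the rule for \<open>-\<close>; otherwise one of the
  summands squares an arc and dies, and the other gives both new circles the sign
  \<open>+\<close>.\<close>

lemma edge_map_split:
  assumes c: "c < length D" "c \<notin> B" and B: "B \<subseteq> {..<length D}" and s: "same B (al c) (be c)"
    and as: "set as \<subseteq> arcs D"
  shows "frag_extend (edge_map D c) (monomial B as) =
    monomial (insert c B) (al c # as) + monomial (insert c B) (be c # as)"
proof -
  let ?B' = "insert c B" and ?C = "circle_of D B" and ?C' = "circle_of D (insert c B)"
  have d: "differ_at c B ?B'" using c by (auto simp: differ_at_def)
  note sc = split_circles[OF d s]
  have ns: "\<not> same ?B' (al c) (be c)" using sc(3) by (simp add: circle_of_eq_iff)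
  have arcs: "al c \<in> arcs D" "be c \<in> arcs D" using al_be_in c by auto
  show ?thesis
  proof (cases "distinct (map ?C as)")
    case False
    have m0: "monomial B as = 0" using False by (simp add: monomial_def)
    \<comment> \<open>Two arcs of the product share a circle of \<open>B\<close>. Either they still
      do in \<open>B'\<close>, or they lie on the two new circles, so that multiplying by
      \<open>al c\<close> or by \<open>be c\<close> repeats a circle.\<close>
    have "monomial ?B' (al c # as) = 0 \<and> monomial ?B' (be c # as) = 0"
    proof (cases "monomial ?B' as = 0")
      case True then show ?thesis using monomial_zero_cons by blast
    next
      case f: False
      then have dis: "distinct (map ?C' as)" by (auto simp: monomial_def split: if_splits)
      then have "distinct as" by (simp add: distinct_map)
      then have "\<not> inj_on ?C (set as)" using False by (simp add: distinct_map)
      then obtain x y where xy: "x \<in> set as" "y \<in> set as" "x \<noteq> y" "same B x y"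
        by (auto simp: inj_on_def circle_of_eq_iff)
      have "\<not> same ?B' x y" using dis xy by (auto simp: distinct_map inj_on_def circle_of_eq_iff)
      then have "same ?B' x (al c) \<and> same ?B' y (be c) \<or> same ?B' x (be c) \<and> same ?B' y (al c)"
        using saddle_join[OF differ_at_sym[OF d] xy(4)] by blast
      then show ?thesis using xy monomial_zero same_sym by blast
    qed
    then show ?thesis using m0 by simp
  next
    case True
    define P where "P = ?C ` set as"
    have PC: "P \<subseteq> circles D B" using as circle_of_in by (auto simp: P_def)
    have img: "?C' ` X \<subseteq> circles D ?B'" if "X \<subseteq> arcs D" for X using that circle_of_in by auto
    have ext: "(B'', P') \<in> enhanced_states D \<and> state_step D c (B, P) (B'', P') \<longleftrightarrow>
        B'' = ?B' \<and> P' \<subseteq> circles D ?B' \<and> P \<inter> circles D ?B' = P' \<inter> circles D B \<and>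
        split_rule P P' (?C (al c)) (?C' (al c)) (?C' (be c))" for B'' P'
    proof -
      have "state_step D c (B, P) (B'', P') \<Longrightarrow> B'' = ?B'" by (simp add: state_step_def)
      then show ?thesis using step_split_iff[OF c s, of P P'] B c by (auto simp: enhanced_states_def)
    qed
    have mem: "?C' ` X \<in> {P'. P' \<subseteq> circles D ?B' \<and> P \<inter> circles D ?B' = P' \<inter> circles D B}"
      if X: "set as \<subseteq> X" "X \<subseteq> insert (al c) (insert (be c) (set as))" for X
    proof -
      have "w \<in> P \<longleftrightarrow> w \<in> ?C' ` X" if w: "w \<in> circles D B" "w \<in> circles D ?B'" for w
      proof -
        have "?C' x \<noteq> w" if "x = al c \<or> x = be c" for x using that w sc(2) by blast
        then have "w \<in> ?C' ` X \<longleftrightarrow> w \<in> ?C' ` set as" using X by blast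
        then show ?thesis using common_mem[OF w] by (simp add: P_def)
      qed
      moreover have "X \<subseteq> arcs D" using X as arcs by blast
      ultimately show ?thesis using PC img[of X] by blast
    qed
    show ?thesis
    proof (cases "?C (al c) \<in> P")
      case z: False
      have un: "\<not> same B x (al c)" if "x \<in> set as" for x
        using z that unfolding P_def by (metis circle_of_eq_iff imageI)
      then have eqC: "?C' x = ?C x" if "x \<in> set as" for x using split_unchanged[OF d s] that by blast
      have nin: "?C' (al c) \<notin> ?C' ` set as" "?C' (be c) \<notin> ?C' ` set as"
      proof -
        have "\<not> same ?B' u x" if "x \<in> set as" "u = al c \<or> u = be c" for u x
          using un[OF that(1)] split_finer[OF d s, of u x] s same_trans same_sym that(2) by blast
        then show "?C' (al c) \<notin> ?C' ` set as" "?C' (be c) \<notin> ?C' ` set as"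
          unfolding image_iff circle_of_eq_iff by blast+
      qed
      have ab: "?C' (al c) \<noteq> ?C' (be c)" by (rule sc(3))
      have set_eq: "{s' \<in> enhanced_states D. state_step D c (B, P) s'} =
          {(?B', ?C' ` insert (al c) (set as)), (?B', ?C' ` insert (be c) (set as))}"
      proof (rule Set.set_eqI)
        fix s' :: enhanced_state obtain B'' P' where s': "s' = (B'', P')" by (cases s')
        have "P' \<subseteq> circles D ?B' \<and> P \<inter> circles D ?B' = P' \<inter> circles D B \<and> (?C' (al c) \<in> P') \<noteq> (?C' (be c) \<in> P') \<longleftrightarrow>
          P' = ?C' ` insert (al c) (set as) \<or> P' = ?C' ` insert (be c) (set as)" (is "?L \<longleftrightarrow> ?R")
        proof
          assume L: ?L
          have "P' = ?C' ` insert u (set as)" if "u = al c \<or> u = be c" "?C' u \<in> P'" for u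
          proof (rule circles_ext[of _ ?B' _ B])
            show "P' \<inter> circles D B = ?C' ` insert u (set as) \<inter> circles D B"
              using L mem[of "insert u (set as)"] that by auto
            show "?C' ` insert u (set as) \<subseteq> circles D ?B'" using mem[of "insert u (set as)"] that by auto
            show "z \<in> P' \<longleftrightarrow> z \<in> ?C' ` insert u (set as)" if "z \<in> circles D ?B' - circles D B" for z
            proof -
              have zc: "z = ?C' (al c) \<or> z = ?C' (be c)" using that unfolding sc(2) by blast
              have "z \<in> ?C' ` insert u (set as) \<longleftrightarrow> z = ?C' u" using zc nin by auto
              moreover have "z \<in> P' \<longleftrightarrow> z = ?C' u"
              proof -
                have "(?C' (al c) \<in> P') \<noteq> (?C' (be c) \<in> P')" using L by blast
                then show ?thesis
                  using zc \<open>u = al c \<or> u = be c\<close> \<open>?C' u \<in> P'\<close> ab ab[symmetric] by (elim disjE) simp_all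
              qed
              ultimately show ?thesis by blast
            qed
          qed (use L in blast)
          note * = this
          from L consider "?C' (al c) \<in> P'" | "?C' (be c) \<in> P'" by blast
          then show ?R using *[of "al c"] *[of "be c"] by cases simp_all
        next
          assume ?R
          then show ?L
          proof (elim disjE)
            assume P': "P' = ?C' ` insert (al c) (set as)"
            then have "?C' (al c) \<in> P'" "?C' (be c) \<notin> P'" using nin ab by auto
            then show ?L using mem[of "insert (al c) (set as)"] P' by blast
          next
            assume P': "P' = ?C' ` insert (be c) (set as)"
            then have "?C' (be c) \<in> P'" "?C' (al c) \<notin> P'" using nin ab by auto
            then show ?L using mem[of "insert (be c) (set as)"] P' by blast
          qed
        qed
        then show "s' \<in> {s' \<in> enhanced_states D. state_step D c (B, P) s'} \<longleftrightarrow>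
            s' \<in> {(?B', ?C' ` insert (al c) (set as)), (?B', ?C' ` insert (be c) (set as))}"
        proof -
          assume eqv: "?L \<longleftrightarrow> ?R"
          have sr: "split_rule P P' (?C (al c)) (?C' (al c)) (?C' (be c)) \<longleftrightarrow> (?C' (al c) \<in> P') \<noteq> (?C' (be c) \<in> P')"
            using z by (simp add: split_rule_def)
          show ?thesis unfolding s' mem_Collect_eq ext sr insert_iff prod.inject empty_iff using eqv by argo
        qed
      qed
      have "?C' ` insert (al c) (set as) \<noteq> ?C' ` insert (be c) (set as)" using nin ab by auto
      then have "edge_map D c (B, P) = frag_of (?B', ?C' ` insert (al c) (set as)) + frag_of (?B', ?C' ` insert (be c) (set as))"
        unfolding edge_map_def set_eq by simp
      moreover have dm: "map ?C' as = map ?C as" using eqC by simp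
      have "distinct (map ?C' as)" unfolding dm by (rule True)
      then have "distinct (map ?C' (al c # as))" "distinct (map ?C' (be c # as))"
        using nin by simp_all
      ultimately show ?thesis using True by (simp add: monomial_def P_def)
    next
      case z: True
      then obtain x where "x \<in> set as" "same B (al c) x" unfolding P_def by (auto simp: circle_of_eq_iff)
      then have x: "x \<in> set as" "same B x (al c)" using same_sym by blast+
      have ux: "y = x" if "y \<in> set as" "same B y (al c)" for y
      proof -
        have "same B y x" by (rule same_trans[OF that(2) same_sym[OF x(2)]])
        then have "circle_of D B y = circle_of D B x" by (simp only: circle_of_eq_iff)
        then show ?thesis using True that(1) x(1) by (metis distinct_map inj_onD)
      qed
      let ?X = "insert (al c) (insert (be c) (set as))"
      have set_eq: "{s' \<in> enhanced_states D. state_step D c (B, P) s'} = {(?B', ?C' ` ?X)}"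
      proof (rule Set.set_eqI)
        fix s' :: enhanced_state obtain B'' P' where s': "s' = (B'', P')" by (cases s')
        have "P' \<subseteq> circles D ?B' \<and> P \<inter> circles D ?B' = P' \<inter> circles D B \<and> ?C' (al c) \<in> P' \<and> ?C' (be c) \<in> P' \<longleftrightarrow>
          P' = ?C' ` ?X" (is "?L \<longleftrightarrow> ?R")
        proof
          assume L: ?L
          show ?R
          proof (rule circles_ext[of _ ?B' _ B])
            show "P' \<inter> circles D B = ?C' ` ?X \<inter> circles D B" using L mem[of ?X] by auto
            show "?C' ` ?X \<subseteq> circles D ?B'" using mem[of ?X] by auto
            show "z \<in> P' \<longleftrightarrow> z \<in> ?C' ` ?X" if "z \<in> circles D ?B' - circles D B" for z
              using that L unfolding sc(2) by auto
          qed (use L in blast)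
        next
          assume ?R
          then show ?L using mem[of ?X] by auto
        qed
        then show "s' \<in> {s' \<in> enhanced_states D. state_step D c (B, P) s'} \<longleftrightarrow> s' \<in> {(?B', ?C' ` ?X)}"
          using ext[of B'' P'] z unfolding s' split_rule_def by auto
      qed
      then have em: "edge_map D c (B, P) = frag_of (?B', ?C' ` ?X)" unfolding edge_map_def set_eq by simp
      have dis: "distinct (map ?C' as)"
        using True split_finer[OF d s] by (auto simp: distinct_map inj_on_def circle_of_eq_iff)
      \<comment> \<open>Here \<open>u\<close> is the strand on the new circle that already carries
        \<open>x\<close>, and \<open>u'\<close> is the other strand.\<close>
      have rhs: "monomial ?B' (u # as) = 0 \<and> monomial ?B' (u' # as) = frag_of (?B', ?C' ` ?X)"
        if u: "same ?B' x u" and uu: "u = al c \<and> u' = be c \<or> u = be c \<and> u' = al c" for u u'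
      proof
        show "monomial ?B' (u # as) = 0" using x u monomial_zero same_sym by blast
        have "\<not> same ?B' y u'" if "y \<in> set as" for y
        proof
          assume yu: "same ?B' y u'"
          then have "same B y u'" by (rule split_finer[OF d s])
          then have "same B y (al c)" using uu s same_trans same_sym by blast
          then have "y = x" using ux that by blast
          then have "same ?B' u u'" using u yu same_trans same_sym by blast
          then show False using uu ns same_sym by blast
        qed
        then have "?C' u' \<notin> ?C' ` set as" by (metis circle_of_eq_iff imageE)
        moreover have "?C' u \<in> ?C' ` set as" using u x by (metis circle_of_eq_iff imageI)
        then have "?C' ` ?X = ?C' ` insert u' (set as)" using uu by auto
        ultimately show "monomial ?B' (u' # as) = frag_of (?B', ?C' ` ?X)" using dis by (simp add: monomial_def)
      qed
      have "same ?B' x (al c) \<or> same ?B' x (be c)" by (rule split_two[OF d s x(2)])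
      then have "monomial ?B' (al c # as) + monomial ?B' (be c # as) = frag_of (?B', ?C' ` ?X)"
        using rhs[of "al c" "be c"] rhs[of "be c" "al c"] by auto
      then show ?thesis using True em by (simp add: monomial_def P_def)
    qed
  qed
qed

text \<open>A merge identifies two generators of the algebra, so a product of arcs keeps its name;
  it vanishes exactly when two of its arcs come to lie on one circle.\<close>

lemma edge_map_merge:
  assumes c: "c < length D" "c \<notin> B" and B: "B \<subseteq> {..<length D}" and s: "\<not> same B (al c) (be c)"
    and as: "set as \<subseteq> arcs D"
  shows "frag_extend (edge_map D c) (monomial B as) = monomial (insert c B) as"
proof -
  let ?B' = "insert c B" and ?C = "circle_of D B" and ?C' = "circle_of D (insert c B)"
  have d0: "differ_at c B ?B'" using c by (auto simp: differ_at_def)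
  have s': "same ?B' (al c) (be c)" using saddle_xor[OF d0] s by blast
  note d = differ_at_sym[OF d0]
  note sc = split_circles[OF d s']
  have fin: "same B x y \<Longrightarrow> same ?B' x y" for x y by (rule split_finer[OF d s'])
  show ?thesis
  proof (cases "distinct (map ?C as)")
    case False
    then have "monomial B as = 0" by (simp add: monomial_def)
    then show ?thesis using monomial_zero2 fin by simp
  next
    case True
    define P where "P = ?C ` set as"
    have PC: "P \<subseteq> circles D B" using as circle_of_in by (auto simp: P_def)
    have img: "?C' ` set as \<subseteq> circles D ?B'" using as circle_of_in by auto
    have ext: "(B'', P') \<in> enhanced_states D \<and> state_step D c (B, P) (B'', P') \<longleftrightarrow>
        B'' = ?B' \<and> P' \<subseteq> circles D ?B' \<and> P \<inter> circles D ?B' = P' \<inter> circles D B \<and>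
        merge_rule P P' (?C (al c)) (?C (be c)) (?C' (al c))" for B'' P'
    proof -
      have "state_step D c (B, P) (B'', P') \<Longrightarrow> B'' = ?B'" by (simp add: state_step_def)
      then show ?thesis using step_merge_iff[OF c s, of P P'] B c by (auto simp: enhanced_states_def)
    qed
    have com: "P \<inter> circles D ?B' = ?C' ` set as \<inter> circles D B"
    proof (rule Set.set_eqI)
      fix w
      show "w \<in> P \<inter> circles D ?B' \<longleftrightarrow> w \<in> ?C' ` set as \<inter> circles D B"
        using common_mem[of w B ?B' "set as"] PC img unfolding P_def by (metis IntD1 IntD2 IntI subsetD)
    qed
    have z: "?C' (al c) \<in> ?C' ` set as \<longleftrightarrow> ?C (al c) \<in> P \<or> ?C (be c) \<in> P"
    proof -
      have "?C' (al c) = ?C' x \<longleftrightarrow> ?C (al c) = ?C x \<or> ?C (be c) = ?C x" for x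
        unfolding circle_of_eq_iff
        using split_two[OF d s', of x] fin s' same_sym same_trans by blast
      then show ?thesis unfolding P_def by (simp add: image_iff bex_disj_distrib)
    qed
    show ?thesis
    proof (cases "?C (al c) \<in> P \<and> ?C (be c) \<in> P")
      case both: True
      then have empty: "{s' \<in> enhanced_states D. state_step D c (B, P) s'} = {}"
        using ext unfolding merge_rule_def by auto
      obtain x y where xy: "x \<in> set as" "y \<in> set as" "?C (al c) = ?C x" "?C (be c) = ?C y"
        using both by (auto simp: P_def)
      then have sx: "same B (al c) x" and sy: "same B (be c) y" by (simp_all add: circle_of_eq_iff)
      have "same ?B' x y" by (rule same_trans[OF same_sym[OF fin[OF sx]] same_trans[OF s' fin[OF sy]]])
      moreover have "x \<noteq> y" using s sx sy same_sym same_trans by blast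
      ultimately have "x \<noteq> y \<and> same ?B' x y" by blast
      then have "\<not> distinct (map ?C' as)" using xy by (auto simp: distinct_map inj_on_def circle_of_eq_iff)
      moreover have "edge_map D c (B, P) = 0" unfolding edge_map_def empty by simp
      ultimately show ?thesis using True by (simp add: monomial_def P_def)
    next
      case nb: False
      have set_eq: "{s' \<in> enhanced_states D. state_step D c (B, P) s'} = {(?B', ?C' ` set as)}"
      proof (rule Set.set_eqI)
        fix s' :: enhanced_state obtain B'' P' where s'': "s' = (B'', P')" by (cases s')
        have "P' \<subseteq> circles D ?B' \<and> P \<inter> circles D ?B' = P' \<inter> circles D B \<and>
            merge_rule P P' (?C (al c)) (?C (be c)) (?C' (al c)) \<longleftrightarrow> P' = ?C' ` set as" (is "?L \<longleftrightarrow> ?R")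
        proof
          assume L: ?L
          then have new: "?C' (al c) \<in> P' \<longleftrightarrow> ?C' (al c) \<in> ?C' ` set as"
            unfolding z merge_rule_def using nb by blast
          show ?R
          proof (rule circles_ext[of _ ?B' _ B])
            show "P' \<inter> circles D B = ?C' ` set as \<inter> circles D B" using L com by simp
            show "z \<in> P' \<longleftrightarrow> z \<in> ?C' ` set as" if "z \<in> circles D ?B' - circles D B" for z
              using that new unfolding sc(1) by simp
          qed (use L img in blast)+
        next
          assume R: ?R
          have "merge_rule P P' (?C (al c)) (?C (be c)) (?C' (al c))"
            unfolding R merge_rule_def z using nb by blast
          then show ?L using R com img by blast
        qed
        then show "s' \<in> {s' \<in> enhanced_states D. state_step D c (B, P) s'} \<longleftrightarrow> s' \<in> {(?B', ?C' ` set as)}"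
          using ext[of B'' P'] unfolding s'' by auto
      qed
      have "x = y" if "x \<in> set as" "y \<in> set as" "same ?B' x y" for x y
      proof -
        have "same B x y"
        proof (rule ccontr)
          assume "\<not> same B x y"
          then have "same B x (al c) \<and> same B y (be c) \<or> same B x (be c) \<and> same B y (al c)"
            using saddle_join[OF d0 that(3)] by blast
          then have "?C (al c) \<in> ?C ` set as \<and> ?C (be c) \<in> ?C ` set as"
            using that(1,2) by (metis circle_of_eq_iff imageI)
          then show False using nb by (simp add: P_def)
        qed
        then show ?thesis using that True by (auto simp: distinct_map inj_on_def circle_of_eq_iff)
      qed
      then have "distinct (map ?C' as)" using True by (auto simp: distinct_map inj_on_def circle_of_eq_iff)
      moreover have "edge_map D c (B, P) = frag_of (?B', ?C' ` set as)" unfolding edge_map_def set_eq by simp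
      ultimately show ?thesis using True by (simp add: monomial_def P_def)
    qed
  qed
qed

lemma edge_map_old: "c \<in> B \<Longrightarrow> frag_extend (edge_map D c) (monomial B as) = 0"
  by (simp add: monomial_def edge_map_def state_step_def)

lemma card_circles_step:
  assumes "c < length D" "c \<notin> B"
  shows "int (card (circles D (insert c B))) = int (card (circles D B)) + (if same B (al c) (be c) then 1 else - 1)"
proof -
  have d: "differ_at c B (insert c B)" using assms by (auto simp: differ_at_def)
  show ?thesis
    using split_circles(4)[OF d] split_circles(4)[OF differ_at_sym[OF d]] saddle_xor[OF d] by auto
qed

text \<open>Both orders reach the same state, so the total change in the number of circles agrees
  and leaves six patterns. Since splits are multiplications and merges keep names, four of them are
  immediate. In the other two the products must be compared on the circles of the final
  state.\<close>

lemma edge_maps_commute: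
  assumes c: "c < length D" "c \<notin> B" and h: "h < length D" "h \<notin> B" and ch: "c \<noteq> h"
    and B: "B \<subseteq> {..<length D}" and as: "set as \<subseteq> arcs D"
  shows "frag_extend (edge_map D h) (frag_extend (edge_map D c) (monomial B as)) =
    frag_extend (edge_map D c) (frag_extend (edge_map D h) (monomial B as))"
proof -
  let ?Bc = "insert c B" and ?Bh = "insert h B" and ?BB = "insert h (insert c B)"
  have BB: "insert c ?Bh = ?BB" by auto
  have al: "set (u # as) \<subseteq> arcs D" if "u = al c \<or> u = be c \<or> u = al h \<or> u = be h" for u
    using that as al_be_in c h by auto
  have dc: "differ_at c B ?Bc" "differ_at c ?Bh ?BB" and dh: "differ_at h B ?Bh" "differ_at h ?Bc ?BB"
    using c h ch by (auto simp: differ_at_def)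
  define p q p' q' where "p = same B (al c) (be c)" and "q = same ?Bc (al h) (be h)"
    and "p' = same B (al h) (be h)" and "q' = same ?Bh (al c) (be c)"
  note defs = p_def q_def p'_def q'_def
  have cnt: "(if p then 1 else - 1) + (if q then 1 else - 1) = (if p' then 1 else - 1) + (if q' then 1 else - 1 :: int)"
    using card_circles_step[of c B] card_circles_step[of h ?Bc] card_circles_step[of h B] card_circles_step[of c ?Bh]
      c h ch unfolding BB defs by auto
  have hB: "h < length D" "h \<notin> ?Bc" "?Bc \<subseteq> {..<length D}" and cB: "c < length D" "c \<notin> ?Bh" "?Bh \<subseteq> {..<length D}"
    using c h ch B by auto
  have L: "frag_extend (edge_map D h) (frag_extend (edge_map D c) (monomial B as)) =
      (let F = (\<lambda>as. if q then monomial ?BB (al h # as) + monomial ?BB (be h # as) else monomial ?BB as) in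
       if p then F (al c # as) + F (be c # as) else F as)"
    using edge_map_split[OF c B _ as] edge_map_merge[OF c B _ as]
      edge_map_split[OF hB] edge_map_merge[OF hB] as al
    by (simp add: defs frag_extend_add Let_def)
  have R: "frag_extend (edge_map D c) (frag_extend (edge_map D h) (monomial B as)) =
      (let F = (\<lambda>as. if q' then monomial ?BB (al c # as) + monomial ?BB (be c # as) else monomial ?BB as) in
       if p' then F (al h # as) + F (be h # as) else F as)"
    using edge_map_split[OF h B _ as] edge_map_merge[OF h B _ as]
      edge_map_split[OF cB] edge_map_merge[OF cB] as al
    by (simp add: defs frag_extend_add Let_def BB)
  consider "p" "q" "p'" "q'" | "\<not> p" "\<not> q" "\<not> p'" "\<not> q'" | "p" "\<not> q" "\<not> p'" "q'" | "\<not> p" "q" "p'" "\<not> q'"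
    | "p" "\<not> q" "p'" "\<not> q'" | "\<not> p" "q" "\<not> p'" "q'"
    using cnt by (cases p; cases q; cases p'; cases q') auto
  then show ?thesis
  proof cases
    case 1
    then show ?thesis unfolding L R Let_def using monomial_swap by (simp add: algebra_simps)
  next
    \<comment> \<open>Both orders split and then merge. In the final state all four strands lie on
      one circle, so each order multiplies by twice the same generator.\<close>
    case 5
    have sc: "same ?BB (al c) (be c)" using saddle_xor[OF dc(2)] 5 by (simp add: defs)
    have sh: "same ?BB (al h) (be h)" using saddle_xor[OF dh(2)] 5 by (simp add: defs)
    have up: "same ?Bc x y \<Longrightarrow> same ?BB x y" for x y using split_finer[OF differ_at_sym[OF dh(2)] sh] .
    have "same B (al h) (al c)"
    proof (rule ccontr)
      assume n: "\<not> same B (al h) (al c)"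
      have "circle_of D ?Bc (al h) = circle_of D B (al h)"
        using split_unchanged[OF dc(1) _ n] 5 by (simp add: defs)
      moreover have "be h \<in> circle_of D B (al h)" using 5 by (simp add: in_circle_of defs)
      ultimately have "same ?Bc (al h) (be h)" by (metis in_circle_of)
      then show False using 5 by (simp add: defs)
    qed
    then have "same ?Bc (al h) (al c) \<or> same ?Bc (al h) (be c)"
      using split_two[OF dc(1)] 5 by (simp add: defs)
    then have "same ?BB (al h) (al c)" using up sc same_trans same_sym by blast
    then have "same ?BB (al c) (al h)" "same ?BB (be c) (be h)" using sc sh same_trans same_sym by blast+
    then show ?thesis unfolding L R Let_def using 5 monomial_cong by simp
  next
    \<comment> \<open>Both orders merge and then split. The strands at \<open>c\<close> and those at
      \<open>h\<close> represent the same two final circles, so \<open>al c + be c\<close> and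
      \<open>al h + be h\<close> are the same factor.\<close>
    case 6
    have nsc: "\<not> same ?BB (al c) (be c)" using saddle_xor[OF dc(2)] 6 by (simp add: defs)
    have nB: "\<not> same B (al h) (be h)" and sBc: "same ?Bc (al h) (be h)" using 6 by (simp_all add: defs)
    then have "same B (al h) (al c) \<and> same B (be h) (be c) \<or> same B (al h) (be c) \<and> same B (be h) (al c)"
      using saddle_join[OF dc(1) sBc] by blast
    moreover have sc': "same ?Bc (al c) (be c)" using saddle_xor[OF dc(1)] 6 by (simp add: defs)
    have up: "same B x y \<Longrightarrow> same ?Bc x y" for x y using split_finer[OF differ_at_sym[OF dc(1)] sc'] .
    ultimately have "same ?Bc (al c) (al h)" using up sc' same_trans same_sym by blast
    then have "same ?Bc (al c) (al h)" "same ?Bc (be c) (al h)" using sc' same_trans same_sym by blast+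
    then have "same ?BB (al c) (al h) \<or> same ?BB (al c) (be h)" "same ?BB (be c) (al h) \<or> same ?BB (be c) (be h)"
      using split_two[OF dh(2) sBc] by blast+
    then have "same ?BB (al c) (al h) \<and> same ?BB (be c) (be h) \<or> same ?BB (al c) (be h) \<and> same ?BB (be c) (al h)"
      using nsc same_trans same_sym by blast
    then show ?thesis unfolding L R Let_def using 6 monomial_cong by (auto simp: algebra_simps)
  qed (auto simp: L R Let_def)
qed

lemma state_monomial:
  assumes "s \<in> enhanced_states D"
  obtains as where "set as \<subseteq> arcs D" "frag_of s = monomial (fst s) as" "fst s \<subseteq> {..<length D}"
proof -
  obtain B P where s: "s = (B, P)" by (cases s)
  then have B: "B \<subseteq> {..<length D}" and P: "P \<subseteq> circles D B" using assms by (auto simp: enhanced_states_def)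
  have "finite P" using P finite_circles finite_subset by blast
  then obtain zs where zs: "set zs = P" "distinct zs" using finite_distinct_list by blast
  define rep where "rep z = (SOME x. x \<in> arcs D \<and> circle_of D B x = z)" for z
  have rep: "rep z \<in> arcs D" "circle_of D B (rep z) = z" if "z \<in> P" for z
  proof -
    have "\<exists>x. x \<in> arcs D \<and> circle_of D B x = z" using that P circle_cases by blast
    then show "rep z \<in> arcs D" "circle_of D B (rep z) = z" unfolding rep_def by (metis (mono_tags, lifting) someI_ex)+
  qed
  have "map (circle_of D B \<circ> rep) zs = zs" by (rule map_idI) (use rep zs in simp)
  then have "map (circle_of D B) (map rep zs) = zs" by simp
  then have "monomial B (map rep zs) = frag_of (B, P)"
    unfolding monomial_def using zs by (metis image_set)
  then show ?thesis using that[of "map rep zs"] rep zs s B by auto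
qed

text \<open>Inserting the lower crossing changes the exponent at the higher one by one; inserting
  the higher crossing changes nothing at the lower one.\<close>

lemma edge_sign_swap:
  assumes B: "finite B" and c: "c \<notin> B" and h: "h \<notin> B" and ch: "c \<noteq> h"
  shows "edge_sign B c * edge_sign (insert c B) h = - (edge_sign B h * edge_sign (insert h B) c)"
proof -
  have aux: "edge_sign B c * edge_sign (insert c B) h = - (edge_sign B h * edge_sign (insert h B) c)"
    if "c < h" "c \<notin> B" for c h
  proof -
    have "{x \<in> insert c B. x < h} = insert c {x \<in> B. x < h}" "{x \<in> insert h B. x < c} = {x \<in> B. x < c}"
      using that by auto
    then show ?thesis using B that by (simp add: edge_sign_def)
  qed
  show ?thesis using aux[of c h] aux[of h c] c h ch by (cases "c < h") auto
qed

lemma khovanov_d_monomial: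
  "khovanov_d D (monomial B as) = (\<Sum>c<length D. frag_cmul (edge_sign B c) (frag_extend (edge_map D c) (monomial B as)))"
  by (simp add: khovanov_d_edges monomial_def)

lemma khovanov_d_add: "khovanov_d D (x + y) = khovanov_d D x + khovanov_d D y"
  by (simp add: khovanov_d_def frag_extend_add)

lemma khovanov_d_diff: "khovanov_d D (x - y) = khovanov_d D x - khovanov_d D y"
  by (simp add: khovanov_d_def frag_extend_diff)

lemma khovanov_d_0: "khovanov_d D 0 = 0"
  by (simp add: khovanov_d_def)

lemma khovanov_d_cmul: "khovanov_d D (frag_cmul k x) = frag_cmul k (khovanov_d D x)"
  by (simp add: khovanov_d_def frag_extend_cmul)

lemma khovanov_d_sum: "finite I \<Longrightarrow> khovanov_d D (\<Sum>i\<in>I. f i) = (\<Sum>i\<in>I. khovanov_d D (f i))"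
  by (simp add: khovanov_d_def frag_extend_sum)

lemma khovanov_d_edge_map:
  assumes c: "c < length D" "c \<notin> B" and B: "B \<subseteq> {..<length D}" and as: "set as \<subseteq> arcs D"
  shows "khovanov_d D (frag_extend (edge_map D c) (monomial B as)) =
    (\<Sum>h<length D. frag_cmul (edge_sign (insert c B) h)
      (frag_extend (edge_map D h) (frag_extend (edge_map D c) (monomial B as))))"
proof (cases "same B (al c) (be c)")
  case True
  show ?thesis unfolding edge_map_split[OF c B True as]
    by (simp add: khovanov_d_add khovanov_d_monomial frag_extend_add frag_cmul_distrib2 sum.distrib)
next
  case False
  show ?thesis unfolding edge_map_merge[OF c B False as] by (rule khovanov_d_monomial)
qed

lemma edge_map_twice:
  assumes c: "c < length D" "c \<notin> B" and B: "B \<subseteq> {..<length D}" and as: "set as \<subseteq> arcs D" and h: "h \<in> insert c B"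
  shows "frag_extend (edge_map D h) (frag_extend (edge_map D c) (monomial B as)) = 0"
proof (cases "same B (al c) (be c)")
  case True
  show ?thesis unfolding edge_map_split[OF c B True as] using edge_map_old[OF h] by (simp add: frag_extend_add)
next
  case False
  show ?thesis unfolding edge_map_merge[OF c B False as] using edge_map_old[OF h] by simp
qed

lemma khovanov_d_twice_state:
  assumes s: "s \<in> enhanced_states D"
  shows "khovanov_d D (khovanov_d D (frag_of s)) = 0"
proof -
  define B where "B = fst s"
  obtain as where as: "set as \<subseteq> arcs D" "frag_of s = monomial B as" and B: "B \<subseteq> {..<length D}"
    using state_monomial[OF s] unfolding B_def by metis
  have finB: "finite B" using B finite_subset by blast
  define E where "E c x = frag_extend (edge_map D c) x" for c x
  define G where "G c h = frag_cmul (edge_sign B c) (frag_cmul (edge_sign (insert c B) h) (E h (E c (monomial B as))))" for c h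
  have "khovanov_d D (khovanov_d D (frag_of s)) = (\<Sum>c<length D. frag_cmul (edge_sign B c) (khovanov_d D (E c (monomial B as))))"
    unfolding as(2) khovanov_d_monomial by (simp add: khovanov_d_sum khovanov_d_cmul E_def)
  also have "\<dots> = (\<Sum>c<length D. \<Sum>h<length D. G c h)"
  proof (rule sum.cong[OF refl])
    fix c assume "c \<in> {..<length D}"
    then have c: "c < length D" by simp
    show "frag_cmul (edge_sign B c) (khovanov_d D (E c (monomial B as))) = (\<Sum>h<length D. G c h)"
    proof (cases "c \<in> B")
      case True
      then have "E c (monomial B as) = 0" unfolding E_def by (rule edge_map_old)
      then show ?thesis by (simp add: G_def E_def khovanov_d_0)
    next
      case False
      show ?thesis unfolding E_def khovanov_d_edge_map[OF c False B as(1)] G_def by (simp add: frag_cmul_sum)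
    qed
  qed
  also have "\<dots> = 0"
  proof (rule antisymmetric_sum_zero)
    fix c h assume "c \<in> {..<length D}" "h \<in> {..<length D}"
    then have c: "c < length D" and h: "h < length D" by simp_all
    have z: "G c h = 0" if "c < length D" "c \<in> B \<or> h \<in> insert c B" for c h
    proof (cases "c \<in> B")
      case True
      then have "E c (monomial B as) = 0" unfolding E_def by (rule edge_map_old)
      then show ?thesis by (simp add: G_def E_def)
    next
      case False
      then have "E h (E c (monomial B as)) = 0" unfolding E_def
        using edge_map_twice[OF that(1) False B as(1)] that(2) by blast
      then show ?thesis by (simp add: G_def)
    qed
    show "G c h = - G h c"
    proof (cases "c \<in> B \<or> h \<in> B \<or> c = h")
      case True
      then show ?thesis using z[of c h] z[of h c] c h by auto
    next
      case False
      then have "E h (E c (monomial B as)) = E c (E h (monomial B as))"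
        unfolding E_def using edge_maps_commute[of c B h as] c h B as(1) by blast
      then show ?thesis using edge_sign_swap[OF finB, of c h] False by (simp add: G_def)
    qed
  qed
  finally show ?thesis .
qed

lemma khovanov_d_twice:
  assumes "Poly_Mapping.keys x \<subseteq> enhanced_states D"
  shows "khovanov_d D (khovanov_d D x) = 0"
  using assms
proof (induction x rule: frag_induction)
  case (diff a b)
  then show ?case by (simp add: khovanov_d_diff)
qed (simp_all add: khovanov_d_0 khovanov_d_twice_state)

lemma step_unique: "state_step D c s s' \<Longrightarrow> state_step D h s s' \<Longrightarrow> c = h"
  by (auto simp: state_step_def split: prod.splits)

text \<open>The crossing of a step can be read off from the two states, so no terms cancel.\<close>

lemma khovanov_d_coeff:
  assumes s': "s' \<in> enhanced_states D"
  shows "\<bar>Poly_Mapping.lookup (khovanov_d D (frag_of s)) s'\<bar> = (if \<exists>c. state_step D c s s' then 1 else 0)"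
proof -
  have em: "Poly_Mapping.lookup (edge_map D c s) s' = (if state_step D c s s' then 1 else 0)" for c
  proof -
    have "Poly_Mapping.lookup (edge_map D c s) s' = (\<Sum>t | t \<in> enhanced_states D \<and> state_step D c s t. if s' = t then 1 else 0)"
      unfolding edge_map_def by (simp add: lookup_sum)
    then show ?thesis using s' finite_enhanced by (simp add: sum.delta)
  qed
  have lk: "Poly_Mapping.lookup (khovanov_d D (frag_of s)) s' =
      (\<Sum>c<length D. if state_step D c s s' then edge_sign (fst s) c else 0)"
    by (simp add: khovanov_d_edges lookup_sum em if_distrib cong: if_cong)
  show ?thesis
  proof (cases "\<exists>c. state_step D c s s'")
    case True
    then obtain c where c: "state_step D c s s'" by blast
    then have cl: "c < length D" by (simp add: state_step_def case_prod_beta)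
    have eq: "(\<lambda>h. if state_step D h s s' then edge_sign (fst s) h else 0) = (\<lambda>h. if h = c then edge_sign (fst s) c else 0)"
      using c step_unique by fastforce
    then have "Poly_Mapping.lookup (khovanov_d D (frag_of s)) s' = edge_sign (fst s) c"
      unfolding lk eq using cl by simp
    then show ?thesis using True by (simp add: edge_sign_def power_abs)
  qed (use lk in simp)
qed

lemma khovanov_d_keys:
  assumes "s' \<in> Poly_Mapping.keys (khovanov_d D (frag_of s))"
  shows "s' \<in> enhanced_states D" "\<exists>c. state_step D c s s'"
proof -
  have "s' \<in> Poly_Mapping.keys (\<Sum>c<length D. frag_cmul (edge_sign (fst s) c) (edge_map D c s))"
    using assms by (simp add: khovanov_d_edges)
  then obtain c where "s' \<in> Poly_Mapping.keys (edge_map D c s)"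
    using keys_sum[of "\<lambda>c. frag_cmul (edge_sign (fst s) c) (edge_map D c s)" "{..<length D}"] by auto
  then obtain t where "t \<in> enhanced_states D" "state_step D c s t" "s' \<in> Poly_Mapping.keys (frag_of t)"
    unfolding edge_map_def using keys_sum[of frag_of "{t. t \<in> enhanced_states D \<and> state_step D c s t}"] by blast
  then show "s' \<in> enhanced_states D" "\<exists>c. state_step D c s s'" by auto
qed

text \<open>A split adds one circle and one sign \<open>+\<close>, a merge removes one circle and
  keeps the number of signs \<open>+\<close>. In both cases \<open>tau\<close> grows by 1, as
  \<open>i_deg\<close> does.\<close>

lemma step_degrees:
  assumes s: "s \<in> enhanced_states D" and s': "s' \<in> enhanced_states D" and step: "state_step D c s s'"
  shows "i_deg D s' = i_deg D s + 1" "j_deg D s' = j_deg D s"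
proof -
  obtain B P where BP: "s = (B, P)" by (cases s)
  have c: "c < length D" "c \<notin> B" and B': "fst s' = insert c B"
    using step BP by (auto simp: state_step_def split: prod.splits)
  then obtain P' where BP': "s' = (insert c B, P')" by (cases s') auto
  have B: "B \<subseteq> {..<length D}" and P: "P \<subseteq> circles D B" and P': "P' \<subseteq> circles D (insert c B)"
    using s s' BP BP' by (auto simp: enhanced_states_def)
  have finB: "finite B" using B finite_subset by blast
  have cB: "{..<length D} - B = insert c ({..<length D} - insert c B)" using c by auto
  have "card ({..<length D} - B) = Suc (card ({..<length D} - insert c B))" unfolding cB by simp
  then have sg: "sigma D s' = sigma D s - 2" using c finB by (simp add: sigma_def BP BP')
  then have "writhe D - sigma D s' = (writhe D - sigma D s) + 2" by simp
  then show i: "i_deg D s' = i_deg D s + 1" unfolding i_deg_def by simp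
  have fin: "finite P" "finite P'" using P P' finite_circles finite_subset by blast+
  have tau: "tau D (X, Q) = 2 * int (card Q) - int (card (circles D X))" if "Q \<subseteq> circles D X" for X Q
  proof -
    have "card (circles D X - Q) = card (circles D X) - card Q" "card Q \<le> card (circles D X)"
      using that finite_circles by (auto simp: card_Diff_subset finite_subset card_mono)
    then show ?thesis by (simp add: tau_def)
  qed
  have cP: "card P = card (P \<inter> circles D (insert c B)) + card (P - circles D (insert c B))"
    "card P' = card (P' \<inter> circles D B) + card (P' - circles D B)"
    using fin card_Int_Diff by auto
  have d: "differ_at c B (insert c B)" using c by (auto simp: differ_at_def)
  have "2 * int (card P') - int (card (circles D (insert c B))) = 2 * int (card P) - int (card (circles D B)) + 1"
  proof (cases "same B (al c) (be c)")
    case True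
    note sc = split_circles[OF d True]
    have st: "P \<inter> circles D (insert c B) = P' \<inter> circles D B"
      and sr: "split_rule P P' (circle_of D B (al c)) (circle_of D (insert c B) (al c)) (circle_of D (insert c B) (be c))"
      using step step_split_iff[OF c True] BP BP' by auto
    have 1: "P - circles D (insert c B) = P \<inter> {circle_of D B (al c)}" using P sc(1) by blast
    have 2: "P' - circles D B = P' \<inter> {circle_of D (insert c B) (al c), circle_of D (insert c B) (be c)}" using P' sc(2) by blast
    have "card (P' - circles D B) = Suc (card (P - circles D (insert c B)))"
      using sr sc(3) unfolding 1 2 split_rule_def by (auto simp: Int_insert_right)
    then show ?thesis using cP st sc(4) by simp
  next
    case False
    then have s': "same (insert c B) (al c) (be c)" using saddle_xor[OF d] by blast
    note sc = split_circles[OF differ_at_sym[OF d] s']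
    have st: "P \<inter> circles D (insert c B) = P' \<inter> circles D B"
      and mr: "merge_rule P P' (circle_of D B (al c)) (circle_of D B (be c)) (circle_of D (insert c B) (al c))"
      using step step_merge_iff[OF c False] BP BP' by auto
    have 1: "P' - circles D B = P' \<inter> {circle_of D (insert c B) (al c)}" using P' sc(1) by blast
    have 2: "P - circles D (insert c B) = P \<inter> {circle_of D B (al c), circle_of D B (be c)}" using P sc(2) by blast
    have "card (P' - circles D B) = card (P - circles D (insert c B))"
      using mr sc(3) unfolding 1 2 merge_rule_def by (auto simp: Int_insert_right)
    then show ?thesis using cP st sc(4) by simp
  qed
  then have "tau D s' = tau D s + 1" using tau P P' by (simp add: BP BP')
  then show "j_deg D s' = j_deg D s" using i by (simp add: j_deg_def)
qed

text \<open>Splitting a circle with sign \<open>+\<close> makes both parts \<open>+\<close>, and a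
  nonzero merge with such a circle is \<open>+\<close>. So the circle of the basepoint keeps its
  sign.\<close>

lemma step_reduced:
  assumes s: "s \<in> reduced_states D b" and s': "s' \<in> enhanced_states D" and step: "state_step D c s s'"
  shows "s' \<in> reduced_states D b"
proof -
  obtain B P where BP: "s = (B, P)" by (cases s)
  have c: "c < length D" "c \<notin> B" and B': "fst s' = insert c B"
    using step BP by (auto simp: state_step_def split: prod.splits)
  then obtain P' where BP': "s' = (insert c B, P')" by (cases s') auto
  have P: "P \<subseteq> circles D B" and "\<exists>x\<in>P. b \<in> x"
    using s BP by (auto simp: reduced_states_def enhanced_states_def)
  then obtain x where x: "x \<in> P" "b \<in> x" by blast
  then have bP: "circle_of D B b \<in> P" using P by (metis circle_cases circle_of_eq_iff in_circle_of subsetD)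
  have d: "differ_at c B (insert c B)" using c by (auto simp: differ_at_def)
  have bC: "circle_of D B b \<in> circles D B" "circle_of D (insert c B) b \<in> circles D (insert c B)"
    using base circle_of_in by auto
  have "circle_of D (insert c B) b \<in> P'"
  proof (cases "same B (al c) (be c)")
    case True
    have st: "P \<inter> circles D (insert c B) = P' \<inter> circles D B"
      and sr: "split_rule P P' (circle_of D B (al c)) (circle_of D (insert c B) (al c)) (circle_of D (insert c B) (be c))"
      using step step_split_iff[OF c True] BP BP' by auto
    show ?thesis
    proof (cases "same B b (al c)")
      case t: True
      then have "circle_of D B (al c) \<in> P" using bP by (metis circle_of_eq_iff)
      then have "circle_of D (insert c B) (al c) \<in> P'" "circle_of D (insert c B) (be c) \<in> P'"
        using sr by (auto simp: split_rule_def)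
      moreover have "same (insert c B) b (al c) \<or> same (insert c B) b (be c)" by (rule split_two[OF d True t])
      ultimately show ?thesis by (metis circle_of_eq_iff)
    next
      case f: False
      then have "circle_of D (insert c B) b = circle_of D B b" by (rule split_unchanged[OF d True])
      then show ?thesis using st bP bC by auto
    qed
  next
    case False
    then have ss: "same (insert c B) (al c) (be c)" using saddle_xor[OF d] by blast
    have st: "P \<inter> circles D (insert c B) = P' \<inter> circles D B"
      and mr: "merge_rule P P' (circle_of D B (al c)) (circle_of D B (be c)) (circle_of D (insert c B) (al c))"
      using step step_merge_iff[OF c False] BP BP' by auto
    show ?thesis
    proof (cases "same (insert c B) b (al c)")
      case t: True
      then have "same B b (al c) \<or> same B b (be c)" by (rule split_two[OF differ_at_sym[OF d] ss])
      then have "circle_of D B (al c) \<in> P \<or> circle_of D B (be c) \<in> P" using bP by (metis circle_of_eq_iff)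
      then have "circle_of D (insert c B) (al c) \<in> P'" using mr by (auto simp: merge_rule_def)
      then show ?thesis using t by (metis circle_of_eq_iff)
    next
      case f: False
      then have "circle_of D B b = circle_of D (insert c B) b" by (rule split_unchanged[OF differ_at_sym[OF d] ss])
      then show ?thesis using st bP bC by auto
    qed
  qed
  then show ?thesis using s' BP' circle_self by (auto simp: reduced_states_def)
qed

end

section \<open>Spectral sequences with a single row\<close>

lemma trivial_groups_iso:
  assumes "trivial_group G" "trivial_group H"
  shows "G \<cong> H"
proof -
  have "group G" "group H" "carrier G = {\<one>\<^bsub>G\<^esub>}" "carrier H = {\<one>\<^bsub>H\<^esub>}"
    using assms by (auto simp: trivial_group_def)
  then have "(\<lambda>_. \<one>\<^bsub>H\<^esub>) \<in> iso G H"
    by (auto simp: iso_def hom_def bij_betw_def group.is_monoid monoid.l_one monoid.one_closed)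
  then show ?thesis by (auto simp: is_iso_def)
qed

lemma mod_one_iso:
  assumes "group G"
  shows "G Mod {\<one>\<^bsub>G\<^esub>} \<cong> G"
proof -
  interpret group_hom G G id
    using assms by (simp add: group_hom_def group_hom_axioms_def hom_def)
  have "kernel G G id = {\<one>\<^bsub>G\<^esub>}" using assms by (auto simp: kernel_def group.is_monoid monoid.one_closed)
  then show ?thesis using FactGroup_iso by simp
qed

lemma mod_self_trivial:
  assumes "comm_group G"
  shows "trivial_group (G Mod carrier G)"
proof -
  interpret comm_group G by fact
  have n: "carrier G \<lhd> G" using subgroup_self subgroup_imp_normal by blast
  have "carrier (G Mod carrier G) \<subseteq> {carrier G}"
    unfolding carrier_FactGroup using coset_join2[OF _ subgroup_self] by blast
  then show ?thesis
    using normal.factorgroup_is_group[OF n] group.trivial_group_alt by blast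
qed

lemma homology_at_zero_maps:
  assumes G: "group G" and P: "carrier P \<noteq> {}"
    and f: "\<And>x. x \<in> carrier P \<Longrightarrow> f x = \<one>\<^bsub>G\<^esub>" and g: "\<And>x. x \<in> carrier G \<Longrightarrow> g x = \<one>\<^bsub>Q\<^esub>"
  shows "homology_at P f G g Q \<cong> G"
proof -
  have "kernel G Q g = carrier G" using g by (auto simp: kernel_def)
  moreover have "f ` carrier P = {\<one>\<^bsub>G\<^esub>}" using f P by force
  ultimately show ?thesis using mod_one_iso[OF G] by (simp add: homology_at_def)
qed

lemma comm_group_subgroup:
  assumes "comm_group G" "subgroup H G"
  shows "comm_group (G\<lparr>carrier := H\<rparr>)"
proof -
  interpret comm_group G by fact
  have "group (G\<lparr>carrier := H\<rparr>)" using subgroup.subgroup_is_group[OF assms(2) is_group] .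
  moreover have "x \<otimes>\<^bsub>G\<^esub> y = y \<otimes>\<^bsub>G\<^esub> x" if "x \<in> H" "y \<in> H" for x y
    using that subgroup.mem_carrier[OF assms(2)] m_comm by blast
  ultimately show ?thesis
    by (intro group.group_comm_groupI) auto
qed

lemma homology_at_group:
  assumes A: "group A" and B: "comm_group B" and C: "group C" and f: "f \<in> hom A B" and g: "g \<in> hom B C"
    and gf: "\<And>x. x \<in> carrier A \<Longrightarrow> g (f x) = \<one>\<^bsub>C\<^esub>"
  shows "comm_group (B\<lparr>carrier := kernel B C g\<rparr>)" "subgroup (f ` carrier A) (B\<lparr>carrier := kernel B C g\<rparr>)"
    "comm_group (homology_at A f B g C)"
proof -
  interpret B: comm_group B by fact
  interpret f: group_hom A B f using A f B.is_group by (simp add: group_hom_def group_hom_axioms_def)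
  interpret g: group_hom B C g using C g B.is_group by (simp add: group_hom_def group_hom_axioms_def)
  have k: "subgroup (kernel B C g) B" by (rule g.subgroup_kernel)
  show 1: "comm_group (B\<lparr>carrier := kernel B C g\<rparr>)" by (rule comm_group_subgroup[OF assms(2) k])
  have "f ` carrier A \<subseteq> kernel B C g" using gf f.hom_closed by (auto simp: kernel_def)
  then show 2: "subgroup (f ` carrier A) (B\<lparr>carrier := kernel B C g\<rparr>)"
    using B.subgroup_incl[OF f.img_is_subgroup k] by simp
  show "comm_group (homology_at A f B g C)"
    unfolding homology_at_def by (rule comm_group.abelian_FactGroup[OF 1 2])
qed

lemma (in spectral_sequence) stable_iso:
  assumes "stable_from E d r p q"
  shows "E (r + k) p q \<cong> E r p q"
proof (induction k)
  case (Suc k)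
  let ?s = "r + k"
  have grp: "group (E s p' q')" for s p' q' using abelian comm_group_def by blast
  have "E (Suc ?s) p q \<cong> homology_at (E ?s (p - int ?s) (q + int ?s - 1)) (d ?s (p - int ?s) (q + int ?s - 1))
        (E ?s p q) (d ?s p q) (E ?s (p + int ?s) (q - int ?s + 1))" by (rule turn_page)
  also have "\<dots> \<cong> E ?s p q"
  proof (rule homology_at_zero_maps[OF grp])
    show "carrier (E ?s (p - int ?s) (q + int ?s - 1)) \<noteq> {}" using grp monoid.one_closed group.is_monoid by fastforce
    show "d ?s (p - int ?s) (q + int ?s - 1) x = \<one>\<^bsub>E ?s p q\<^esub>" if "x \<in> carrier (E ?s (p - int ?s) (q + int ?s - 1))" for x
      using assms that le_add1[of r k] unfolding stable_from_def by blast
    show "d ?s p q x = \<one>\<^bsub>E ?s (p + int ?s) (q - int ?s + 1)\<^esub>" if "x \<in> carrier (E ?s p q)" for x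
      using assms that le_add1[of r k] unfolding stable_from_def by blast
  qed
  finally show ?case using Suc iso_trans by auto
qed (simp add: iso_refl)

text \<open>Page 0 repeats page 1, with zero differentials.\<close>

definition row_page :: "(int \<Rightarrow> 'a monoid) \<Rightarrow> (int \<Rightarrow> 'a monoid) \<Rightarrow> nat \<Rightarrow> int \<Rightarrow> int \<Rightarrow> 'a monoid" where
  "row_page A H r p q = (if q \<noteq> 0 then singleton_group undefined else if r \<le> 1 then A p else H p)"

definition row_diff ::
    "(int \<Rightarrow> 'a monoid) \<Rightarrow> (int \<Rightarrow> 'a monoid) \<Rightarrow> (int \<Rightarrow> 'a \<Rightarrow> 'a) \<Rightarrow> nat \<Rightarrow> int \<Rightarrow> int \<Rightarrow> 'a \<Rightarrow> 'a" where
  "row_diff A H bd r p q x = (if r = 1 \<and> q = 0 then bd p x else \<one>\<^bsub>row_page A H r (p + int r) (q - int r + 1)\<^esub>)"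

text \<open>\<open>H\<close> is only required to be isomorphic to the homology of \<open>A\<close>,
  because it will be the homology of another complex, of which \<open>A\<close> is a
  quotient.\<close>

locale row_complex =
  fixes A H :: "int \<Rightarrow> 'a monoid" and bd :: "int \<Rightarrow> 'a \<Rightarrow> 'a"
  assumes A: "comm_group (A p)" and H: "comm_group (H p)"
    and hom: "bd p \<in> hom (A p) (A (p + 1))"
    and square: "x \<in> carrier (A p) \<Longrightarrow> bd (p + 1) (bd p x) = \<one>\<^bsub>A (p + 1 + 1)\<^esub>"
    and homology: "H p \<cong> homology_at (A (p - 1)) (bd (p - 1)) (A p) (bd p) (A (p + 1))"
begin

abbreviation "E \<equiv> row_page A H"
abbreviation "d \<equiv> row_diff A H bd"

lemma page_comm: "comm_group (E r p q)"
  using A H by (simp add: row_page_def)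

lemma page_group: "group (E r p q)"
  using page_comm comm_group_def by blast

lemma page_nonempty: "carrier (E r p q) \<noteq> {}"
  using page_group group.is_monoid monoid.one_closed by fastforce

lemma page_one: "\<one>\<^bsub>E r p q\<^esub> \<in> carrier (E r p q)"
  using page_group group.is_monoid monoid.one_closed by fastforce

lemma diff_one:
  assumes "x = \<one>\<^bsub>E r p q\<^esub>"
  shows "d r p q x = \<one>\<^bsub>E r (p + int r) (q - int r + 1)\<^esub>"
proof (cases "r = 1 \<and> q = 0")
  case True
  have "bd p \<one>\<^bsub>A p\<^esub> = \<one>\<^bsub>A (p + 1)\<^esub>" using hom_one[OF hom] A comm_group_def by blast
  then show ?thesis using True assms by (simp add: row_diff_def row_page_def)
qed (auto simp: row_diff_def)

text \<open>A differential of bidegree \<open>(r, 1 - r)\<close> stays in the row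
  \<open>q = 0\<close> only on page 1. Everywhere else it is zero and the next page is isomorphic to
  the present one.\<close>

lemma spectral: "spectral_sequence E d"
proof (rule spectral_sequence.intro)
  fix r :: nat and p q :: int
  show "comm_group (E r p q)" by (rule page_comm)
  show "d r p q \<in> hom (E r p q) (E r (p + int r) (q - int r + 1))"
  proof (cases "r = 1 \<and> q = 0")
    case True
    then have "d r p q = bd p" "E r p q = A p" "E r (p + int r) (q - int r + 1) = A (p + 1)"
      by (auto simp: row_diff_def row_page_def)
    then show ?thesis using hom by simp
  next
    case False
    let ?X = "E r (p + int r) (q - int r + 1)"
    have "\<one>\<^bsub>?X\<^esub> \<otimes>\<^bsub>?X\<^esub> \<one>\<^bsub>?X\<^esub> = \<one>\<^bsub>?X\<^esub>" using page_group group.is_monoid monoid.l_one page_one by metis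
    then show ?thesis using False page_one by (auto simp: hom_def row_diff_def)
  qed
next
  fix x :: 'a and r :: nat and p q :: int
  assume x: "x \<in> carrier (E r p q)"
  show "d r (p + int r) (q - int r + 1) (d r p q x) = \<one>\<^bsub>E r (p + int r + int r) (q - int r + 1 - int r + 1)\<^esub>"
  proof (cases "r = 1 \<and> q = 0")
    case True
    then show ?thesis using square x by (simp add: row_diff_def row_page_def)
  next
    case False
    then have "d r p q x = \<one>\<^bsub>E r (p + int r) (q - int r + 1)\<^esub>" by (auto simp: row_diff_def)
    then show ?thesis by (rule diff_one)
  qed
next
  fix r :: nat and p q :: int
  let ?H = "homology_at (E r (p - int r) (q + int r - 1)) (d r (p - int r) (q + int r - 1))
        (E r p q) (d r p q) (E r (p + int r) (q - int r + 1))"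
  show "E (Suc r) p q \<cong> ?H"
  proof (cases "r = 1 \<and> q = 0")
    case True
    have "d 1 p' 0 = bd p'" "E 1 p' 0 = A p'" for p' by (auto simp: row_diff_def row_page_def)
    then show ?thesis using True homology by (simp add: row_page_def)
  next
    case False
    have "d r (p - int r) (q + int r - 1) x = \<one>\<^bsub>E r p q\<^esub>" for x
      using False by (auto simp: row_diff_def)
    moreover have "d r p q x = \<one>\<^bsub>E r (p + int r) (q - int r + 1)\<^esub>" for x
      using False by (auto simp: row_diff_def)
    ultimately have iso: "?H \<cong> E r p q" by (intro homology_at_zero_maps page_group page_nonempty)
    have "E (Suc r) p q = E r p q" using False by (auto simp: row_page_def)
    moreover have "group ?H"
    proof -
      have "d r p q \<in> hom (E r p q) (E r (p + int r) (q - int r + 1))"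
        "d r (p - int r) (q + int r - 1) \<in> hom (E r (p - int r) (q + int r - 1)) (E r p q)"
      proof -
        have *: "(\<lambda>_. \<one>\<^bsub>Y\<^esub>) \<in> hom X Y" if "group Y" for X Y :: "'a monoid"
          using that by (auto simp: hom_def group.is_monoid monoid.one_closed monoid.l_one)
        have "d r p q = (\<lambda>_. \<one>\<^bsub>E r (p + int r) (q - int r + 1)\<^esub>)"
          "d r (p - int r) (q + int r - 1) = (\<lambda>_. \<one>\<^bsub>E r p q\<^esub>)"
          using False by (auto simp: row_diff_def fun_eq_iff)
        then show "d r p q \<in> hom (E r p q) (E r (p + int r) (q - int r + 1))"
          "d r (p - int r) (q + int r - 1) \<in> hom (E r (p - int r) (q + int r - 1)) (E r p q)"
          using * page_group by metis+
      qed
      moreover have "d r p q (d r (p - int r) (q + int r - 1) x) = \<one>\<^bsub>E r (p + int r) (q - int r + 1)\<^esub>" for x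
        using False by (auto simp: row_diff_def)
      ultimately show ?thesis
        using homology_at_group(3) page_group page_comm comm_group_def by blast
    qed
    ultimately show ?thesis using group.iso_sym iso by metis
  qed
qed

lemma stable_2: "stable_from E d 2 p q"
  by (auto simp: stable_from_def row_diff_def)

lemma collapses_2: "collapses_at E d 2"
  using stable_2 by (simp add: collapses_at_def)

text \<open>For diagrams with at most one crossing, where page 2 exceeds the bound on
  \<open>r\<close>.\<close>

lemma collapses_0:
  assumes "\<And>p x. x \<in> carrier (A p) \<Longrightarrow> bd p x = \<one>\<^bsub>A (p + 1)\<^esub>"
  shows "collapses_at E d 0"
proof -
  have "d s p q x = \<one>\<^bsub>E s (p + int s) (q - int s + 1)\<^esub>" if "x \<in> carrier (E s p q)" for s p q x
    using that assms by (auto simp: row_diff_def row_page_def)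
  moreover from this[where p = "p - int s" and q = "q + int s - 1" for p q s]
  have "d s (p - int s) (q + int s - 1) x = \<one>\<^bsub>E s p q\<^esub>" if "x \<in> carrier (E s (p - int s) (q + int s - 1))" for s p q x
    using that by simp
  ultimately show ?thesis by (auto simp: collapses_at_def stable_from_def)
qed

lemma E_infinity: "E 2 p q \<cong> E_infinity E d p q"
proof -
  \<comment> \<open>\<open>E_infinity\<close> is taken at the least stable page, which may be lower
    than 2; stable pages at one position are isomorphic.\<close>
  define r where "r = (LEAST r. stable_from E d r p q)"
  have st: "stable_from E d r p q" and "r \<le> 2"
    unfolding r_def using stable_2 by (rule LeastI, rule Least_le)
  then obtain k where "2 = r + k" using le_Suc_ex by blast
  then show ?thesis
    using spectral_sequence.stable_iso[OF spectral st, of k] by (simp add: E_infinity_def r_def)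
qed

lemma converges: "converges_to E d H"
proof -
  \<comment> \<open>All of \<open>H n\<close> comes from the position \<open>(n, 0)\<close>, so the
    filtration has a single jump, from \<open>p = n\<close> to \<open>p = n + 1\<close>.\<close>
  define F where "F n p = (if p \<le> n then carrier (H n) else {\<one>\<^bsub>H n\<^esub>})" for n p
  have gH: "group (H n)" for n using H comm_group_def by blast
  have sub: "subgroup (F n p) (H n)" for n p
    using group.subgroup_self[OF gH] group.triv_subgroup[OF gH] by (simp add: F_def)
  have E: "E_infinity E d p q \<cong> (H (p + q))\<lparr>carrier := F (p + q) p\<rparr> Mod F (p + q) (p + 1)" (is "_ \<cong> ?G") for p q
  proof -
    have gE: "group (E_infinity E d p q)" using page_group by (simp add: E_infinity_def)
    have "E 2 p q \<cong> ?G"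
    proof (cases "q = 0")
      case True
      have "group (H p Mod {\<one>\<^bsub>H p\<^esub>})"
        using comm_group.abelian_FactGroup[OF H group.triv_subgroup[OF gH]] comm_group_def by blast
      then show ?thesis
        using group.iso_sym mod_one_iso[OF gH, of p] mod_one_iso[OF gH, of p] True
        by (simp add: row_page_def F_def group.iso_sym)
    next
      case False
      let ?K = "(H (p + q))\<lparr>carrier := F (p + q) p\<rparr>"
      have cK: "comm_group ?K" by (rule comm_group_subgroup[OF H sub])
      have "F (p + q) (p + 1) = carrier ?K" using False by (auto simp: F_def)
      then have "trivial_group ?G" using mod_self_trivial[OF cK] by simp
      moreover have "trivial_group (E 2 p q)" using False by (simp add: row_page_def)
      ultimately show ?thesis by (rule trivial_groups_iso[rotated])
    qed
    then show ?thesis using E_infinity[of p q] group.iso_sym[OF page_group] iso_trans by blast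
  qed
  show ?thesis unfolding converges_to_def
  proof (intro conjI allI exI[of _ F])
    show "\<exists>r. stable_from E d r p q" for p q using stable_2 by blast
    show "subgroup (F n p) (H n)" for n p by (rule sub)
    show "F n (p + 1) \<subseteq> F n p" for n p
      using gH[of n] by (auto simp: F_def group.is_monoid monoid.one_closed)
    show "\<exists>p. F n p = carrier (H n)" for n by (rule exI[of _ n]) (simp add: F_def)
    show "\<exists>p. F n p = {\<one>\<^bsub>H n\<^esub>}" for n by (rule exI[of _ "n + 1"]) (simp add: F_def)
  qed (rule E)
qed

end

section \<open>Complexes with an acyclic matching\<close>

lemma iso_from_surjective_hom:
  assumes "group G" "group H" "h \<in> hom G H" "h ` carrier G = carrier H" "kernel G H h = N"
  shows "G Mod N \<cong> H"
proof -
  interpret group_hom G H h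
    using assms by (simp add: group_hom_def group_hom_axioms_def)
  show ?thesis using FactGroup_iso assms by simp
qed

lemma coset_eq_iff:
  assumes "group G" "subgroup N G" "x \<in> carrier G" "y \<in> carrier G"
  shows "N #>\<^bsub>G\<^esub> x = N #>\<^bsub>G\<^esub> y \<longleftrightarrow> x \<otimes>\<^bsub>G\<^esub> inv\<^bsub>G\<^esub> y \<in> N"
proof -
  interpret group G by fact
  have "N #>\<^bsub>G\<^esub> x = N #>\<^bsub>G\<^esub> y \<longleftrightarrow> x \<in> N #>\<^bsub>G\<^esub> y"
    using assms repr_independence[of x N y] rcos_self[of x N] by blast
  also have "\<dots> \<longleftrightarrow> x \<otimes>\<^bsub>G\<^esub> inv\<^bsub>G\<^esub> y \<in> N"
    using subgroup.rcos_module[OF assms(2) is_group assms(4,3)] by blast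
  finally show ?thesis .
qed

text \<open>A based complex with a matching of some basis elements, the sources, with others, the targets.
  The matrix of the differential from sources to targets is unitriangular up to signs.
  So the sources and their boundaries span a contractible subcomplex with a complement spanned by
  the critical elements.\<close>

locale matched_complex =
  fixes X :: "int \<Rightarrow> 'a set" and f :: "'a \<Rightarrow> ('a \<Rightarrow>\<^sub>0 int)" and A B K :: "'a set"
    and mate :: "'a \<Rightarrow> 'a" and rank :: "'a \<Rightarrow> nat"
  assumes finite_X: "finite (X i)"
    and keys_f: "s \<in> X i \<Longrightarrow> Poly_Mapping.keys (f s) \<subseteq> X (i + 1)"
    and square: "Poly_Mapping.keys x \<subseteq> X i \<Longrightarrow> frag_extend f (frag_extend f x) = 0"
    and cover: "X i \<subseteq> A \<union> B \<union> K"
    and disjoint: "A \<inter> B = {}" "A \<inter> K = {}" "B \<inter> K = {}"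
    and mate_in: "s \<in> A \<Longrightarrow> s \<in> X i \<Longrightarrow> mate s \<in> B \<and> mate s \<in> X (i + 1)"
    and mate_onto: "t \<in> B \<Longrightarrow> t \<in> X (i + 1) \<Longrightarrow> \<exists>s. s \<in> A \<and> s \<in> X i \<and> mate s = t"
    and coeff_mate: "s \<in> A \<Longrightarrow> s \<in> X i \<Longrightarrow> \<bar>Poly_Mapping.lookup (f s) (mate s)\<bar> = 1"
    and coeff_rank: "s \<in> A \<Longrightarrow> s \<in> X i \<Longrightarrow> s' \<in> A \<Longrightarrow> s' \<in> X i \<Longrightarrow> s \<noteq> s' \<Longrightarrow>
      Poly_Mapping.lookup (f s) (mate s') \<noteq> 0 \<Longrightarrow> rank s < rank s'"
begin

abbreviation "bd \<equiv> frag_extend f"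
abbreviation "chain_group i \<equiv> free_Abelian_group (X i)"

lemma keys_bd: "Poly_Mapping.keys x \<subseteq> X i \<Longrightarrow> Poly_Mapping.keys (bd x) \<subseteq> X (i + 1)"
  using keys_frag_extend[of f x] keys_f by blast

lemma keys_bd_minus: "Poly_Mapping.keys x \<subseteq> X (i - 1) \<Longrightarrow> Poly_Mapping.keys (bd x) \<subseteq> X i"
  using keys_bd[of x "i - 1"] by simp

lemma keys_diff_subset: "Poly_Mapping.keys x \<subseteq> Y \<Longrightarrow> Poly_Mapping.keys y \<subseteq> Y \<Longrightarrow> Poly_Mapping.keys (x - y) \<subseteq> Y"
  using keys_diff[of x y] by blast

lemma keys_add_subset: "Poly_Mapping.keys x \<subseteq> Y \<Longrightarrow> Poly_Mapping.keys y \<subseteq> Y \<Longrightarrow> Poly_Mapping.keys (x + y) \<subseteq> Y"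
  using keys_add[of x y] by blast

text \<open>For a source \<open>s\<close> of least rank in \<open>a'\<close> no other source of
  \<open>a'\<close> contributes to the coefficient of \<open>bd a'\<close> at \<open>mate s\<close>.
  This coefficient is therefore nonzero, although \<open>c\<close> contains no targets.\<close>

lemma source_independent:
  assumes a': "Poly_Mapping.keys a' \<subseteq> A \<inter> X i" and c: "Poly_Mapping.keys c \<subseteq> A \<union> K" and eq: "bd a' = c"
  shows "a' = 0"
proof (rule ccontr)
  assume "a' \<noteq> 0"
  then have "Poly_Mapping.keys a' \<noteq> {}" by simp
  then obtain s where s: "s \<in> Poly_Mapping.keys a'" and min: "\<And>t. t \<in> Poly_Mapping.keys a' \<Longrightarrow> rank s \<le> rank t"
    using ex_min_if_finite[of "rank ` Poly_Mapping.keys a'"] by (metis (no_types, lifting) finite_imageI finite_keys image_iff image_is_empty not_less)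
  have sA: "s \<in> A" "s \<in> X i" using s a' by auto
  have z: "Poly_Mapping.lookup (f t) (mate s) = 0" if "t \<in> Poly_Mapping.keys a' - {s}" for t
    using coeff_rank[of t i s] min[of t] that sA a' by fastforce
  have "Poly_Mapping.lookup (bd a') (mate s) = (\<Sum>t\<in>Poly_Mapping.keys a'. Poly_Mapping.lookup a' t * Poly_Mapping.lookup (f t) (mate s))"
    by (simp add: frag_extend_def lookup_sum)
  also have "\<dots> = Poly_Mapping.lookup a' s * Poly_Mapping.lookup (f s) (mate s)
      + (\<Sum>t\<in>Poly_Mapping.keys a' - {s}. Poly_Mapping.lookup a' t * Poly_Mapping.lookup (f t) (mate s))"
    by (rule sum.remove) (use s in auto)
  also have "\<dots> = Poly_Mapping.lookup a' s * Poly_Mapping.lookup (f s) (mate s)"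
    using z by simp
  also have "\<dots> \<noteq> 0" using s coeff_mate[OF sA] by (auto simp: in_keys_iff)
  finally have "mate s \<in> Poly_Mapping.keys c" using eq by (simp add: in_keys_iff)
  then show False using c mate_in[OF sA] disjoint by blast
qed

section \<open>The chain groups as sums of sources, boundaries of sources and critical
  elements\<close>

definition splits :: "int \<Rightarrow> ('a \<Rightarrow>\<^sub>0 int) \<Rightarrow> bool" where
  "splits i x \<longleftrightarrow> (\<exists>a a' k. Poly_Mapping.keys a \<subseteq> A \<inter> X i \<and> Poly_Mapping.keys a' \<subseteq> A \<inter> X (i - 1)
     \<and> Poly_Mapping.keys k \<subseteq> K \<inter> X i \<and> x = a + bd a' + k)"

lemma split_diff:
  assumes "splits i x" "splits i y"
  shows "splits i (x - y)"
proof -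
  obtain a a' k where 1: "Poly_Mapping.keys a \<subseteq> A \<inter> X i" "Poly_Mapping.keys a' \<subseteq> A \<inter> X (i - 1)"
    "Poly_Mapping.keys k \<subseteq> K \<inter> X i" "x = a + bd a' + k"
    using assms(1) unfolding splits_def by blast
  obtain e e' h where 2: "Poly_Mapping.keys e \<subseteq> A \<inter> X i" "Poly_Mapping.keys e' \<subseteq> A \<inter> X (i - 1)"
    "Poly_Mapping.keys h \<subseteq> K \<inter> X i" "y = e + bd e' + h"
    using assms(2) unfolding splits_def by blast
  have "x - y = (a - e) + bd (a' - e') + (k - h)"
    by (simp add: 1 2 frag_extend_diff algebra_simps)
  then show ?thesis unfolding splits_def
    using keys_diff_subset[OF 1(1) 2(1)] keys_diff_subset[OF 1(2) 2(2)] keys_diff_subset[OF 1(3) 2(3)] by blast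
qed

lemma split_zero: "splits i 0"
  unfolding splits_def by (intro exI[of _ 0]) simp

lemma split_keys:
  assumes "\<And>s. s \<in> Poly_Mapping.keys x \<Longrightarrow> splits i (frag_of s)"
  shows "splits i x"
proof -
  have "Poly_Mapping.keys x \<subseteq> {s. splits i (frag_of s)}" using assms by blast
  then show ?thesis
  proof (induction x rule: frag_induction)
    case (diff a b) then show ?case by (simp add: split_diff)
  qed (simp_all add: split_zero)
qed

lemma split_cmul: "splits i x \<Longrightarrow> splits i (frag_cmul k x)"
  by (rule frag_closure_minus_cmul) (simp_all add: split_diff split_zero)

lemma split_critical: "s \<in> (A \<union> K) \<inter> X i \<Longrightarrow> splits i (frag_of s)"
proof -
  assume "s \<in> (A \<union> K) \<inter> X i"
  then have "s \<in> A \<inter> X i \<or> s \<in> K \<inter> X i" by blast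
  moreover have "frag_of s = frag_of s + bd 0 + 0" "frag_of s = 0 + bd 0 + frag_of s" by simp_all
  ultimately show ?thesis unfolding splits_def by (metis empty_subsetI insert_subset keys_frag_of keys_zero)
qed

text \<open>Up to sign, \<open>mate s\<close> is the boundary of \<open>s\<close> minus a remainder
  whose targets have mates of higher rank. Ranks are bounded on a finite basis, so the induction
  runs downwards.\<close>

lemma split_target:
  assumes "s \<in> A" "s \<in> X (i - 1)"
  shows "splits i (frag_of (mate s))"
proof -
  define M where "M = Max (rank ` X (i - 1))"
  have bound: "rank t \<le> M" if "t \<in> X (i - 1)" for t
    unfolding M_def using finite_X that by auto
  show ?thesis
    using assms
  proof (induction "M - rank s" arbitrary: s rule: less_induct)
    case less
    let ?t = "mate s" and ?e = "Poly_Mapping.lookup (f s) (mate s)"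
    have e: "?e * ?e = 1" using coeff_mate[OF less.prems] by (cases "?e \<ge> 0") auto
    define r where "r = f s - frag_cmul ?e (frag_of ?t)"
    have rt: "Poly_Mapping.lookup r ?t = 0" by (simp add: r_def lookup_minus)
    have kf: "Poly_Mapping.keys (f s) \<subseteq> X i" using keys_f[OF less.prems(2)] by simp
    have tX: "?t \<in> X i" using mate_in[OF less.prems] by simp
    have "Poly_Mapping.keys (frag_cmul ?e (frag_of ?t)) \<subseteq> X i" using tX by auto
    then have kr: "Poly_Mapping.keys r \<subseteq> X i" unfolding r_def by (rule keys_diff_subset[OF kf])
    have "splits i (frag_of u)" if u: "u \<in> Poly_Mapping.keys r" for u
    proof (cases "u \<in> B")
      case False
      then show ?thesis using u kr cover split_critical by blast
    next
      case True
      have uX: "u \<in> X (i - 1 + 1)" using u kr by auto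
      then obtain s' where s': "s' \<in> A" "s' \<in> X (i - 1)" "mate s' = u" using mate_onto[OF True] by blast
      have ut: "u \<noteq> ?t" using u rt by (auto simp: in_keys_iff)
      then have "Poly_Mapping.lookup (f s) u \<noteq> 0"
        using u unfolding in_keys_iff r_def by (simp add: lookup_minus)
      then have "rank s < rank s'" using coeff_rank[OF less.prems s'(1,2)] s' ut by auto
      then have "M - rank s' < M - rank s" using bound[OF s'(2)] by simp
      then show ?thesis using less.hyps s' by blast
    qed
    then have sr: "splits i r" by (rule split_keys)
    have "Poly_Mapping.keys (frag_of s) \<subseteq> A \<inter> X (i - 1)" using less.prems by simp
    moreover have "f s = 0 + bd (frag_of s) + 0" by simp
    ultimately have "splits i (f s)" unfolding splits_def by (metis empty_subsetI keys_zero)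
    then have "splits i (frag_cmul ?e (f s - r))" using split_cmul split_diff sr by blast
    moreover have "frag_cmul ?e (f s - r) = frag_of ?t" unfolding r_def using e by simp
    ultimately show ?case by simp
  qed
qed

lemma split_all:
  assumes "Poly_Mapping.keys x \<subseteq> X i"
  shows "splits i x"
proof (rule split_keys)
  fix s assume "s \<in> Poly_Mapping.keys x"
  then have s: "s \<in> X i" using assms by blast
  show "splits i (frag_of s)"
  proof (cases "s \<in> B")
    case True
    then obtain s' where "s' \<in> A" "s' \<in> X (i - 1)" "mate s' = s" using mate_onto[of s "i - 1"] s by auto
    then show ?thesis using split_target by blast
  next
    case False
    then show ?thesis using s cover split_critical by blast
  qed
qed

definition null :: "int \<Rightarrow> ('a \<Rightarrow>\<^sub>0 int) set" where
  "null i = {a + bd a' | a a'. Poly_Mapping.keys a \<subseteq> A \<inter> X i \<and> Poly_Mapping.keys a' \<subseteq> A \<inter> X (i - 1)}"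

lemma null_split: "splits i x \<longleftrightarrow> (\<exists>z\<in>null i. \<exists>k. Poly_Mapping.keys k \<subseteq> K \<inter> X i \<and> x = z + k)"
  unfolding splits_def null_def by blast

lemma null_keys: "x \<in> null i \<Longrightarrow> Poly_Mapping.keys x \<subseteq> X i"
proof -
  assume "x \<in> null i"
  then obtain a a' where "Poly_Mapping.keys a \<subseteq> X i" "Poly_Mapping.keys a' \<subseteq> X (i - 1)" "x = a + bd a'"
    unfolding null_def by blast
  then show ?thesis using keys_add_subset[of a "X i" "bd a'"] keys_bd_minus[of a' i] by simp
qed

lemma null_diff: "x \<in> null i \<Longrightarrow> y \<in> null i \<Longrightarrow> x - y \<in> null i"
proof -
  assume "x \<in> null i" "y \<in> null i"
  then obtain a a' e e' where 1: "Poly_Mapping.keys a \<subseteq> A \<inter> X i" "Poly_Mapping.keys a' \<subseteq> A \<inter> X (i - 1)" "x = a + bd a'"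
    "Poly_Mapping.keys e \<subseteq> A \<inter> X i" "Poly_Mapping.keys e' \<subseteq> A \<inter> X (i - 1)" "y = e + bd e'"
    unfolding null_def by blast
  then have "x - y = (a - e) + bd (a' - e')" by (simp add: frag_extend_diff)
  then show ?thesis unfolding null_def using keys_diff_subset[OF 1(1,4)] keys_diff_subset[OF 1(2,5)] by blast
qed

lemma null_zero: "0 \<in> null i"
proof -
  have "0 = (0 :: 'a \<Rightarrow>\<^sub>0 int) + bd 0" by simp
  then show ?thesis unfolding null_def by (metis (mono_tags, lifting) empty_subsetI keys_zero mem_Collect_eq)
qed

lemma null_subgroup: "subgroup (null i) (chain_group i)"
proof
  show "null i \<subseteq> carrier (chain_group i)" using null_keys by auto
  show "x \<otimes>\<^bsub>chain_group i\<^esub> y \<in> null i" if "x \<in> null i" "y \<in> null i" for x y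
    using null_diff[OF that(1) null_diff[OF null_zero that(2)]] by simp
  show "\<one>\<^bsub>chain_group i\<^esub> \<in> null i" using null_zero by simp
  show "inv\<^bsub>chain_group i\<^esub> x \<in> null i" if "x \<in> null i" for x
    using null_diff[OF null_zero that] null_keys[OF that] by simp
qed

lemma null_critical:
  assumes "x \<in> null i" "Poly_Mapping.keys x \<subseteq> K \<inter> X i"
  shows "x = 0"
proof -
  obtain a a' where a: "Poly_Mapping.keys a \<subseteq> A \<inter> X i" "Poly_Mapping.keys a' \<subseteq> A \<inter> X (i - 1)" "x = a + bd a'"
    using assms(1) unfolding null_def by blast
  have "bd a' = x - a" using a by simp
  moreover have "Poly_Mapping.keys (x - a) \<subseteq> A \<union> K"
    by (rule keys_diff_subset) (use assms a in blast)+
  ultimately have "a' = 0" using source_independent[OF a(2)] by blast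
  then have "x = a" using a by simp
  then have "Poly_Mapping.keys x = {}" using a(1) assms(2) disjoint by blast
  then show ?thesis by simp
qed

text \<open>A cycle of the subcomplex is a boundary: the source part of \<open>x\<close> is itself a
  cycle and vanishes by \<open>source_independent\<close>.\<close>

lemma null_cycle:
  assumes "x \<in> null i" "bd x = 0"
  shows "\<exists>a'. Poly_Mapping.keys a' \<subseteq> X (i - 1) \<and> x = bd a'"
proof -
  obtain a a' where a: "Poly_Mapping.keys a \<subseteq> A \<inter> X i" "Poly_Mapping.keys a' \<subseteq> A \<inter> X (i - 1)" "x = a + bd a'"
    using assms(1) unfolding null_def by blast
  have "bd (bd a') = 0" using square[of a' "i - 1"] a(2) by blast
  then have "bd a = 0" using assms(2) a(3) by (simp add: frag_extend_add)
  then have "a = 0" using source_independent[OF a(1), of 0] by simp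
  then show ?thesis using a by auto
qed

lemma bd_null:
  assumes "x \<in> null i"
  shows "bd x \<in> null (i + 1)"
proof -
  obtain a a' where a: "Poly_Mapping.keys a \<subseteq> A \<inter> X i" "Poly_Mapping.keys a' \<subseteq> A \<inter> X (i - 1)" "x = a + bd a'"
    using assms(1) unfolding null_def by blast
  have "bd (bd a') = 0" using square[of a' "i - 1"] a(2) by blast
  then have "bd x = 0 + bd a" using a(3) by (simp add: frag_extend_add)
  moreover have "Poly_Mapping.keys a \<subseteq> A \<inter> X (i + 1 - 1)" using a(1) by simp
  moreover have "Poly_Mapping.keys (0 :: 'a \<Rightarrow>\<^sub>0 int) \<subseteq> A \<inter> X (i + 1)" by simp
  ultimately show ?thesis unfolding null_def by blast
qed

text \<open>A cycle of the quotient lifts to a cycle: its boundary lies in the subcomplex, is a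
  cycle there, hence \<open>bd a'\<close> for a chain \<open>a'\<close> of sources that can be
  subtracted.\<close>

lemma bd_null_exact:
  assumes "Poly_Mapping.keys x \<subseteq> X i" "bd x \<in> null (i + 1)"
  shows "\<exists>z\<in>null i. bd (x - z) = 0"
proof -
  obtain a a' where a: "Poly_Mapping.keys a \<subseteq> A \<inter> X (i + 1)" "Poly_Mapping.keys a' \<subseteq> A \<inter> X i" "bd x = a + bd a'"
    using assms(2) unfolding null_def by auto
  have "bd (bd a') = 0" "bd (bd x) = 0" using square[of a' i] square[of x i] a(2) assms(1) by blast+
  then have "bd a = 0" using a(3) by (simp add: frag_extend_add)
  then have "a = 0" using source_independent[OF a(1), of 0] by simp
  then have "bd (x - a') = 0" using a(3) by (simp add: frag_extend_diff)
  moreover have "a' + bd 0 \<in> null i" unfolding null_def using a(2) by (metis (mono_tags, lifting) empty_subsetI keys_zero mem_Collect_eq)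
  ultimately show ?thesis by auto
qed

section \<open>The quotient complex and its homology\<close>

definition reduced :: "int \<Rightarrow> ('a \<Rightarrow>\<^sub>0 int) set monoid" where
  "reduced i = chain_group i Mod null i"

definition cls :: "int \<Rightarrow> ('a \<Rightarrow>\<^sub>0 int) \<Rightarrow> ('a \<Rightarrow>\<^sub>0 int) set" where
  "cls i x = null i #>\<^bsub>chain_group i\<^esub> x"

text \<open>Defined by a chosen representative; \<open>bd_null\<close> makes the result independent
  of the choice.\<close>

definition reduced_bd :: "int \<Rightarrow> ('a \<Rightarrow>\<^sub>0 int) set \<Rightarrow> ('a \<Rightarrow>\<^sub>0 int) set" where
  "reduced_bd i U = cls (i + 1) (bd (SOME x. Poly_Mapping.keys x \<subseteq> X i \<and> cls i x = U))"

lemma cls_eq: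
  assumes "Poly_Mapping.keys x \<subseteq> X i" "Poly_Mapping.keys y \<subseteq> X i"
  shows "cls i x = cls i y \<longleftrightarrow> x - y \<in> null i"
  unfolding cls_def using coset_eq_iff[OF group_free_Abelian_group null_subgroup, of x i y] assms by simp

lemma null_normal: "null i \<lhd> chain_group i"
  by (rule comm_group.subgroup_imp_normal[OF abelian_free_Abelian_group null_subgroup])

lemma reduced_comm: "comm_group (reduced i)"
  unfolding reduced_def by (rule comm_group.abelian_FactGroup[OF abelian_free_Abelian_group null_subgroup])

lemma reduced_group: "group (reduced i)"
  using reduced_comm comm_group_def by blast

lemma cls_hom: "cls i \<in> hom (chain_group i) (reduced i)"
  unfolding cls_def reduced_def using normal.r_coset_hom_Mod[OF null_normal] by blast

lemma reduced_carrier: "carrier (reduced i) = cls i ` carrier (chain_group i)"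
  unfolding reduced_def carrier_FactGroup cls_def ..

lemma reduced_one: "\<one>\<^bsub>reduced i\<^esub> = cls i 0"
  using hom_one[OF cls_hom group_free_Abelian_group reduced_group] by simp

lemma cls_one:
  assumes "Poly_Mapping.keys x \<subseteq> X i"
  shows "cls i x = \<one>\<^bsub>reduced i\<^esub> \<longleftrightarrow> x \<in> null i"
  using cls_eq[OF assms, of 0] by (simp add: reduced_one)

lemma reduced_bd_cls:
  assumes "Poly_Mapping.keys x \<subseteq> X i"
  shows "reduced_bd i (cls i x) = cls (i + 1) (bd x)"
proof -
  define y where "y = (SOME y. Poly_Mapping.keys y \<subseteq> X i \<and> cls i y = cls i x)"
  have y: "Poly_Mapping.keys y \<subseteq> X i" "cls i y = cls i x"
    using someI[of "\<lambda>y. Poly_Mapping.keys y \<subseteq> X i \<and> cls i y = cls i x" x] assms unfolding y_def by auto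
  then have "bd (y - x) \<in> null (i + 1)" using cls_eq assms bd_null by blast
  then show ?thesis unfolding reduced_bd_def y_def[symmetric]
    using cls_eq keys_bd y assms by (metis frag_extend_diff)
qed

lemma reduced_bd_hom: "reduced_bd i \<in> hom (reduced i) (reduced (i + 1))"
proof (rule homI)
  fix U assume "U \<in> carrier (reduced i)"
  then obtain x where x: "Poly_Mapping.keys x \<subseteq> X i" "U = cls i x" by (auto simp: reduced_carrier)
  then show "reduced_bd i U \<in> carrier (reduced (i + 1))"
    using reduced_bd_cls keys_bd by (auto simp: reduced_carrier)
next
  fix U V assume "U \<in> carrier (reduced i)" "V \<in> carrier (reduced i)"
  then obtain x y where x: "Poly_Mapping.keys x \<subseteq> X i" "U = cls i x" and y: "Poly_Mapping.keys y \<subseteq> X i" "V = cls i y"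
    by (auto simp: reduced_carrier)
  have add: "cls j (v + w) = cls j v \<otimes>\<^bsub>reduced j\<^esub> cls j w"
    if "Poly_Mapping.keys v \<subseteq> X j" "Poly_Mapping.keys w \<subseteq> X j" for v w j
    using hom_mult[OF cls_hom, of v j w] that by simp
  show "reduced_bd i (U \<otimes>\<^bsub>reduced i\<^esub> V) = reduced_bd i U \<otimes>\<^bsub>reduced (i + 1)\<^esub> reduced_bd i V"
    unfolding x y add[OF x(1) y(1), symmetric]
    using reduced_bd_cls[OF x(1)] reduced_bd_cls[OF y(1)] reduced_bd_cls[OF keys_add_subset[OF x(1) y(1)]]
      add[OF keys_bd[OF x(1)] keys_bd[OF y(1)]] by (simp add: frag_extend_add)
qed

lemma reduced_bd_square:
  assumes "U \<in> carrier (reduced i)"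
  shows "reduced_bd (i + 1) (reduced_bd i U) = \<one>\<^bsub>reduced (i + 1 + 1)\<^esub>"
proof -
  obtain x where x: "Poly_Mapping.keys x \<subseteq> X i" "U = cls i x" using assms by (auto simp: reduced_carrier)
  then show ?thesis using reduced_bd_cls keys_bd square by (simp add: reduced_one)
qed

lemma bd_hom: "bd \<in> hom (chain_group i) (chain_group (i + 1))"
  using keys_bd by (auto simp: hom_def frag_extend_add)

lemma bd_hom': "bd \<in> hom (chain_group (i - 1)) (chain_group i)"
  using bd_hom[of "i - 1"] by simp

text \<open>Dividing by a subcomplex without homology does not change homology. Cycles are mapped to
  homology classes of the quotient: \<open>bd_null_exact\<close> gives surjectivity, and
  \<open>null_cycle\<close> shows that the kernel consists of the boundaries.\<close>

lemma homology_reduced: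
  "homology_at (chain_group (i - 1)) bd (chain_group i) bd (chain_group (i + 1)) \<cong>
   homology_at (reduced (i - 1)) (reduced_bd (i - 1)) (reduced i) (reduced_bd i) (reduced (i + 1))"
proof -
  let ?Z = "chain_group i\<lparr>carrier := kernel (chain_group i) (chain_group (i + 1)) bd\<rparr>"
  let ?R = "reduced i\<lparr>carrier := kernel (reduced i) (reduced (i + 1)) (reduced_bd i)\<rparr>"
  let ?I = "reduced_bd (i - 1) ` carrier (reduced (i - 1))"
  have hom': "reduced_bd (i - 1) \<in> hom (reduced (i - 1)) (reduced i)" using reduced_bd_hom[of "i - 1"] by simp
  have sq': "reduced_bd i (reduced_bd (i - 1) U) = \<one>\<^bsub>reduced (i + 1)\<^esub>" if "U \<in> carrier (reduced (i - 1))" for U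
    using reduced_bd_square[OF that] by simp
  have sq: "bd (bd x) = \<one>\<^bsub>chain_group (i + 1)\<^esub>" if "x \<in> carrier (chain_group (i - 1))" for x
    using square[of x "i - 1"] that by simp
  note HZ = homology_at_group[OF group_free_Abelian_group abelian_free_Abelian_group group_free_Abelian_group bd_hom' bd_hom sq]
  note HR = homology_at_group[OF reduced_group reduced_comm reduced_group hom' reduced_bd_hom sq']
  have gZ: "group ?Z" and gR: "group ?R" using HZ(1) HR(1) comm_group_def by blast+
  have Z: "x \<in> carrier ?Z \<longleftrightarrow> Poly_Mapping.keys x \<subseteq> X i \<and> bd x = 0" for x by (auto simp: kernel_def)
  have nI: "?I \<lhd> ?R" by (rule comm_group.subgroup_imp_normal[OF HR(1) HR(2)])
  have cR: "cls i x \<in> carrier ?R \<longleftrightarrow> bd x \<in> null (i + 1)" if "Poly_Mapping.keys x \<subseteq> X i" for x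
    using that reduced_bd_cls[OF that] cls_one[OF keys_bd[OF that]] by (auto simp: kernel_def reduced_carrier)
  have "cls i \<in> hom ?Z ?R"
  proof (rule homI)
    show "cls i x \<in> carrier ?R" if "x \<in> carrier ?Z" for x using that cR[of x] null_zero unfolding Z by simp
    show "cls i (x \<otimes>\<^bsub>?Z\<^esub> y) = cls i x \<otimes>\<^bsub>?R\<^esub> cls i y" if "x \<in> carrier ?Z" "y \<in> carrier ?Z" for x y
      using that hom_mult[OF cls_hom, of x i y] unfolding Z by simp
  qed
  then have h: "(\<lambda>U. ?I #>\<^bsub>?R\<^esub> U) \<circ> cls i \<in> hom ?Z (?R Mod ?I)"
    using hom_compose normal.r_coset_hom_Mod[OF nI] by blast
  have Icls: "cls i x \<in> ?I \<longleftrightarrow> (\<exists>y. Poly_Mapping.keys y \<subseteq> X (i - 1) \<and> x - bd y \<in> null i)" if "Poly_Mapping.keys x \<subseteq> X i" for x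
  proof -
    have "cls i x \<in> ?I \<longleftrightarrow> (\<exists>y. Poly_Mapping.keys y \<subseteq> X (i - 1) \<and> cls i x = reduced_bd (i - 1) (cls (i - 1) y))"
      unfolding reduced_carrier image_image by (simp add: image_iff Bex_def)
    also have "\<dots> \<longleftrightarrow> (\<exists>y. Poly_Mapping.keys y \<subseteq> X (i - 1) \<and> x - bd y \<in> null i)"
      using reduced_bd_cls[where i = "i - 1"] cls_eq[OF that keys_bd_minus] by (metis diff_add_cancel)
    finally show ?thesis .
  qed
  have "?Z Mod (bd ` carrier (chain_group (i - 1))) \<cong> ?R Mod ?I"
  proof (rule iso_from_surjective_hom[OF gZ _ h])
    show "group (?R Mod ?I)" using HR(3) comm_group_def unfolding homology_at_def by blast
    have surj: "\<exists>x\<in>carrier ?Z. cls i x = U" if U: "U \<in> carrier ?R" for U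
    proof -
      have "U \<in> carrier (reduced i)" using U by (simp add: kernel_def)
      then obtain x where x: "Poly_Mapping.keys x \<subseteq> X i" "U = cls i x" by (auto simp: reduced_carrier)
      then have "bd x \<in> null (i + 1)" using cR U by blast
      then obtain z where z: "z \<in> null i" "bd (x - z) = 0" using bd_null_exact x by blast
      have k: "Poly_Mapping.keys (x - z) \<subseteq> X i" by (rule keys_diff_subset[OF x(1) null_keys[OF z(1)]])
      have "cls i (x - z) = cls i x" using cls_eq[OF k x(1)] null_diff[OF null_zero z(1)] by simp
      then show ?thesis using z k x Z by blast
    qed
    have "cls i ` carrier ?Z = carrier ?R"
    proof
      show "cls i ` carrier ?Z \<subseteq> carrier ?R"
      proof
        fix U assume "U \<in> cls i ` carrier ?Z"
        then obtain x where "x \<in> carrier ?Z" "U = cls i x" by blast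
        then show "U \<in> carrier ?R" using cR[of x] null_zero unfolding Z by simp
      qed
      show "carrier ?R \<subseteq> cls i ` carrier ?Z" using surj by blast
    qed
    then show "((\<lambda>U. ?I #>\<^bsub>?R\<^esub> U) \<circ> cls i) ` carrier ?Z = carrier (?R Mod ?I)"
      unfolding carrier_FactGroup image_comp[symmetric] by simp
    show "kernel ?Z (?R Mod ?I) ((\<lambda>U. ?I #>\<^bsub>?R\<^esub> U) \<circ> cls i) = bd ` carrier (chain_group (i - 1))"
    proof -
      have "?I #>\<^bsub>?R\<^esub> cls i x = ?I \<longleftrightarrow> x \<in> bd ` carrier (chain_group (i - 1))" if x: "x \<in> carrier ?Z" for x
      proof -
        have xk: "Poly_Mapping.keys x \<subseteq> X i" "bd x = 0" using x Z by auto
        have cx: "cls i x \<in> carrier ?R" using cR[OF xk(1)] xk null_zero by simp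
        have "?I #>\<^bsub>?R\<^esub> cls i x = ?I \<longleftrightarrow> cls i x \<in> ?I"
          using group.coset_join1[OF gR _ cx HR(2)] group.coset_join2[OF gR cx HR(2)] subgroup.subset[OF HR(2)] by blast
        also have "\<dots> \<longleftrightarrow> (\<exists>y. Poly_Mapping.keys y \<subseteq> X (i - 1) \<and> x = bd y)"
        proof
          assume "cls i x \<in> ?I"
          then obtain y where y: "Poly_Mapping.keys y \<subseteq> X (i - 1)" "x - bd y \<in> null i" using Icls xk by blast
          have "bd (x - bd y) = 0" using xk square[OF y(1)] by (simp add: frag_extend_diff)
          then obtain a where a: "Poly_Mapping.keys a \<subseteq> X (i - 1)" "x - bd y = bd a" using null_cycle y by blast
          then have "x = bd (a + y)" by (simp add: frag_extend_add diff_eq_eq)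
          then show "\<exists>y. Poly_Mapping.keys y \<subseteq> X (i - 1) \<and> x = bd y" using keys_add_subset a y by blast
        next
          assume "\<exists>y. Poly_Mapping.keys y \<subseteq> X (i - 1) \<and> x = bd y"
          then show "cls i x \<in> ?I" using Icls xk null_zero by (metis diff_self)
        qed
        also have "\<dots> \<longleftrightarrow> x \<in> bd ` carrier (chain_group (i - 1))" by (simp add: image_iff Bex_def)
        finally show ?thesis .
      qed
      moreover have "bd ` carrier (chain_group (i - 1)) \<subseteq> carrier ?Z" using subgroup.subset[OF HZ(2)] by simp
      ultimately show ?thesis unfolding kernel_def[of ?Z] by auto
    qed
  qed
  then show ?thesis unfolding homology_at_def .
qed

text \<open>Critical chains represent all classes by \<open>split_all\<close> and inject into the
  quotient by \<open>null_critical\<close>.\<close>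

lemma reduced_iso: "reduced i \<cong> free_Abelian_group (K \<inter> X i)"
proof -
  let ?F = "free_Abelian_group (K \<inter> X i)"
  have "cls i \<in> iso ?F (reduced i)"
    unfolding iso_def
  proof (intro CollectI conjI)
    show "cls i \<in> hom ?F (reduced i)"
      using cls_hom[of i] unfolding hom_def by (auto simp: Pi_iff)
    show "bij_betw (cls i) (carrier ?F) (carrier (reduced i))"
      unfolding bij_betw_def
    proof
      show "inj_on (cls i) (carrier ?F)"
      proof (rule inj_onI)
        fix x y assume "x \<in> carrier ?F" "y \<in> carrier ?F" "cls i x = cls i y"
        then have "x - y \<in> null i" "Poly_Mapping.keys (x - y) \<subseteq> K \<inter> X i"
          using cls_eq[of x i y] keys_diff_subset[of x "K \<inter> X i" y] by auto
        then have "x - y = 0" by (rule null_critical)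
        then show "x = y" by simp
      qed
      show "cls i ` carrier ?F = carrier (reduced i)"
      proof
        show "cls i ` carrier ?F \<subseteq> carrier (reduced i)" by (auto simp: reduced_carrier)
        show "carrier (reduced i) \<subseteq> cls i ` carrier ?F"
        proof
          fix U assume "U \<in> carrier (reduced i)"
          then obtain x where x: "Poly_Mapping.keys x \<subseteq> X i" "U = cls i x" by (auto simp: reduced_carrier)
          then obtain z k where zk: "z \<in> null i" "Poly_Mapping.keys k \<subseteq> K \<inter> X i" "x = z + k"
            using split_all null_split by blast
          then have "cls i x = cls i k" using cls_eq[of x i k] x by auto
          then show "U \<in> cls i ` carrier ?F" using x zk by auto
        qed
      qed
    qed
  qed
  then have "?F \<cong> reduced i" by (auto simp: is_iso_def)
  then show ?thesis by (rule group.iso_sym[OF group_free_Abelian_group])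
qed

lemma homology_comm: "comm_group (homology_at (chain_group (i - 1)) bd (chain_group i) bd (chain_group (i + 1)))"
  by (rule homology_at_group(3)[OF group_free_Abelian_group abelian_free_Abelian_group group_free_Abelian_group bd_hom' bd_hom])
    (use square[of _ "i - 1"] in simp)

lemma row_complex_reduced: "row_complex reduced (\<lambda>i. homology_at (chain_group (i - 1)) bd (chain_group i) bd (chain_group (i + 1))) reduced_bd"
  by (rule row_complex.intro) (fact reduced_comm homology_comm reduced_bd_hom reduced_bd_square homology_reduced)+

end

section \<open>Spanning trees and cycles\<close>

lemma joined_refl: "(x, x) \<in> joined ends T"
  by (simp add: joined_def)

lemma joined_trans: "(x, y) \<in> joined ends T \<Longrightarrow> (y, z) \<in> joined ends T \<Longrightarrow> (x, z) \<in> joined ends T"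
  unfolding joined_def by (rule rtrancl_trans)

lemma joined_edge: "e \<in> T \<Longrightarrow> ends e = {x, y} \<Longrightarrow> (x, y) \<in> joined ends T"
  unfolding joined_def by (intro r_into_rtrancl) auto

lemma joined_sym: "(x, y) \<in> joined ends T \<Longrightarrow> (y, x) \<in> joined ends T"
proof -
  have "sym {(x, y). \<exists>e\<in>T. ends e = {x, y}}" by (auto simp: sym_def insert_commute)
  then have "sym (joined ends T)" unfolding joined_def by (rule sym_rtrancl)
  then show "(x, y) \<in> joined ends T \<Longrightarrow> (y, x) \<in> joined ends T" by (meson symE)
qed

lemma joined_induct [consumes 1, case_names refl step]:
  assumes "(x, y) \<in> joined ends T" "P x"
    "\<And>y z e. (x, y) \<in> joined ends T \<Longrightarrow> e \<in> T \<Longrightarrow> ends e = {y, z} \<Longrightarrow> P y \<Longrightarrow> P z"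
  shows "P y"
  using assms(1) unfolding joined_def
proof (induction rule: rtrancl_induct)
  case base then show ?case by (rule assms)
next
  case (step y z) then show ?case using assms(3) unfolding joined_def by blast
qed

lemma joined_subset:
  assumes "(x, y) \<in> joined ends T" "\<And>e u v. e \<in> T \<Longrightarrow> ends e = {u, v} \<Longrightarrow> (u, v) \<in> joined ends T'"
  shows "(x, y) \<in> joined ends T'"
  using assms(1)
proof (induction rule: joined_induct)
  case refl show ?case by (rule joined_refl)
next
  case (step y z e)
  show ?case by (rule joined_trans[OF step(4) assms(2)[OF step(2,3)]])
qed

lemma joined_mono: "(x, y) \<in> joined ends T \<Longrightarrow> T \<subseteq> T' \<Longrightarrow> (x, y) \<in> joined ends T'"
proof (erule joined_subset)
  fix e u v assume "T \<subseteq> T'" "e \<in> T" "ends e = {u, v}"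
  then show "(u, v) \<in> joined ends T'" using joined_edge[of e T' ends u v] by blast
qed

lemma joined_insert:
  assumes "(x, y) \<in> joined ends (insert e T)" "ends e = {u, v}"
  shows "(x, y) \<in> joined ends T \<or> (x, u) \<in> joined ends T \<and> (v, y) \<in> joined ends T
    \<or> (x, v) \<in> joined ends T \<and> (u, y) \<in> joined ends T"
  using assms(1)
proof (induction rule: joined_induct)
  case refl then show ?case by (simp add: joined_refl)
next
  case (step y z g)
  show ?case
  proof (cases "g \<in> T")
    case True
    then have "(y, z) \<in> joined ends T" using joined_edge step by metis
    then show ?thesis using step.IH joined_trans by metis
  next
    case False
    then have "{y, z} = {u, v}" using step assms(2) by auto
    then have "y = u \<and> z = v \<or> y = v \<and> z = u" by (simp add: doubleton_eq_iff)
    then show ?thesis using step.IH joined_refl joined_trans joined_sym by metis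
  qed
qed

lemma cycle_edge_joined:
  assumes "is_cycle ends C" "e \<in> C" "ends e = {x, y}"
  shows "(x, y) \<in> joined ends (C - {e})"
proof -
  obtain xs es where xs: "xs \<noteq> []" "length es = length xs" "distinct es" "C = set es"
    "\<And>k. k < length xs \<Longrightarrow> ends (es ! k) = {xs ! k, xs ! (Suc k mod length xs)}"
    using assms(1) unfolding is_cycle_def by blast
  let ?m = "length xs"
  obtain k where k: "k < ?m" "es ! k = e" using assms(2) xs by (metis in_set_conv_nth)
  have "(xs ! (Suc k mod ?m), xs ! ((Suc k + i) mod ?m)) \<in> joined ends (C - {e})" if "i < ?m" for i
    using that
  proof (induction i)
    case 0 show ?case by (simp add: joined_refl)
  next
    case (Suc i)
    let ?j = "(Suc k + i) mod ?m"
    have j: "?j < ?m" using xs(1) by simp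
    \<comment> \<open>The walk starts behind edge \<open>k\<close> and goes around the cycle; in
      fewer than \<open>?m - 1\<close> steps it has not come back to this edge.\<close>
    have "?j \<noteq> k"
    proof
      assume eq: "?j = k"
      show False
      proof (cases "Suc k + i < ?m")
        case True
        then show False using eq by simp
      next
        case False
        then have "?j = Suc k + i - ?m" using k Suc.prems by (simp add: le_mod_geq)
        then show False using eq k Suc.prems False by simp
      qed
    qed
    then have "es ! ?j \<noteq> e" using k j xs(2,3) nth_eq_iff_index_eq by metis
    then have "es ! ?j \<in> C - {e}" using j xs(2,4) by simp
    moreover have "Suc ?j mod ?m = (Suc k + Suc i) mod ?m" by (simp add: mod_Suc_eq)
    ultimately have "(xs ! ?j, xs ! ((Suc k + Suc i) mod ?m)) \<in> joined ends (C - {e})"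
      using xs(5)[OF j] joined_edge by metis
    then show ?case using Suc joined_trans by (meson Suc_lessD)
  qed
  from this[of "?m - 1"] have "(xs ! (Suc k mod ?m), xs ! k) \<in> joined ends (C - {e})"
    using k xs(1) by simp
  moreover have "{x, y} = {xs ! k, xs ! (Suc k mod ?m)}" using xs(5)[OF k(1)] k assms(3) by simp
  ultimately show ?thesis using joined_sym by (metis doubleton_eq_iff)
qed

lemma joined_path:
  assumes "(x, y) \<in> joined ends T"
  shows "\<exists>xs es. xs \<noteq> [] \<and> hd xs = x \<and> last xs = y \<and> distinct xs \<and> Suc (length es) = length xs \<and> set es \<subseteq> T \<and>
    (\<forall>k<length es. ends (es ! k) = {xs ! k, xs ! Suc k})"
  using assms
proof (induction rule: joined_induct)
  case refl
  show ?case by (intro exI[of _ "[x]"] exI[of _ "[]"]) simp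
next
  case (step y z e)
  then obtain xs es where xs: "xs \<noteq> []" "hd xs = x" "last xs = y" "distinct xs" "Suc (length es) = length xs" "set es \<subseteq> T"
    "\<And>k. k < length es \<Longrightarrow> ends (es ! k) = {xs ! k, xs ! Suc k}" by blast
  show ?case
  proof (cases "z \<in> set xs")
    case True
    \<comment> \<open>The new vertex is already on the path, so the path is cut off there.\<close>
    then obtain m where m: "m < length xs" "xs ! m = z" by (metis in_set_conv_nth)
    have 1: "take (Suc m) xs \<noteq> []" "hd (take (Suc m) xs) = x" using xs by (cases xs; simp)+
    have 2: "last (take (Suc m) xs) = z" using m by (simp add: take_Suc_conv_app_nth)
    have 3: "Suc (length (take m es)) = length (take (Suc m) xs)" using m xs(5) by simp
    have 4: "set (take m es) \<subseteq> T" using xs(6) set_take_subset by fast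
    show ?thesis
      by (rule exI[of _ "take (Suc m) xs"], rule exI[of _ "take m es"]) (use 1 2 3 4 xs(4,7) in auto)
  next
    case False
    have "ends ((es @ [e]) ! k) = {(xs @ [z]) ! k, (xs @ [z]) ! Suc k}" if k: "k < length (es @ [e])" for k
    proof (cases "k < length es")
      case True then show ?thesis using xs(5,7) by (simp add: nth_append)
    next
      case f: False
      then have k': "k = length es" using k by simp
      have "xs ! k = y" using xs(1,3,5) k' by (metis diff_Suc_1 last_conv_nth)
      then show ?thesis using step(3) k' xs(5) by (simp add: nth_append)
    qed
    then show ?thesis
      by (intro exI[of _ "xs @ [z]"] exI[of _ "es @ [e]"]) (use xs(1-6) False step(2) in auto)
  qed
qed

text \<open>The edge \<open>e\<close> closes a simple path between its end points. A loop closes the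
  path with one vertex, which is a cycle of length one in \<open>is_cycle\<close>.\<close>

lemma joined_cycle:
  assumes "(x, y) \<in> joined ends T" "e \<notin> T" "ends e = {x, y}"
  shows "\<exists>C. is_cycle ends C \<and> e \<in> C \<and> C \<subseteq> insert e T"
proof -
  obtain xs es where xs: "xs \<noteq> []" "hd xs = x" "last xs = y" "distinct xs" "Suc (length es) = length xs" "set es \<subseteq> T"
    "\<And>k. k < length es \<Longrightarrow> ends (es ! k) = {xs ! k, xs ! Suc k}"
    using joined_path[OF assms(1)] by blast
  have "es ! i \<noteq> es ! j" if "i < j" "j < length es" for i j
  proof
    assume "es ! i = es ! j"
    then have "{xs ! i, xs ! Suc i} = {xs ! j, xs ! Suc j}" using xs(7)[of i] xs(7)[of j] that by simp
    then have "xs ! i = xs ! j \<or> xs ! i = xs ! Suc j" by auto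
    then show False using xs(4,5) that by (auto simp: nth_eq_iff_index_eq)
  qed
  then have "distinct es" by (metis distinct_conv_nth linorder_neqE_nat)
  then have d: "distinct (es @ [e])" using xs(6) assms(2) by auto
  have "ends ((es @ [e]) ! k) = {xs ! k, xs ! (Suc k mod length xs)}" if k: "k < length xs" for k
  proof (cases "k < length es")
    case True
    then show ?thesis using xs(5,7) by (simp add: nth_append mod_less)
  next
    case False
    then have k': "k = length es" using k xs(5) by simp
    have "xs ! k = y" using xs(1,3,5) k' by (metis diff_Suc_1 last_conv_nth)
    moreover have "Suc k mod length xs = 0" using k' xs(5) by simp
    moreover have "xs ! 0 = x" using xs(1,2) by (simp add: hd_conv_nth)
    ultimately show ?thesis using k' assms(3) by (simp add: insert_commute)
  qed
  then have "is_cycle ends (set (es @ [e]))"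
    unfolding is_cycle_def using xs(1,4,5) d by (intro exI[of _ xs] exI[of _ "es @ [e]"]) simp
  then show ?thesis using xs(6) by (intro exI[of _ "set (es @ [e])"]) auto
qed

definition acyclic_edges :: "('e \<Rightarrow> 'v set) \<Rightarrow> 'e set \<Rightarrow> bool" where
  "acyclic_edges ends T \<longleftrightarrow> (\<nexists>C. C \<subseteq> T \<and> is_cycle ends C)"

lemma acyclic_subset: "acyclic_edges ends T \<Longrightarrow> T' \<subseteq> T \<Longrightarrow> acyclic_edges ends T'"
  unfolding acyclic_edges_def by blast

lemma acyclic_separates:
  assumes "acyclic_edges ends T" "e \<in> T" "ends e = {x, y}"
  shows "(x, y) \<notin> joined ends (T - {e})"
proof
  assume "(x, y) \<in> joined ends (T - {e})"
  then obtain C where "is_cycle ends C" "C \<subseteq> insert e (T - {e})" using joined_cycle[of x y ends "T - {e}" e] assms(3) by blast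
  then show False using assms(1,2) unfolding acyclic_edges_def by blast
qed

locale tree_in_graph =
  fixes V :: "'v set" and E :: "'e::linorder set" and ends :: "'e \<Rightarrow> 'v set" and T :: "'e set"
  assumes ends_in: "e \<in> E \<Longrightarrow> \<exists>x\<in>V. \<exists>y\<in>V. ends e = {x, y}"
    and tree: "spanning_tree V E ends T"
begin

lemma T_subset: "T \<subseteq> E" and T_connected: "x \<in> V \<Longrightarrow> y \<in> V \<Longrightarrow> (x, y) \<in> joined ends T"
  and T_acyclic: "acyclic_edges ends T"
  using tree unfolding spanning_tree_def acyclic_edges_def by auto

lemma cycle_through:
  assumes "is_cycle ends C" "C \<subseteq> insert f T"
  shows "f \<in> C"
  using assms T_acyclic unfolding acyclic_edges_def by blast

text \<open>If \<open>e\<close> is in \<open>C\<close> but not in \<open>C'\<close>, then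
  \<open>C'\<close> joins the end points of \<open>f\<close> inside \<open>T - {e}\<close>.
  Replacing \<open>f\<close> by this connection in \<open>C\<close> joins the end points of
  \<open>e\<close> there too, against acyclicity.\<close>

lemma cycle_unique:
  assumes f: "f \<in> E" "f \<notin> T" and C: "is_cycle ends C" "C \<subseteq> insert f T" and C': "is_cycle ends C'" "C' \<subseteq> insert f T"
  shows "C \<subseteq> C'"
proof
  fix e assume e: "e \<in> C"
  show "e \<in> C'"
  proof (rule ccontr)
    assume n: "e \<notin> C'"
    have fC: "f \<in> C'" by (rule cycle_through[OF C'])
    then have eT: "e \<in> T" "e \<noteq> f" using n e C by auto
    obtain x y where xy: "ends f = {x, y}" using ends_in f by blast
    have "(x, y) \<in> joined ends (C' - {f})" by (rule cycle_edge_joined[OF C'(1) fC xy])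
    then have j: "(x, y) \<in> joined ends (T - {e})" by (rule joined_mono) (use C' n in blast)
    obtain u v where uv: "ends e = {u, v}" using ends_in eT T_subset by blast
    have "(u, v) \<in> joined ends (C - {e})" by (rule cycle_edge_joined[OF C(1) e uv])
    then have "(u, v) \<in> joined ends (insert f (T - {e}))" by (rule joined_mono) (use C in blast)
    then have "(u, v) \<in> joined ends (T - {e})"
      using joined_insert[of u v ends f "T - {e}" x y] xy j joined_trans joined_sym by metis
    then show False using acyclic_separates[OF T_acyclic eT(1) uv] by blast
  qed
qed

lemma cyc:
  assumes f: "f \<in> E" "f \<notin> T"
  shows "is_cycle ends (cyc ends T f)" "cyc ends T f \<subseteq> insert f T"
    "is_cycle ends C \<Longrightarrow> C \<subseteq> insert f T \<Longrightarrow> C = cyc ends T f"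
proof -
  obtain x y where xy: "x \<in> V" "y \<in> V" "ends f = {x, y}" using ends_in f by blast
  have "\<exists>C. is_cycle ends C \<and> C \<subseteq> insert f T"
    using joined_cycle[OF T_connected[OF xy(1,2)] f(2) xy(3)] by blast
  then have "\<exists>!C. is_cycle ends C \<and> C \<subseteq> insert f T"
    using cycle_unique[OF f] by (meson subset_antisym)
  then have *: "is_cycle ends (cyc ends T f) \<and> cyc ends T f \<subseteq> insert f T"
    unfolding cyc_def by (rule theI')
  then show "is_cycle ends (cyc ends T f)" "cyc ends T f \<subseteq> insert f T" by auto
  show "is_cycle ends C \<Longrightarrow> C \<subseteq> insert f T \<Longrightarrow> C = cyc ends T f"
    using cycle_unique[OF f] * by (meson subset_antisym)
qed

lemma exchange:
  assumes f: "f \<in> E" "f \<notin> T" and g: "g \<in> T"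
  shows "g \<in> cyc ends T f \<longleftrightarrow> spanning_tree V E ends (insert f (T - {g}))"
proof
  assume gC: "g \<in> cyc ends T f"
  obtain u v where uv: "ends g = {u, v}" using ends_in g T_subset by blast
  have "(u, v) \<in> joined ends (cyc ends T f - {g})" by (rule cycle_edge_joined[OF cyc(1)[OF f] gC uv])
  then have gj: "(u, v) \<in> joined ends (insert f (T - {g}))" by (rule joined_mono) (use cyc(2)[OF f] in blast)
  have "(x, y) \<in> joined ends (insert f (T - {g}))" if "x \<in> V" "y \<in> V" for x y
  proof (rule joined_subset[OF T_connected[OF that]])
    fix e x y assume e: "e \<in> T" "ends e = {x, y}"
    show "(x, y) \<in> joined ends (insert f (T - {g}))"
    proof (cases "e = g")
      case True
      then have "x = u \<and> y = v \<or> x = v \<and> y = u" using e uv by (auto simp: doubleton_eq_iff)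
      then show ?thesis using gj joined_sym by metis
    next
      case False
      then show ?thesis using joined_edge[of e "insert f (T - {g})" ends x y] e by blast
    qed
  qed
  moreover have "\<not> is_cycle ends C" if "C \<subseteq> insert f (T - {g})" for C
    using cyc(3)[OF f, of C] that gC g f by blast
  ultimately show "spanning_tree V E ends (insert f (T - {g}))"
    unfolding spanning_tree_def using f T_subset by auto
next
  assume s: "spanning_tree V E ends (insert f (T - {g}))"
  show "g \<in> cyc ends T f"
  proof (rule ccontr)
    assume "g \<notin> cyc ends T f"
    then have "cyc ends T f \<subseteq> insert f (T - {g})" using cyc(2)[OF f] by blast
    then show False using s cyc(1)[OF f] unfolding spanning_tree_def by blast
  qed
qed

text \<open>Duality of fundamental cuts and cycles: an edge outside the tree crosses the cut of
  \<open>e\<close> exactly when its cycle runs through \<open>e\<close>.\<close>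

lemma cut_iff:
  assumes e: "e \<in> T" and g: "g \<in> E"
  shows "g \<in> cut E ends T e \<longleftrightarrow> g = e \<or> g \<notin> T \<and> e \<in> cyc ends T g"
proof -
  obtain x y where xy: "ends g = {x, y}" using ends_in g by blast
  have cut: "g \<in> cut E ends T e \<longleftrightarrow> (x, y) \<notin> joined ends (T - {e})"
  proof -
    have "(u, v) \<in> joined ends (T - {e}) \<longleftrightarrow> (x, y) \<in> joined ends (T - {e})" if "ends g = {u, v}" for u v
      using that xy joined_sym by (metis doubleton_eq_iff)
    then show ?thesis unfolding cut_def using g xy by blast
  qed
  show ?thesis
  proof (cases "g \<in> T")
    case True
    then show ?thesis
      using cut acyclic_separates[OF T_acyclic e] xy joined_edge[of g "T - {e}" ends x y] by blast
  next
    case False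
    note c = cyc[OF g False]
    have "(x, y) \<in> joined ends (T - {e}) \<longleftrightarrow> e \<notin> cyc ends T g"
    proof
      assume "(x, y) \<in> joined ends (T - {e})"
      then obtain C where "is_cycle ends C" "C \<subseteq> insert g (T - {e})"
        using joined_cycle[of x y ends "T - {e}" g] False xy by blast
      moreover from this have "C = cyc ends T g" using c(3) by blast
      ultimately show "e \<notin> cyc ends T g" using e False by blast
    next
      assume "e \<notin> cyc ends T g"
      then have sub: "cyc ends T g - {g} \<subseteq> T - {e}" using c(2) by blast
      show "(x, y) \<in> joined ends (T - {e})"
        by (rule joined_mono[OF cycle_edge_joined[OF c(1) cycle_through[OF c(1,2)] xy] sub])
    qed
    then show ?thesis using cut False e by blast
  qed
qed

text \<open>The members of the cut or cycle of \<open>e\<close> other than \<open>e\<close> are the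
  edges that can be exchanged with \<open>e\<close>. In this form cuts and cycles disappear, and
  activity can be compared with \<open>lives\<close>.\<close>

lemma live_iff:
  assumes e: "e \<in> E"
  shows "live E ends T e \<longleftrightarrow> (\<forall>g\<in>E. g < e \<longrightarrow> \<not> spanning_tree V E ends (sym_diff T {e, g}))"
proof (cases "e \<in> T")
  case True
  have "g \<in> cut E ends T e \<longleftrightarrow> spanning_tree V E ends (sym_diff T {e, g})" if g: "g \<in> E" "g < e" for g
  proof (cases "g \<in> T")
    case gT: True
    \<comment> \<open>With both edges removed, the end points of \<open>e\<close> are no longer
      joined.\<close>
    have "\<not> spanning_tree V E ends (sym_diff T {e, g})"
    proof
      assume s: "spanning_tree V E ends (sym_diff T {e, g})"
      obtain x y where xy: "x \<in> V" "y \<in> V" "ends e = {x, y}" using ends_in e by blast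
      then have "(x, y) \<in> joined ends (sym_diff T {e, g})" using s unfolding spanning_tree_def by blast
      then have "(x, y) \<in> joined ends (T - {e})" by (rule joined_mono) (use gT True in auto)
      then show False using acyclic_separates[OF T_acyclic True xy(3)] by blast
    qed
    then show ?thesis using cut_iff[OF True g(1)] g gT by auto
  next
    case gT: False
    have "sym_diff T {e, g} = insert g (T - {e})" using True gT by auto
    then show ?thesis using cut_iff[OF True g(1)] exchange[OF g(1) gT True] g gT by auto
  qed
  note cut = this
  have "cut E ends T e \<subseteq> E" by (auto simp: cut_def)
  then have "live E ends T e \<longleftrightarrow> (\<forall>g\<in>E. g < e \<longrightarrow> g \<notin> cut E ends T e)"
    unfolding live_def using True by (auto simp: not_less[symmetric])
  then show ?thesis using cut by blast
next
  case False
  have "g \<in> cyc ends T e \<longleftrightarrow> spanning_tree V E ends (sym_diff T {e, g})" if g: "g \<in> E" "g < e" for g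
  proof (cases "g \<in> T")
    case gT: True
    have "sym_diff T {e, g} = insert e (T - {g})" using False gT by auto
    then show ?thesis using exchange[OF e False gT] by simp
  next
    case gT: False
    \<comment> \<open>With both edges added, the cycle of \<open>e\<close> survives.\<close>
    have "cyc ends T e \<subseteq> sym_diff T {e, g}" using cyc(2)[OF e False] False gT by auto
    then have "\<not> spanning_tree V E ends (sym_diff T {e, g})"
      using cyc(1)[OF e False] unfolding spanning_tree_def by blast
    then show ?thesis using cyc(2)[OF e False] g gT by auto
  qed
  note cyc' = this
  have "cyc ends T e \<subseteq> E" using cyc(2)[OF e False] e T_subset by blast
  then have "live E ends T e \<longleftrightarrow> (\<forall>g\<in>E. g < e \<longrightarrow> g \<notin> cyc ends T e)"
    unfolding live_def using False by (auto simp: not_less[symmetric])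
  then show ?thesis using cyc' by blast
qed

end

lemma card_image_eq_of_kernel:
  assumes "\<And>x y. x \<in> A \<Longrightarrow> y \<in> A \<Longrightarrow> f x = f y \<longleftrightarrow> g x = g y"
  shows "card (f ` A) = card (g ` A)"
proof -
  let ?P = "(\<lambda>x. (f x, g x)) ` A"
  have "inj_on fst ?P" "inj_on snd ?P" using assms by (auto simp: inj_on_def)
  moreover have "fst ` ?P = f ` A" "snd ` ?P = g ` A" by (auto simp: image_image)
  ultimately show ?thesis by (metis card_image)
qed

section \<open>The Tait graph and the one-circle states\<close>

context colored_diagram
begin

text \<open>Colour \<open>True\<close> stands for shaded.\<close>

definition face_at :: "bool \<Rightarrow> nat \<Rightarrow> (nat \<times> bool) set" where
  "face_at s x = face_of D (x, (face_of D (x, True) \<in> S) = s)"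

lemma face_at_shade: "x \<in> arcs D \<Longrightarrow> face_at s x \<in> S \<longleftrightarrow> s"
  unfolding face_at_def using board_arc[of x True] by (cases "face_of D (x, True) \<in> S"; cases s) auto

lemma face_at_eq:
  assumes "x \<in> arcs D" "face_of D (x, out) \<in> S \<longleftrightarrow> s"
  shows "face_at s x = face_of D (x, out)"
proof -
  have "((face_of D (x, True) \<in> S) = s) = out" using assms board_arc[of x True] by (cases out) auto
  then show ?thesis by (simp add: face_at_def)
qed

lemma corner_next:
  assumes "c < length D" "k < 4" "arc_ends D c ! (Suc k mod 4) = (a, out)"
  shows "corner_face D c k = face_of D (a, \<not> out)"
proof -
  have "(arc_ends D c ! k, (a, \<not> out)) \<in> corner_glue D"
    unfolding corner_glue_def using assms assms(3)[symmetric] by blast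
  then show ?thesis unfolding corner_face_def by (intro face_of_glue) auto
qed

text \<open>Corner \<open>k\<close> borders on the arcs at ends \<open>k\<close> and
  \<open>k + 1\<close>, so either arc names its face.\<close>

lemma corner_face_at:
  assumes c: "c < length D" "k < 4" and s: "shaded c k = s"
  shows "corner_face D c k = face_at s (arc_at D c k)" "corner_face D c k = face_at s (arc_at D c (Suc k mod 4))"
proof -
  obtain a out where a: "arc_ends D c ! k = (a, out)" by (cases "arc_ends D c ! k")
  have "a \<in> arcs D" using arc_at_in[OF c] a by (simp add: arc_at_def)
  then show "corner_face D c k = face_at s (arc_at D c k)"
    using face_at_eq[of a out s] corner_shaded[OF c a] s a by (simp add: corner_face_def arc_at_def)
  obtain a' out' where a': "arc_ends D c ! (Suc k mod 4) = (a', out')" by (cases "arc_ends D c ! (Suc k mod 4)")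
  have "a' \<in> arcs D" using arc_at_in[of c "Suc k mod 4"] c a' by (simp add: arc_at_def)
  then show "corner_face D c k = face_at s (arc_at D c (Suc k mod 4))"
    using face_at_eq[of a' "\<not> out'" s] corner_next[OF c a'] s a' by (simp add: shaded_def arc_at_def)
qed

text \<open>The state whose circles are the boundaries of the faces of colour \<open>s\<close>.\<close>

definition face_state :: "bool \<Rightarrow> nat set" where
  "face_state s = {c. c < length D \<and> shaded c 1 = s}"

text \<open>At each corner of colour \<open>s\<close> the strand rounds off the corner, so it runs
  along the boundary of that face.\<close>

lemma face_state_partner:
  assumes c: "c < length D" and k: "k < 4" "shaded c k = s"
  shows "partner (face_state s) c k = Suc k mod 4"
proof -
  have "c \<in> face_state s \<longleftrightarrow> shaded c 1 = s" using c by (simp add: face_state_def)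
  then show ?thesis using k shaded_parity[OF c] by (auto simp: less4 partner_def)
qed

lemma face_state_same:
  assumes x: "x \<in> arcs D" and y: "y \<in> arcs D"
  shows "same (face_state s) x y \<longleftrightarrow> face_at s x = face_at s y"
proof
  assume "same (face_state s) x y"
  then show "face_at s x = face_at s y"
  proof (induction rule: same_induct)
    case (step c k)
    let ?p = "partner (face_state s) c k"
    have "face_at s (arc_at D c k) = face_at s (arc_at D c ?p)"
    proof (cases "shaded c k = s")
      case True
      show ?thesis unfolding face_state_partner[OF step(1,2) True]
        using corner_face_at[OF step(1,2) True] by simp
    next
      case False
      have p: "?p < 4" "shaded c ?p = s" using partner_less step shaded_partner False by auto
      have "partner (face_state s) c ?p = k" using partner_partner step by blast
      then have "Suc ?p mod 4 = k" using face_state_partner[OF step(1) p] by simp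
      then show ?thesis using corner_face_at[OF step(1) p] by simp
    qed
    then show ?case using step by simp
  qed simp
next
  define X where "X = (x, (face_of D (x, True) \<in> S) = s)"
  define Y where "Y = (y, (face_of D (y, True) \<in> S) = s)"
  assume "face_at s x = face_at s y"
  then have "face_of D X = face_of D Y" by (simp add: face_at_def X_def Y_def)
  moreover have "Y \<in> face_of D Y" by (simp add: face_of_def)
  ultimately have "Y \<in> face_of D X" by metis
  then have "(X, Y) \<in> (corner_glue D \<union> (corner_glue D)\<inverse>)\<^sup>*" by (simp add: face_of_def)
  then have "same (face_state s) (fst X) (fst Y)"
  proof (induction rule: rtrancl_induct)
    case base then show ?case by (rule same_refl)
  next
    case (step P Q)
    have PX: "face_of D P = face_at s x"
      using face_of_glue[OF step(1)] unfolding X_def face_at_def by simp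
    have PS: "face_of D P \<in> S \<longleftrightarrow> s"
      unfolding PX by (rule face_at_shade[OF x])
    have QS: "face_of D Q \<in> S \<longleftrightarrow> s"
      using PS unfolding face_of_glue[OF r_into_rtrancl[OF step(2)]] .
    \<comment> \<open>A chain of corner gluings stays on the boundary of one face, here of colour
      \<open>s\<close>, so every corner on the way is rounded off by the state.\<close>
    have main: "same (face_state s) (fst P) (fst Q)" if PQ: "(P, Q) \<in> corner_glue D" and PS: "face_of D P \<in> S \<longleftrightarrow> s" for P Q
    proof -
      obtain c k a out where g: "c < length D" "k < 4" "(a, out) = arc_ends D c ! (Suc k mod 4)"
        "P = arc_ends D c ! k" "Q = (a, \<not> out)" using PQ unfolding corner_glue_def by blast
      have "shaded c k = s" using PS g by (simp add: shaded_def corner_face_def)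
      then have "partner (face_state s) c k = Suc k mod 4" by (rule face_state_partner[OF g(1,2)])
      then show ?thesis using same_partner[OF g(1,2), of "face_state s"] g(3-5) by (metis arc_at_def fst_conv)
    qed
    show ?case using step main[of P Q] main[of Q P] PS QS same_trans same_sym by blast
  qed
  then show "same (face_state s) x y" by (simp add: X_def Y_def)
qed

lemma faces_eq: "faces D = face_of D ` (arcs D \<times> UNIV)"
  by (auto simp: faces_def glue_classes_def quotient_def face_of_def)

lemma colour_faces: "{F \<in> faces D. (F \<in> S) = s} = face_at s ` arcs D"
proof
  show "{F \<in> faces D. (F \<in> S) = s} \<subseteq> face_at s ` arcs D"
  proof
    fix F assume "F \<in> {F \<in> faces D. (F \<in> S) = s}"
    then obtain x out where "x \<in> arcs D" "F = face_of D (x, out)" "(F \<in> S) = s" by (auto simp: faces_eq)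
    then show "F \<in> face_at s ` arcs D" using face_at_eq[of x out s] by auto
  qed
  show "face_at s ` arcs D \<subseteq> {F \<in> faces D. (F \<in> S) = s}"
    using face_at_shade by (auto simp: faces_eq face_at_def)
qed

lemma S_eq: "S = face_at True ` arcs D"
  using colour_faces[of True] board by (auto simp: checkerboard_def)

lemma card_colour: "card (face_at s ` arcs D) = card (circles D (face_state s))"
  unfolding circles_eq using face_state_same circle_of_eq_iff by (intro card_image_eq_of_kernel) metis

text \<open>The faces of each colour correspond to the circles of a face state, which turns the
  planarity of the diagram into a statement about circles.\<close>

lemma euler: "card (circles D (face_state True)) + card (circles D (face_state False)) = length D + 2"
proof -
  have "faces D = {F \<in> faces D. (F \<in> S) = True} \<union> {F \<in> faces D. (F \<in> S) = False}" by blast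
  then have "faces D = face_at True ` arcs D \<union> face_at False ` arcs D" unfolding colour_faces .
  moreover have "face_at True ` arcs D \<inter> face_at False ` arcs D = {}"
    unfolding colour_faces[symmetric] by blast
  ultimately have "card (faces D) = card (face_at True ` arcs D) + card (face_at False ` arcs D)"
    using finite_arcs by (simp add: card_Un_disjoint)
  then show ?thesis using knot by (simp add: knot_diagram_def card_colour)
qed

lemma pos_edge_iff: "c < length D \<Longrightarrow> pos_edge D S c \<longleftrightarrow> shaded c 1"
  unfolding pos_edge_def using shaded_parity[of c] by (simp add: shaded_def)

text \<open>The arcs that stand for the two strands at a crossing also name the two shaded faces
  there, whatever the sign of the edge. This links saddles to edges.\<close>

lemma edge_ends_eq:
  assumes c: "c < length D"
  shows "edge_ends D S c = {face_at True (al c), face_at True (be c)}"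
proof (cases "shaded c 1")
  case True
  have "shaded c 3" using True shaded_parity[OF c] by simp
  then have "corner_face D c 1 = face_at True (be c)" "corner_face D c 3 = face_at True (al c)"
    using corner_face_at(2)[OF c, of 1 True] corner_face_at(2)[OF c, of 3 True] True by (simp_all add: numeral_2_eq_2)
  then show ?thesis using True pos_edge_iff[OF c] by (auto simp: edge_ends_def)
next
  case False
  have "shaded c 0" "shaded c 2" using False shaded_parity[OF c] by auto
  then have "corner_face D c 0 = face_at True (al c)" "corner_face D c 2 = face_at True (be c)"
    using corner_face_at(1)[OF c, of 0 True] corner_face_at(1)[OF c, of 2 True] by simp_all
  then show ?thesis using False pos_edge_iff[OF c] by (auto simp: edge_ends_def)
qed

text \<open>The state of a subgraph of the Tait graph: its smoothings join the shaded regions exactly along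
  the edges of the subgraph, so that its circles bound a neighbourhood of the subgraph.\<close>

definition subgraph_state :: "nat set \<Rightarrow> nat set" where
  "subgraph_state H = {c. c < length D \<and> (c \<in> H) \<noteq> shaded c 1}"

abbreviation "connected_in H x y \<equiv> (face_at True x, face_at True y) \<in> joined (edge_ends D S) H"

lemma subgraph_state_empty: "subgraph_state {} = face_state True"
  by (auto simp: subgraph_state_def face_state_def)

lemma subgraph_state_full: "subgraph_state {..<length D} = face_state False"
  by (auto simp: subgraph_state_def face_state_def)

lemma subgraph_state_twice: "H \<subseteq> {..<length D} \<Longrightarrow> subgraph_state (subgraph_state H) = H"
  by (auto simp: subgraph_state_def)

lemma subgraph_state_subset: "subgraph_state H \<subseteq> {..<length D}"
  by (auto simp: subgraph_state_def)

lemma subgraph_state_sym_diff: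
  "X \<subseteq> {..<length D} \<Longrightarrow> subgraph_state (sym_diff H X) = sym_diff (subgraph_state H) X"
  by (auto simp: subgraph_state_def)

lemma subgraph_differ: "c < length D \<Longrightarrow> c \<notin> H \<Longrightarrow> differ_at c (subgraph_state H) (subgraph_state (insert c H))"
  by (auto simp: differ_at_def subgraph_state_def)

text \<open>Outside \<open>H\<close> a strand follows the boundary of a shaded face; at an edge of
  \<open>H\<close> it can only pass to the other end point of the edge.\<close>

lemma same_connected:
  assumes xy: "same (subgraph_state H) x y"
  shows "connected_in H x y"
  using xy
proof (induction rule: same_induct)
  case refl then show ?case by (rule joined_refl)
next
  case (step c k)
  let ?p = "partner (subgraph_state H) c k"
  have p: "?p < 4" using partner_less step by blast
  have "connected_in H (arc_at D c k) (arc_at D c ?p)"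
  proof (cases "c \<in> H")
    case False
    then have "c \<in> subgraph_state H \<longleftrightarrow> c \<in> face_state True" by (simp add: subgraph_state_def face_state_def step)
    then have "?p = partner (face_state True) c k" by (simp add: partner_def)
    then have "same (face_state True) (arc_at D c k) (arc_at D c ?p)" using same_partner step by metis
    then have "face_at True (arc_at D c k) = face_at True (arc_at D c ?p)"
      using face_state_same arc_at_in step p by blast
    then show ?thesis by (simp add: joined_refl)
  next
    case True
    have v: "face_at True (arc_at D c j) \<in> {face_at True (al c), face_at True (be c)}" if "j < 4" for j
      using end_at_al_be[OF step(1) that, of "face_state True"] face_state_same arc_at_in[OF step(1) that] al_be_in[OF step(1)]
      by blast
    have "connected_in H (al c) (be c)" by (rule joined_edge[where e = c]) (use True edge_ends_eq[OF step(1)] in auto)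
    then show ?thesis using v[OF step(2)] v[OF p] joined_refl joined_sym by fastforce
  qed
  then show ?case using step joined_trans by metis
qed

text \<open>A new edge of a forest joins two components. Its strands lie on different circles by
  \<open>same_connected\<close>, so the saddle merges two circles.\<close>

lemma forest_circles:
  assumes H: "H \<subseteq> {..<length D}" and a: "acyclic_edges (edge_ends D S) H"
  shows "card (circles D (subgraph_state H)) + card H = card S"
    "x \<in> arcs D \<Longrightarrow> y \<in> arcs D \<Longrightarrow> connected_in H x y \<Longrightarrow> same (subgraph_state H) x y"
proof -
  have "finite H" using H finite_subset by blast
  then have "card (circles D (subgraph_state H)) + card H = card S \<and>
    (\<forall>x\<in>arcs D. \<forall>y\<in>arcs D. connected_in H x y \<longrightarrow> same (subgraph_state H) x y)"
    using H a
  proof (induction H)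
    case empty
    have "same (face_state True) x y" if "x \<in> arcs D" "y \<in> arcs D" "connected_in {} x y" for x y
    proof -
      have "face_at True x = face_at True y" using that(3) by (auto simp: joined_def)
      then show ?thesis using face_state_same that by blast
    qed
    then show ?case using card_colour[of True] S_eq by (simp add: subgraph_state_empty)
  next
    case (insert c H)
    let ?B = "subgraph_state H" and ?B' = "subgraph_state (insert c H)"
    have c: "c < length D" and H: "H \<subseteq> {..<length D}" using insert.prems by auto
    have aH: "acyclic_edges (edge_ends D S) H" using acyclic_subset insert.prems(2) by blast
    note IH = insert.IH[OF H aH]
    have "\<not> connected_in H (al c) (be c)"
      using acyclic_separates[OF insert.prems(2) insertI1 edge_ends_eq[OF c]] insert.hyps by simp
    then have ns: "\<not> same ?B (al c) (be c)" using same_connected by blast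
    have d: "differ_at c ?B ?B'" by (rule subgraph_differ[OF c insert.hyps(2)])
    have s': "same ?B' (al c) (be c)" using saddle_xor[OF d] ns by blast
    have "card (circles D ?B) = Suc (card (circles D ?B'))" by (rule split_circles(4)[OF differ_at_sym[OF d] s'])
    moreover have "same ?B' x y" if xy: "x \<in> arcs D" "y \<in> arcs D" "connected_in (insert c H) x y" for x y
    proof -
      have up: "same ?B' u v" if "u \<in> arcs D" "v \<in> arcs D" "connected_in H u v" for u v
        using split_finer[OF differ_at_sym[OF d] s'] IH that by blast
      have ab: "al c \<in> arcs D" "be c \<in> arcs D" using al_be_in c by auto
      show ?thesis
        using joined_insert[OF xy(3) edge_ends_eq[OF c]] up xy(1,2) ab s' same_trans same_sym by metis
    qed
    ultimately show ?case using IH insert.hyps by simp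
  qed
  then show "card (circles D (subgraph_state H)) + card H = card S"
    "x \<in> arcs D \<Longrightarrow> y \<in> arcs D \<Longrightarrow> connected_in H x y \<Longrightarrow> same (subgraph_state H) x y" by auto
qed

lemma circles_growth:
  assumes "finite X" "X \<subseteq> {..<length D}" "X \<inter> H = {}"
  shows "card (circles D (subgraph_state (H \<union> X))) \<le> card (circles D (subgraph_state H)) + card X"
  using assms
proof (induction X)
  case (insert c X)
  have d: "differ_at c (subgraph_state (H \<union> X)) (subgraph_state (insert c (H \<union> X)))"
    by (rule subgraph_differ) (use insert in auto)
  have "card (circles D (subgraph_state (insert c (H \<union> X)))) \<le> Suc (card (circles D (subgraph_state (H \<union> X))))"
  proof (cases "same (subgraph_state (H \<union> X)) (al c) (be c)")
    case True
    then show ?thesis using split_circles(4)[OF d] by simp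
  next
    case False
    then have "same (subgraph_state (insert c (H \<union> X))) (al c) (be c)" using saddle_xor[OF d] by blast
    then show ?thesis using split_circles(4)[OF differ_at_sym[OF d]] by simp
  qed
  moreover have "card (circles D (subgraph_state (H \<union> X))) \<le> card (circles D (subgraph_state H)) + card X"
    using insert.IH insert.prems by blast
  ultimately show ?case using insert.hyps by simp
qed simp

lemma tree_one_circle:
  assumes "tait_tree D S H"
  shows "one_circle (subgraph_state H)" "Suc (card H) = card S" "H \<subseteq> {..<length D}"
proof -
  show H: "H \<subseteq> {..<length D}" using assms by (auto simp: tait_tree_def spanning_tree_def)
  have a: "acyclic_edges (edge_ends D S) H"
    using assms by (auto simp: tait_tree_def spanning_tree_def acyclic_edges_def)
  have "connected_in H x y" if "x \<in> arcs D" "y \<in> arcs D" for x y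
  proof -
    have "S \<times> S \<subseteq> joined (edge_ends D S) H" using assms by (simp add: tait_tree_def spanning_tree_def)
    moreover have "face_at True x \<in> S" "face_at True y \<in> S" using face_at_shade that by auto
    ultimately show ?thesis by blast
  qed
  then show one: "one_circle (subgraph_state H)"
    using forest_circles(2)[OF H a] subgraph_state_subset by (auto simp: one_circle_def)
  show "Suc (card H) = card S"
    using forest_circles(1)[OF H a] one by (simp add: one_circle_iff_card)
qed

text \<open>A connected subgraph contains a spanning tree; by Euler's formula every edge added to the tree
  adds a circle.\<close>

lemma one_circle_tree:
  assumes H: "H \<subseteq> {..<length D}" and one: "one_circle (subgraph_state H)"
  shows "tait_tree D S H"
proof -
  have finH: "finite H" using H finite_subset by blast
  have "is_cycle (edge_ends D S) C \<Longrightarrow> C \<noteq> {}" for C by (auto simp: is_cycle_def)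
  then have "acyclic_edges (edge_ends D S) {}" by (auto simp: acyclic_edges_def)
  \<comment> \<open>A maximal forest in \<open>H\<close> spans \<open>S\<close>, since
    \<open>H\<close> connects all faces and each further edge closes a cycle.\<close>
  then obtain F where F: "F \<subseteq> H" "acyclic_edges (edge_ends D S) F"
    and max: "\<And>F'. F' \<subseteq> H \<Longrightarrow> acyclic_edges (edge_ends D S) F' \<Longrightarrow> card F' \<le> card F"
    using ex_has_greatest_nat[of "\<lambda>F. F \<subseteq> H \<and> acyclic_edges (edge_ends D S) F" "{}" card "Suc (card H)"]
      card_mono[OF finH] by (auto simp: less_Suc_eq_le)
  have finF: "finite F" using F finH finite_subset by blast
  have con: "(u, v) \<in> joined (edge_ends D S) F" if e: "e \<in> H" "edge_ends D S e = {u, v}" for e u v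
  proof (cases "e \<in> F")
    case True then show ?thesis using joined_edge e by metis
  next
    case False
    then have "card F < card (insert e F)" using finF by simp
    then have "\<not> acyclic_edges (edge_ends D S) (insert e F)" using max[of "insert e F"] e F by auto
    then obtain C where C: "C \<subseteq> insert e F" "is_cycle (edge_ends D S) C" by (auto simp: acyclic_edges_def)
    then have "e \<in> C" using F(2) unfolding acyclic_edges_def by blast
    then have "(u, v) \<in> joined (edge_ends D S) (C - {e})" by (rule cycle_edge_joined[OF C(2) _ e(2)])
    then show ?thesis by (rule joined_mono) (use C in blast)
  qed
  have conF: "(p, q) \<in> joined (edge_ends D S) F" if "p \<in> S" "q \<in> S" for p q
  proof -
    have "p \<in> face_at True ` arcs D" "q \<in> face_at True ` arcs D"
      using that by (simp_all only: S_eq[symmetric])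
    then obtain x y where xy: "x \<in> arcs D" "y \<in> arcs D" "p = face_at True x" "q = face_at True y"
      by (elim imageE)
    then have "same (subgraph_state H) x y" using one by (simp add: one_circle_def)
    then have "connected_in H x y" by (rule same_connected)
    then show ?thesis unfolding xy by (rule joined_subset) (rule con)
  qed
  have Fn: "F \<subseteq> {..<length D}" using F(1) H by blast
  have "tait_tree D S F"
    unfolding tait_tree_def spanning_tree_def using Fn F(2) conF by (auto simp: acyclic_edges_def)
  then have cF: "Suc (card F) = card S" by (rule tree_one_circle)
  have "H \<union> ({..<length D} - H) = {..<length D}" using H by blast
  then have "card (circles D (face_state False)) \<le> card (circles D (subgraph_state H)) + card ({..<length D} - H)"
    using circles_growth[of "{..<length D} - H" H] subgraph_state_full by auto
  moreover have "card (circles D (subgraph_state H)) = 1" using one by (simp add: one_circle_iff_card)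
  moreover have "card ({..<length D} - H) = length D - card H" "card H \<le> length D"
    using H finH card_mono[of "{..<length D}" H] by (auto simp: card_Diff_subset)
  moreover have "card S = card (circles D (face_state True))" using card_colour[of True] S_eq by simp
  \<comment> \<open>The state of all edges has at most \<open>1 + length D - card H\<close> circles,
    while \<open>euler\<close> makes it \<open>length D + 2 - card S\<close>; so \<open>H\<close>
    has at most \<open>card S - 1\<close> edges.\<close>
  ultimately have "card H \<le> card F" using euler cF by linarith
  then have "F = H" using F(1) finH card_seteq by blast
  then show ?thesis using \<open>tait_tree D S F\<close> by simp
qed

lemma tree_iff_one_circle:
  "H \<subseteq> {..<length D} \<Longrightarrow> tait_tree D S H \<longleftrightarrow> one_circle (subgraph_state H)"
  using tree_one_circle one_circle_tree by blast

lemma live_iff_lives: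
  assumes T: "tait_tree D S H" and e: "e < length D"
  shows "live {..<length D} (edge_ends D S) H e \<longleftrightarrow> e \<in> lives (subgraph_state H)"
proof -
  interpret tree_in_graph S "{..<length D}" "edge_ends D S" H
  proof
    show "spanning_tree S {..<length D} (edge_ends D S) H" using T by (simp add: tait_tree_def)
    show "\<exists>x\<in>S. \<exists>y\<in>S. edge_ends D S c = {x, y}" if "c \<in> {..<length D}" for c
    proof -
      have c: "c < length D" using that by simp
      then have "face_at True (al c) \<in> S" "face_at True (be c) \<in> S"
        using face_at_shade al_be_in by auto
      then show ?thesis using edge_ends_eq[OF c] by blast
    qed
  qed
  have "tait_tree D S (sym_diff H {e, g}) \<longleftrightarrow> one_circle (sym_diff (subgraph_state H) {e, g})" if g: "g < e" for g
  proof -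
    have "{e, g} \<subseteq> {..<length D}" using e g by auto
    moreover have "sym_diff H {e, g} \<subseteq> {..<length D}" using tree_one_circle(3)[OF T] calculation by blast
    ultimately show ?thesis using tree_iff_one_circle subgraph_state_sym_diff by metis
  qed
  then show ?thesis using live_iff[of e] e unfolding lives_def tait_tree_def by auto
qed

end

section \<open>The spanning tree complex\<close>

context colored_diagram
begin

definition degree_states :: "int \<Rightarrow> int \<Rightarrow> enhanced_state set" where
  "degree_states j i = {s \<in> reduced_states D b. i_deg D s = i \<and> j_deg D s = j}"

definition boundary :: "enhanced_state \<Rightarrow> (enhanced_state \<Rightarrow>\<^sub>0 int)" where
  "boundary s = khovanov_d D (frag_of s)"

lemma frag_extend_boundary: "frag_extend boundary = khovanov_d D"
  unfolding boundary_def khovanov_d_def by simp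

lemma reduced_enhanced: "reduced_states D b \<subseteq> enhanced_states D"
  by (auto simp: reduced_states_def)

lemma step_degree_states:
  assumes "s \<in> reduced_states D b" "s' \<in> reduced_states D b" "state_step D c s s'"
  shows "s \<in> degree_states j i \<longleftrightarrow> s' \<in> degree_states j (i + 1)"
proof -
  have "i_deg D s' = i_deg D s + 1" "j_deg D s' = j_deg D s"
    using step_degrees[OF _ _ assms(3)] assms(1,2) reduced_enhanced by auto
  then show ?thesis using assms(1,2) by (auto simp: degree_states_def)
qed

lemma matched: "matched_complex (degree_states j) boundary sources targets critical mate rank"
proof
  show "finite (degree_states j i)" for i
    by (rule finite_subset[OF _ finite_enhanced]) (use reduced_enhanced in \<open>auto simp: degree_states_def\<close>)
  show "Poly_Mapping.keys (boundary s) \<subseteq> degree_states j (i + 1)" if s: "s \<in> degree_states j i" for s i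
  proof
    fix s' assume "s' \<in> Poly_Mapping.keys (boundary s)"
    then obtain c where c: "s' \<in> enhanced_states D" "state_step D c s s'"
      using khovanov_d_keys unfolding boundary_def by blast
    have sr: "s \<in> reduced_states D b" using s by (simp add: degree_states_def)
    then have "s' \<in> reduced_states D b" using step_reduced c by blast
    then show "s' \<in> degree_states j (i + 1)" using step_degree_states[OF sr _ c(2)] s by blast
  qed
  show "frag_extend boundary (frag_extend boundary x) = 0" if "Poly_Mapping.keys x \<subseteq> degree_states j i" for x i
    unfolding frag_extend_boundary using that reduced_enhanced
    by (intro khovanov_d_twice) (auto simp: degree_states_def)
  show "degree_states j i \<subseteq> sources \<union> targets \<union> critical" for i
    using reduced_partition(1) by (auto simp: degree_states_def)
  show "sources \<inter> targets = {}" "sources \<inter> critical = {}" "targets \<inter> critical = {}"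
    by (rule reduced_partition)+
  have deg: "s \<in> degree_states j i \<longleftrightarrow> mate s \<in> degree_states j (i + 1)" if s: "s \<in> sources" for s i
    using step_degree_states[OF _ _ source_mate(2)[OF s]] s source_mate(1)[OF s] reduced_partition(1) by blast
  show "mate s \<in> targets \<and> mate s \<in> degree_states j (i + 1)" if "s \<in> sources" "s \<in> degree_states j i" for s i
    using source_mate(1) deg that by blast
  show "\<exists>s. s \<in> sources \<and> s \<in> degree_states j i \<and> mate s = t" if t: "t \<in> targets" "t \<in> degree_states j (i + 1)" for t i
    using target_unmate[OF t(1)] deg t(2) by blast
  show "\<bar>Poly_Mapping.lookup (boundary s) (mate s)\<bar> = 1" if "s \<in> sources" "s \<in> degree_states j i" for s i
  proof -
    have "mate s \<in> enhanced_states D" using source_mate(1)[OF that(1)] reduced_partition(1) reduced_enhanced by blast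
    then show ?thesis unfolding boundary_def using khovanov_d_coeff source_mate(2)[OF that(1)] by auto
  qed
  show "rank s < rank s'" if "s \<in> sources" "s \<in> degree_states j i" "s' \<in> sources" "s' \<in> degree_states j i" "s \<noteq> s'"
    "Poly_Mapping.lookup (boundary s) (mate s') \<noteq> 0" for s s' i
  proof -
    have "\<exists>c. state_step D c s (mate s')"
      using that(6) khovanov_d_keys(2) unfolding boundary_def in_keys_iff[symmetric] by blast
    then show ?thesis using mate_rank that by blast
  qed
qed

lemma reduced_khovanov_homology:
  "reduced_khovanov D b i j =
   homology_at (free_Abelian_group (degree_states j (i - 1))) (frag_extend boundary)
     (free_Abelian_group (degree_states j i)) (frag_extend boundary) (free_Abelian_group (degree_states j (i + 1)))"
  unfolding reduced_khovanov_def reduced_chains_def frag_extend_boundary degree_states_def ..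

abbreviation "tree_complex j \<equiv> matched_complex.reduced (degree_states j) boundary sources"
abbreviation "tree_bd j \<equiv> matched_complex.reduced_bd (degree_states j) boundary sources"

lemma row_complex_trees: "row_complex (tree_complex j) (\<lambda>i. reduced_khovanov D b i j) (tree_bd j)"
  unfolding reduced_khovanov_homology by (rule matched_complex.row_complex_reduced[OF matched])

lemma tree_complex_iso: "tree_complex j i \<cong> free_Abelian_group (critical \<inter> degree_states j i)"
  by (rule matched_complex.reduced_iso[OF matched])

text \<open>With one crossing the only other state is obtained by switching it, which splits the
  circle.\<close>

lemma few_crossings_one_tree:
  assumes n: "length D < 2" and T: "one_circle T" "one_circle T'"
  shows "T = T'"
proof (rule ccontr)
  assume ne: "T \<noteq> T'"
  have sub: "T \<subseteq> {..<length D}" "T' \<subseteq> {..<length D}" using T by (auto simp: one_circle_def)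
  obtain c where c: "c \<in> sym_diff T T'" using ne by blast
  then have "c < length D" using sub by blast
  moreover from this have "{..<length D} = {c}" using n by auto
  ultimately have "sym_diff T {c} = T'" using c sub by blast
  then show False using flip_two(1)[OF T(1) \<open>c < length D\<close>] T(2) al_be_in[OF \<open>c < length D\<close>]
    by (simp add: one_circle_def)
qed

text \<open>There is only one critical state, and it cannot be present in two successive
  degrees.\<close>

lemma few_crossings_trivial_bd:
  assumes n: "length D < 2" and U: "U \<in> carrier (tree_complex j p)"
  shows "tree_bd j p U = \<one>\<^bsub>tree_complex j (p + 1)\<^esub>"
proof -
  interpret row_complex "tree_complex j" "\<lambda>i. reduced_khovanov D b i j" "tree_bd j" by (rule row_complex_trees)
  have grp: "group (tree_complex j i)" for i using A comm_group_def by blast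
  have "s = s'" if "s \<in> critical" "s' \<in> critical" for s s'
  proof -
    have "tree_state ` {T. one_circle T} = critical" using tree_state_bij by (simp add: bij_betw_def)
    then have "s \<in> tree_state ` {T. one_circle T}" "s' \<in> tree_state ` {T. one_circle T}"
      using that by simp_all
    then obtain T T' where "one_circle T" "s = tree_state T" "one_circle T'" "s' = tree_state T'" by blast
    then show ?thesis using few_crossings_one_tree[OF n, of T T'] by simp
  qed
  moreover have "degree_states j p \<inter> degree_states j (p + 1) = {}" by (auto simp: degree_states_def)
  ultimately have "critical \<inter> degree_states j p = {} \<or> critical \<inter> degree_states j (p + 1) = {}" by blast
  moreover have triv: "trivial_group (tree_complex j i)" if "critical \<inter> degree_states j i = {}" for i
  proof -
    have "carrier (free_Abelian_group (critical \<inter> degree_states j i)) \<subseteq> {0}" using that by auto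
    then have "trivial_group (free_Abelian_group (critical \<inter> degree_states j i))"
      using group.trivial_group_alt[OF group_free_Abelian_group] by blast
    moreover have "free_Abelian_group (critical \<inter> degree_states j i) \<cong> tree_complex j i"
      using tree_complex_iso group.iso_sym grp by blast
    ultimately show ?thesis using isomorphic_group_triviality1[OF _ grp] by blast
  qed
  ultimately show ?thesis
  proof (elim disjE)
    assume "critical \<inter> degree_states j p = {}"
    then have "U = \<one>\<^bsub>tree_complex j p\<^esub>" using triv[of p] U by (simp add: trivial_group_def)
    then show ?thesis using hom_one[OF hom grp grp] by simp
  next
    assume "critical \<inter> degree_states j (p + 1) = {}"
    then have "carrier (tree_complex j (p + 1)) = {\<one>\<^bsub>tree_complex j (p + 1)\<^esub>}"
      using triv[of "p + 1"] by (simp add: trivial_group_def)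
    then show ?thesis using hom_in_carrier[OF hom U] by blast
  qed
qed

section \<open>Degrees of critical states and activities of trees\<close>

lemma activity_sum:
  "int (card {e. e < length D \<and> Q e}) = (\<Sum>e<length D. if Q e then 1 else 0)"
proof -
  have "{e. e < length D \<and> Q e} = {e \<in> {..<length D}. Q e}" by auto
  then show ?thesis by (simp add: sum.If_cases Int_def)
qed

text \<open>From \<open>i_deg = (writhe D - length D) div 2 + card B\<close> for the critical state.
  Expressing \<open>card B\<close> by \<open>u\<close> and \<open>v\<close> leaves the number of
  positive edges and the number \<open>card S - 1\<close> of tree edges.\<close>

definition i_shift :: int where
  "i_shift = (writhe D - int (length D)) div 2 + int (card {c. c < length D \<and> pos_edge D S c}) + int (card S) - 1"

definition j_shift :: int where
  "j_shift = i_shift + writhe D - 1"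

lemma tree_degrees:
  assumes H: "tait_tree D S H"
  shows "i_deg D (tree_state (subgraph_state H)) = tree_u D S H - 2 * tree_v D S H + i_shift"
    "j_deg D (tree_state (subgraph_state H)) = 2 * tree_u D S H - 2 * tree_v D S H + j_shift"
proof -
  let ?T = "subgraph_state H" and ?n = "length D"
  let ?L = "lives ?T" and ?s = "tree_state (subgraph_state H)"
  note T = tree_one_circle[OF H]
  define lv where "lv e = live {..<?n} (edge_ends D S) H e" for e
  define ps where "ps e = pos_edge D S e" for e
  have L: "e \<in> ?L \<longleftrightarrow> lv e" and inT: "e \<in> ?T \<longleftrightarrow> (e \<in> H) \<noteq> ps e" if "e < ?n" for e
    using live_iff_lives[OF H that] pos_edge_iff[OF that] that by (simp_all add: lv_def ps_def subgraph_state_def)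
  have Ln: "?L \<subseteq> {..<?n}" and Tn: "?T \<subseteq> {..<?n}" using lives_less subgraph_state_subset by auto
  define B where "B = sym_diff ?T ?L"
  have Bn: "B \<subseteq> {..<?n}" using Ln Tn by (auto simp: B_def)
  have cB: "int (card B) = (\<Sum>e<?n. if ((e \<in> H) \<noteq> ps e) \<noteq> lv e then 1 else 0)"
  proof -
    have "B = {e. e < ?n \<and> ((e \<in> H) \<noteq> ps e) \<noteq> lv e}" unfolding B_def using L inT Ln Tn by blast
    then show ?thesis using activity_sum by metis
  qed
  have cL: "int (card ?L) = (\<Sum>e<?n. if lv e then 1 else 0)"
  proof -
    have "?L = {e. e < ?n \<and> lv e}" using L Ln by blast
    then show ?thesis using activity_sum by metis
  qed
  have cLT: "int (card (?L \<inter> ?T)) = (\<Sum>e<?n. if lv e \<and> (e \<in> H) \<noteq> ps e then 1 else 0)"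
  proof -
    have "?L \<inter> ?T = {e. e < ?n \<and> lv e \<and> (e \<in> H) \<noteq> ps e}" using L inT Ln by blast
    then show ?thesis using activity_sum by metis
  qed
  have cH: "int (card H) = (\<Sum>e<?n. if e \<in> H then 1 else 0)"
  proof -
    have "H = {e. e < ?n \<and> e \<in> H}" using T(3) by blast
    then show ?thesis using activity_sum by metis
  qed
  have cP: "int (card {c. c < ?n \<and> ps c}) = (\<Sum>e<?n. if ps e then 1 else 0)" by (rule activity_sum)
  have ac: "activity_count D S H i p l = (\<Sum>e<?n. if (e \<in> H) = i \<and> ps e = p \<and> lv e = l then 1 else 0)" for i p l
    unfolding activity_count_def lv_def ps_def by (rule activity_sum)
  \<comment> \<open>Edge by edge: a live edge counts \<open>-1\<close> if it is in
    \<open>?T\<close>, that is, internal and negative or external and positive, and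
    \<open>+1\<close> otherwise.\<close>
  have u: "tree_u D S H = int (card ?L) - 2 * int (card (?L \<inter> ?T))"
    unfolding tree_u_def ac cL cLT sum_distrib_left sum_subtractf[symmetric] sum.distrib[symmetric]
    by (rule sum.cong) auto
  \<comment> \<open>Checked for each of the eight letters: \<open>B\<close> consists of the edges
    with letter L, d, and with a bar D and l.\<close>
  have b: "int (card B) = tree_u D S H - 2 * tree_v D S H + int (card {c. c < ?n \<and> ps c}) + int (card H)"
    unfolding tree_u_def tree_v_def ac cB cP cH sum_distrib_left sum_subtractf[symmetric] sum.distrib[symmetric]
    by (rule sum.cong) auto
  have fs: "fst ?s = B" using tree_state_counts(1)[OF T(1)] by (simp add: B_def)
  have "card ({..<?n} - B) = ?n - card B" "card B \<le> ?n"
    using Bn finite_subset[OF Bn] card_mono[OF _ Bn] by (auto simp: card_Diff_subset)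
  then have "sigma D ?s = int ?n - 2 * int (card B)" by (simp add: sigma_def fs)
  then have "writhe D - sigma D ?s = (writhe D - int ?n) + 2 * int (card B)" by simp
  then have "i_deg D ?s = (writhe D - int ?n) div 2 + int (card B)" by (simp add: i_deg_def)
  moreover have "int (card H) = int (card S) - 1" using T(2) by simp
  ultimately show i: "i_deg D ?s = tree_u D S H - 2 * tree_v D S H + i_shift"
    using b by (simp add: i_shift_def ps_def)
  have sub: "snd ?s \<subseteq> circles D (fst ?s)"
  proof -
    have "?s \<in> critical" using tree_state_bij T(1) unfolding bij_betw_def by blast
    then show ?thesis unfolding critical_def reduced_states_def enhanced_states_def by (auto simp: case_prod_beta)
  qed
  have "card (circles D (fst ?s) - snd ?s) = card (circles D (fst ?s)) - card (snd ?s)"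
    "card (snd ?s) \<le> card (circles D (fst ?s))"
    using sub finite_circles finite_subset[OF sub] by (auto simp: card_Diff_subset card_mono)
  then have "tau D ?s = 2 * int (card (snd ?s)) - int (card (circles D (fst ?s)))" by (simp add: tau_def)
  then have "tau D ?s = 1 - tree_u D S H" using tree_state_counts[OF T(1)] u by simp
  then show "j_deg D ?s = 2 * tree_u D S H - 2 * tree_v D S H + j_shift"
    using i by (simp add: j_deg_def j_shift_def)
qed

definition degree_trees :: "int \<Rightarrow> int \<Rightarrow> nat set set" where
  "degree_trees i j = {H. tait_tree D S H \<and> i = tree_u D S H - 2 * tree_v D S H + i_shift \<and>
     j = 2 * tree_u D S H - 2 * tree_v D S H + j_shift}"

lemma trees_critical: "critical \<inter> degree_states j i \<approx> degree_trees i j"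
proof -
  have "bij_betw (tree_state \<circ> subgraph_state) (degree_trees i j) (critical \<inter> degree_states j i)"
  proof (rule bij_betw_imageI)
    have inj: "inj_on tree_state {T. one_circle T}" and img: "tree_state ` {T. one_circle T} = critical"
      using tree_state_bij by (auto simp: bij_betw_def)
    show "inj_on (tree_state \<circ> subgraph_state) (degree_trees i j)"
    proof (rule inj_onI)
      fix H H' assume H: "H \<in> degree_trees i j" "H' \<in> degree_trees i j"
        and eq: "(tree_state \<circ> subgraph_state) H = (tree_state \<circ> subgraph_state) H'"
      note T = tree_one_circle[of H] tree_one_circle[of H']
      have "subgraph_state H = subgraph_state H'"
        using inj_onD[OF inj] eq H T by (simp add: degree_trees_def)
      then show "H = H'" using subgraph_state_twice T H by (metis (mono_tags, lifting) degree_trees_def mem_Collect_eq)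
    qed
    show "(tree_state \<circ> subgraph_state) ` degree_trees i j = critical \<inter> degree_states j i"
    proof
      show "(tree_state \<circ> subgraph_state) ` degree_trees i j \<subseteq> critical \<inter> degree_states j i"
      proof
        fix s assume "s \<in> (tree_state \<circ> subgraph_state) ` degree_trees i j"
        then obtain H where H: "H \<in> degree_trees i j" "s = tree_state (subgraph_state H)" by auto
        then have t: "tait_tree D S H" by (simp add: degree_trees_def)
        have c: "s \<in> critical" using img tree_one_circle(1)[OF t] H(2) by blast
        then have "s \<in> reduced_states D b" by (simp add: critical_def)
        then show "s \<in> critical \<inter> degree_states j i"
          using c tree_degrees[OF t] H by (simp add: degree_states_def degree_trees_def)
      qed
      show "critical \<inter> degree_states j i \<subseteq> (tree_state \<circ> subgraph_state) ` degree_trees i j"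
      proof
        fix s assume s: "s \<in> critical \<inter> degree_states j i"
        then obtain T where T: "one_circle T" "s = tree_state T" using img by blast
        define H where "H = subgraph_state T"
        have TH: "subgraph_state H = T" unfolding H_def using T(1) by (intro subgraph_state_twice) (simp add: one_circle_def)
        have "H \<subseteq> {..<length D}" unfolding H_def by (rule subgraph_state_subset)
        then have t: "tait_tree D S H" using tree_iff_one_circle TH T(1) by simp
        have "H \<in> degree_trees i j" using tree_degrees[OF t] t s T(2) TH by (simp add: degree_trees_def degree_states_def)
        then show "s \<in> (tree_state \<circ> subgraph_state) ` degree_trees i j" using T(2) TH by force
      qed
    qed
  qed
  then show ?thesis by (meson eqpoll_def eqpoll_sym)
qed

text \<open>The difference \<open>j - i\<close> determines \<open>u\<close>, and then
  \<open>i\<close> determines \<open>v\<close>, so the sum has at most one summand. It is empty if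
  no integer \<open>v\<close> exists.\<close>

lemma tree_groups_sum:
  "sum_group {(u, v). i = u - 2 * v + i_shift \<and> j = 2 * u - 2 * v + j_shift} (\<lambda>(u, v). tree_group D S u v)
    \<cong> free_Abelian_group (degree_trees i j)"
proof -
  let ?I = "{(u, v). i = u - 2 * v + i_shift \<and> j = 2 * u - 2 * v + j_shift}"
  let ?Y = "\<lambda>(u, v). {T. tait_tree D S T \<and> tree_u D S T = u \<and> tree_v D S T = v}"
  have "(\<lambda>f. sum' f ?I) \<in> iso (sum_group ?I (\<lambda>p. free_Abelian_group (?Y p))) (free_Abelian_group (\<Union> (?Y ` ?I)))"
    by (rule iso_free_Abelian_group_sum) (auto simp: pairwise_def disjnt_def)
  moreover have "\<Union> (?Y ` ?I) = degree_trees i j" by (auto simp: degree_trees_def)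
  moreover have "(\<lambda>p. free_Abelian_group (?Y p)) = (\<lambda>(u, v). tree_group D S u v)"
    by (auto simp: tree_group_def)
  ultimately show ?thesis by (auto simp: is_iso_def)
qed

text \<open>Only \<open>p = i\<close> contributes, because \<open>q = i - p\<close> has to be the
  single row.\<close>

lemma first_page_sum:
  "sum_group UNIV (\<lambda>p. row_page (tree_complex j) (\<lambda>i. reduced_khovanov D b i j) 1 p (i - p))
    \<cong> free_Abelian_group (critical \<inter> degree_states j i)"
proof -
  let ?E = "\<lambda>p. row_page (tree_complex j) (\<lambda>i. reduced_khovanov D b i j) 1 p (i - p)"
  let ?Y = "\<lambda>p. if p = i then critical \<inter> degree_states j i else {}"
  have "sum_group UNIV ?E \<cong> sum_group UNIV (\<lambda>p. free_Abelian_group (?Y p))"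
  proof (rule iso_sum_groupI)
    fix p
    show "group (?E p)" by (rule row_complex.page_group[OF row_complex_trees])
    show "group (free_Abelian_group (?Y p))" by simp
    show "?E p \<cong> free_Abelian_group (?Y p)"
    proof (cases "p = i")
      case True
      then show ?thesis using tree_complex_iso by (simp add: row_page_def)
    next
      case False
      have "carrier (free_Abelian_group ({} :: enhanced_state set)) \<subseteq> {0}" by auto
      then have "trivial_group (free_Abelian_group ({} :: enhanced_state set))"
        using group.trivial_group_alt[OF group_free_Abelian_group] by blast
      then show ?thesis using False trivial_groups_iso[OF trivial_singleton_group] by (simp add: row_page_def)
    qed
  qed
  moreover have "(\<lambda>f. sum' f UNIV) \<in> iso (sum_group UNIV (\<lambda>p. free_Abelian_group (?Y p))) (free_Abelian_group (\<Union> (range ?Y)))"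
    by (rule iso_free_Abelian_group_sum) (auto simp: pairwise_def disjnt_def)
  moreover have "\<Union> (range ?Y) = critical \<inter> degree_states j i" by auto
  ultimately show ?thesis using iso_trans unfolding is_iso_def by fastforce
qed

lemma first_page_trees:
  "sum_group UNIV (\<lambda>p. row_page (tree_complex j) (\<lambda>i. reduced_khovanov D b i j) 1 p (i - p)) \<cong>
   sum_group {(u, v). i = u - 2 * v + i_shift \<and> j = 2 * u - 2 * v + j_shift} (\<lambda>(u, v). tree_group D S u v)"
proof -
  have "free_Abelian_group (critical \<inter> degree_states j i) \<cong> free_Abelian_group (degree_trees i j)"
    using trees_critical isomorphic_free_Abelian_groups by blast
  moreover have "group (sum_group {(u, v). i = u - 2 * v + i_shift \<and> j = 2 * u - 2 * v + j_shift} (\<lambda>(u, v). tree_group D S u v))"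
    by (rule sum_group) (auto simp: tree_group_def)
  ultimately show ?thesis using first_page_sum tree_groups_sum group.iso_sym iso_trans by meson
qed

end

text \<open>The differential preserves \<open>j\<close>, so \<open>j\<close> indexes a family of
  spectral sequences. The witnesses for \<open>k\<close> and \<open>l\<close> are
  \<open>i_shift\<close> and \<open>j_shift\<close>, constants of the coloured diagram.\<close>

theorem theorem5:
  fixes D :: gauss_code and b :: nat and S :: "(nat \<times> bool) set set"
  assumes "knot_diagram D"
    and "b \<in> arcs D"
    and "tait_coloring D S"
  shows "\<exists>(E :: int \<Rightarrow> nat \<Rightarrow> int \<Rightarrow> int \<Rightarrow> (enhanced_state \<Rightarrow>\<^sub>0 int) set monoid) d.
      (\<forall>j. spectral_sequence (E j) (d j) \<and>
           converges_to (E j) (d j) (\<lambda>i. reduced_khovanov D b i j)) \<and>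
      (\<exists>k l. \<forall>i j.
         sum_group UNIV (\<lambda>p. E j 1 p (i - p)) \<cong>
         sum_group {(u, v). i = u - 2 * v + k \<and> j = 2 * u - 2 * v + l}
           (\<lambda>(u, v). tree_group D S u v)) \<and>
      (\<exists>r \<le> length D. \<forall>j. collapses_at (E j) (d j) r)"
proof -
  interpret colored_diagram D b S
    using assms by (simp add: colored_diagram_def tait_coloring_def)
  define E where "E j = row_page (tree_complex j) (\<lambda>i. reduced_khovanov D b i j)" for j
  define d where "d j = row_diff (tree_complex j) (\<lambda>i. reduced_khovanov D b i j) (tree_bd j)" for j
  have "spectral_sequence (E j) (d j) \<and> converges_to (E j) (d j) (\<lambda>i. reduced_khovanov D b i j)" for j
    unfolding E_def d_def using row_complex.spectral[OF row_complex_trees] row_complex.converges[OF row_complex_trees] by blast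
  moreover have "sum_group UNIV (\<lambda>p. E j 1 p (i - p)) \<cong>
      sum_group {(u, v). i = u - 2 * v + i_shift \<and> j = 2 * u - 2 * v + j_shift} (\<lambda>(u, v). tree_group D S u v)" for i j
    unfolding E_def by (rule first_page_trees)
  moreover have "\<exists>r \<le> length D. \<forall>j. collapses_at (E j) (d j) r"
  proof (cases "length D < 2")
    case True
    have "collapses_at (E j) (d j) 0" for j
      unfolding E_def d_def by (rule row_complex.collapses_0[OF row_complex_trees few_crossings_trivial_bd[OF True]])
    then show ?thesis by blast
  next
    case False
    have "collapses_at (E j) (d j) 2" for j
      unfolding E_def d_def by (rule row_complex.collapses_2[OF row_complex_trees])
    then show ?thesis using False by (intro exI[of _ 2]) auto
  qed
  ultimately show ?thesis by blast
qed

end
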